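(* For any Local Learning Process $(X_n,A_n,\beta_n)_{n\ge0}$ in Model 2 (both defined in the context), the limit $$\alpha:=\lim_{n\to+\infty}\frac1n\sum_{i=1}^n\mathbf I(A_i=r)$$ exists almost surely and is constant. Therefore $$\lim_{n\to+\infty}\frac{X_n}{n}=\alpha\, d(\mu_r)+(1-\alpha)\,d(\mu_g)\quad\text{a.s.}$$
   Context: $\mathbf I(\cdot)$ is the indicator. For a probability measure $\mu$ on $\mathbb Z^2$ with $\mathbb E_\mu(\|\xi\|)<\infty$, its drift is $d(\mu)=\mathbb E_\mu(\xi)\in\mathbb R^2$. Model 2. $\mathcal S=\mathbb Z^2$, $\mathcal A=\{r,g\}$, and the transition probabilities are $p(x+\xi\mid x,a)=\mu_a(\xi)$ for all $x,\xi\in\mathbb Z^2$ and $a\in\{r,g\}$, where $\mu_r,\mu_g$ are two fixed probability measures on $\mathbb Z^2$ such that: for some $c>0$, $\mathbb E_{\mu_a}(\exp(c\|\xi\|))<+\infty$ for $a=r$ and $a=g$; and there exists a unit vector $l\in\mathbb R^2$ such that $\varrho:=\min\{\langle d(\mu_r),l\rangle,\langle d(\mu_g),l\rangle\}>0$. Local Learning Process (LLP). This is a discrete-time process $(X_n,A_n,\beta_n)_{n\ge0}$ with $X_n\in\mathcal S$, $A_n\in\mathcal A$, $\beta_n:\mathcal S\times\mathcal A\to\mathbb R$ (the environment at time $n$), determined by an initial state $X_0\in\mathcal S$, an initial environment $\beta_0$, a decision rule $\varphi$ (assigning to each function $b:\mathcal A\to\mathbb R$ a probability measure $\varphi(\cdot\mid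 b)$ on $\mathcal A$) and a real-valued update rule $\psi$, through: (i) given the past, $A_n\sim\varphi(\cdot\mid\beta_n(X_n,\cdot))$; (ii) given the past and $A_n$, $X_{n+1}\sim p(\cdot\mid X_n,A_n)$; (iii) $\beta_{n+1}(X_n,A_n)=\psi(\beta_n(X_n,\cdot),\beta_n(X_{n+1},\cdot),X_{n+1}-X_n,A_n)$, and $\beta_{n+1}(x,a)=\beta_n(x,a)$ for $(x,a)\ne(X_n,A_n)$. It is required that $\varphi(a\mid\beta_0(x,\cdot))>0$ for all $x\in\mathcal S,a\in\mathcal A$, and that $\beta_0(x,\cdot)=\beta_0(y,\cdot)$ for all $x,y\in\mathcal S$. *)

theory Defs
  imports "HOL-Probability.Probability"
begin

text \<open>\<^bold>\<open>Local Learning Processes.\<close>  The transition probabilities are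
  \<open>p x a = p(\<cdot> | x, a)\<close>, and \<open>\<phi> b = \<phi>(\<cdot> | b)\<close>.\<close>

definition env_algebra :: "('s \<Rightarrow> 'a \<Rightarrow> real) measure" where
  "env_algebra = Pi\<^sub>M UNIV (\<lambda>_. Pi\<^sub>M UNIV (\<lambda>_. borel))"

text \<open>The past before the \<open>n\<close>-th action is chosen is generated by \<open>X\<^sub>0, \<dots>, X\<^sub>n\<close>,
  \<open>A\<^sub>0, \<dots>, A\<^sub>n\<^sub>-\<^sub>1\<close>, \<open>\<beta>\<^sub>0, \<dots>, \<beta>\<^sub>n\<close>, i.e. by \<open>past M X A \<beta> n n\<close>;
  adding \<open>A\<^sub>n\<close> gives \<open>past M X A \<beta> n (Suc n)\<close>.\<close>

definition past ::
  "'w measure \<Rightarrow> (nat \<Rightarrow> 'w \<Rightarrow> 's) \<Rightarrow> (nat \<Rightarrow> 'w \<Rightarrow> 'a) \<Rightarrow>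
    (nat \<Rightarrow> 'w \<Rightarrow> 's \<Rightarrow> 'a \<Rightarrow> real) \<Rightarrow> nat \<Rightarrow> nat \<Rightarrow> 'w measure" where
  "past M X A \<beta> n m = sigma (space M)
     ({X k -` B \<inter> space M | k B. k \<le> n} \<union>
      {A k -` B \<inter> space M | k B. k < m} \<union>
      {\<beta> k -` B \<inter> space M | k B. k \<le> n \<and> B \<in> sets env_algebra})"

locale local_learning_process = prob_space M
  for M :: "'w measure"
    and p :: "'s::{group_add, countable} \<Rightarrow> 'a::{finite, countable} \<Rightarrow> 's pmf"
    and x0 :: 's
    and b0 :: "'s \<Rightarrow> 'a \<Rightarrow> real"
    and \<phi> :: "('a \<Rightarrow> real) \<Rightarrow> 'a pmf"
    and \<psi> :: "('a \<Rightarrow> real) \<Rightarrow> ('a \<Rightarrow> real) \<Rightarrow> 's \<Rightarrow> 'a \<Rightarrow> real"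
    and X :: "nat \<Rightarrow> 'w \<Rightarrow> 's"
    and A :: "nat \<Rightarrow> 'w \<Rightarrow> 'a"
    and \<beta> :: "nat \<Rightarrow> 'w \<Rightarrow> 's \<Rightarrow> 'a \<Rightarrow> real" +
  assumes X_measurable: "\<And>n. X n \<in> measurable M (count_space UNIV)"
    and A_measurable: "\<And>n. A n \<in> measurable M (count_space UNIV)"
    and env_measurable: "\<And>n. \<beta> n \<in> measurable M env_algebra"
    and X_init: "AE \<omega> in M. X 0 \<omega> = x0"
    and env_init: "AE \<omega> in M. \<beta> 0 \<omega> = b0"
    and decision: "\<And>n a. AE \<omega> in M.
      real_cond_exp M (past M X A \<beta> n n) (indicator {\<omega> \<in> space M. A n \<omega> = a}) \<omega>
        = pmf (\<phi> (\<beta> n \<omega> (X n \<omega>))) a"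
    and transition: "\<And>n y. AE \<omega> in M.
      real_cond_exp M (past M X A \<beta> n (Suc n)) (indicator {\<omega> \<in> space M. X (Suc n) \<omega> = y}) \<omega>
        = pmf (p (X n \<omega>) (A n \<omega>)) y"
    and update: "\<And>n. AE \<omega> in M. \<forall>x a. \<beta> (Suc n) \<omega> x a =
      (if (x, a) = (X n \<omega>, A n \<omega>)
       then \<psi> (\<beta> n \<omega> (X n \<omega>)) (\<beta> n \<omega> (X (Suc n) \<omega>)) (X (Suc n) \<omega> - X n \<omega>) (A n \<omega>)
       else \<beta> n \<omega> x a)"
    and decision_init_pos: "\<And>x a. pmf (\<phi> (b0 x)) a > 0"
    and env_init_homogeneous: "\<And>x y. b0 x = b0 y"
begin

lemma subalgebra_past: "subalgebra M (past M X A \<beta> n m)"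
proof -
  let ?G = "{X k -` B \<inter> space M | k B. k \<le> n} \<union>
      {A k -` B \<inter> space M | k B. k < m} \<union>
      {\<beta> k -` B \<inter> space M | k B. k \<le> n \<and> B \<in> sets env_algebra}"
  have "?G \<subseteq> sets M"
    using measurable_sets[OF X_measurable] measurable_sets[OF A_measurable]
      measurable_sets[OF env_measurable] by auto
  then have "sigma_sets (space M) ?G \<subseteq> sets M"
    by (rule sets.sigma_sets_subset)
  moreover have "?G \<subseteq> Pow (space M)" by auto
  ultimately show ?thesis
    unfolding subalgebra_def past_def by simp
qed

end

text \<open>\<^bold>\<open>Model 2.\<close>  States are the points of \<open>int \<times> int\<close>; norm and inner product
  are those of \<open>real \<times> real\<close>, which are the Euclidean ones.\<close>

datatype action = Red | Green

instance action :: countable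
  by countable_datatype

lemma UNIV_action: "(UNIV :: action set) = {Red, Green}"
  by (auto intro: action.exhaust)

instance action :: finite
  by standard (simp add: UNIV_action)

definition real_point :: "int \<times> int \<Rightarrow> real \<times> real" where
  "real_point x = (real_of_int (fst x), real_of_int (snd x))"

definition drift :: "(int \<times> int) pmf \<Rightarrow> real \<times> real" where
  "drift \<nu> = measure_pmf.expectation \<nu> real_point"

definition model2 :: "(action \<Rightarrow> (int \<times> int) pmf) \<Rightarrow> bool" where
  "model2 \<mu> \<longleftrightarrow>
     (\<exists>c>0. \<forall>a. integrable (measure_pmf (\<mu> a)) (\<lambda>\<xi>. exp (c * norm (real_point \<xi>)))) \<and>
     (\<exists>l. norm l = 1 \<and> min (drift (\<mu> Red) \<bullet> l) (drift (\<mu> Green) \<bullet> l) > 0)"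

definition model2_transition ::
  "(action \<Rightarrow> (int \<times> int) pmf) \<Rightarrow> int \<times> int \<Rightarrow> action \<Rightarrow> (int \<times> int) pmf" where
  "model2_transition \<mu> x a = map_pmf (\<lambda>\<xi>. x + \<xi>) (\<mu> a)"

lemma pmf_model2_transition: "pmf (model2_transition \<mu> x a) (x + \<xi>) = pmf (\<mu> a) \<xi>"
  unfolding model2_transition_def by (rule pmf_map_inj') (simp add: inj_on_def)

end

theory Submission
  imports Defs
begin

text \<open>The process renews itself. Let \<open>u\<close> be a unit vector along which both drifts are
positive, and call \<open>real_point x \<bullet> u\<close> the level of the site \<open>x\<close>.
A time is a regeneration time if the level of the walker is then strictly larger than ever before
and never becomes smaller afterwards. Every update changes the environment only at the site just
occupied, and before a regeneration time all these sites lie strictly below the level reached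
then. Hence from a regeneration time on the walker meets only sites whose environment is still the
initial one, and since the initial environment and the laws of the increments are the same
everywhere, the future is a fresh copy of the process, conditioned never to go below its starting
level. For finite paths this is one identity: the probability of \<open>g @ h\<close> is the
product of the probabilities of \<open>g\<close> and \<open>h\<close> whenever \<open>g\<close>
ends in a strict record and \<open>h\<close> never goes below its start
(\<open>path_prob_fresh_start\<close>). Everything about action frequencies follows from this
identity and from three properties of the level: it tends to infinity, it has a positive
probability of never going below its start, and the expected number of its records up to time
\<open>n\<close> grows linearly.

The identity makes the pieces of path between consecutive regeneration times independent and
identically distributed (\<open>prob_next_block\<close>), so the frequency of \<open>Red\<close>
is asymptotically a ratio of two sums over such blocks and converges to a constant, provided that
the blocks have finite mean length. That mean is finite for a reason that needs no estimate on
single blocks: the events that \<open>k\<close> is the last regeneration time up to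
\<open>n\<close> are disjoint for different \<open>k\<close>, and their probabilities are, up to a
constant factor, products of the probability of a record at \<open>k\<close> and of a tail of the
block length (\<open>renewal_inequality\<close>). As the expected number of records grows
linearly, the tails must be summable (\<open>summable_isolated\<close>). Only the first moment is
obtained in this way, so the strong law of large numbers is proved in Etemadi's form, by
truncation along geometric subsequences. Regeneration times exist because, whatever happened so
far, the next record is a regeneration time with a probability bounded away from zero
(\<open>AE_regen_exists\<close>).

The three properties of the level come from the drift. For small \<open>\<theta> > 0\<close> the
expectation of \<open>exp (- \<theta> * \<dots>)\<close> of an increment of the level is at most
some \<open>\<gamma> < 1\<close> for both actions, which gives transience and a positive
probability of no return; comparing the mean of the level with its running maximum gives the
growth of the number of records.

For the position, \<open>X n\<close> minus the sum of the drifts of the chosen actions is a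
martingale whose increments have bounded fourth moments, hence is \<open>o(n)\<close>
(\<open>martingale_strong_law\<close>), and the sum of the drifts is controlled by the action
frequencies.\<close>

section \<open>Strong law of large numbers for nonnegative variables\<close>

text \<open>A geometric sum is comparable to its largest term, and here the largest term is below
\<open>x\<close>. With the next lemma this makes both error terms of a truncation at levels of
order \<open>a ^ n\<close> summable over \<open>n\<close>, with a sum of order \<open>x\<close>;
that is why a first moment suffices for the strong law.\<close>
lemma sum_powers_below_le:
  fixes a x :: real
  assumes a: "a > 1" and x: "x \<ge> 0"
  shows "(\<Sum>n<N. if a ^ n < x then a ^ n else 0) \<le> a / (a - 1) * x"
proof -
  let ?F = "{n\<in>{..<N}. a ^ n < x}"
  have fin: "finite ?F" by simp
  have eq: "(\<Sum>n<N. if a ^ n < x then a ^ n else 0) = (\<Sum>n\<in>?F. a ^ n)"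
    by (rule sum.inter_filter[symmetric]) simp
  show ?thesis
  proof (cases "?F = {}")
    case True
    then show ?thesis unfolding eq True using a x by simp
  next
    case False
    define m where "m = Max ?F"
    have m: "m \<in> ?F" unfolding m_def using fin False by (rule Max_in)
    have "(\<Sum>n\<in>?F. a ^ n) \<le> (\<Sum>n\<le>m. a ^ n)"
      using a fin by (intro sum_mono2) (auto simp: m_def)
    also have "\<dots> = (a ^ Suc m - 1) / (a - 1)"
      using a geometric_sum[of a "Suc m"] by (simp only: lessThan_Suc_atMost)
    also have "\<dots> \<le> a / (a - 1) * x"
      using a m by (auto simp: divide_simps intro: order.trans[of _ "a * a^m"])
    finally show ?thesis unfolding eq .
  qed
qed

lemma sum_inverse_powers_above_le:
  fixes a x :: real
  assumes a: "a > 1" and x: "x > 0"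
  shows "(\<Sum>n<N. if x \<le> a ^ n then 1 / a ^ n else 0) \<le> a / (a - 1) / x"
proof -
  let ?F = "{n\<in>{..<N}. x \<le> a ^ n}"
  have fin: "finite ?F" by simp
  have eq: "(\<Sum>n<N. if x \<le> a ^ n then 1 / a ^ n else 0) = (\<Sum>n\<in>?F. 1 / a ^ n)"
    by (rule sum.inter_filter[symmetric]) simp
  show ?thesis
  proof (cases "?F = {}")
    case True
    then show ?thesis unfolding eq True using a x by simp
  next
    case False
    define m where "m = Min ?F"
    have m: "m \<in> ?F" unfolding m_def using fin False by (rule Min_in)
    then have mN: "m < N" and xm: "x \<le> a ^ m" by auto
    have "(\<Sum>n\<in>?F. 1 / a ^ n) \<le> (\<Sum>n\<in>{m..<N}. 1 / a ^ n)"
      using a fin by (intro sum_mono2) (auto simp: m_def)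
    also have "\<dots> = (\<Sum>n<N-m. 1 / a ^ m * (1 / a) ^ n)"
      using mN by (intro sum.reindex_bij_witness[of _ "\<lambda>n. n + m" "\<lambda>n. n - m"])
        (auto simp: power_add[symmetric] power_divide)
    also have "\<dots> = 1 / a ^ m * (\<Sum>n<N-m. (1 / a) ^ n)"
      by (simp add: sum_distrib_left)
    also have "(\<Sum>n<N-m. (1 / a) ^ n) \<le> a / (a - 1)"
    proof -
      have "(\<Sum>n<N-m. (1 / a) ^ n) = (1 - (1/a)^(N-m)) / (1 - 1/a)"
        using a by (subst sum_gp_strict) auto
      also have "\<dots> \<le> 1 / (1 - 1/a)"
        using a by (intro divide_right_mono) auto
      also have "\<dots> = a / (a - 1)" using a by (simp add: divide_simps)
      finally show ?thesis .
    qed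
    finally have "(\<Sum>n\<in>?F. 1 / a ^ n) \<le> 1 / a ^ m * (a / (a - 1))"
      using a by (simp add: divide_right_mono)
    also have "\<dots> \<le> 1 / x * (a / (a - 1))"
      using a x xm by (intro mult_right_mono divide_left_mono) auto
    finally show ?thesis unfolding eq by (simp add: ac_simps)
  qed
qed

lemma (in prob_space) variance_sum_uncorrelated:
  fixes Y :: "'i \<Rightarrow> 'a \<Rightarrow> real"
  assumes "finite I"
    and int: "\<And>i. i \<in> I \<Longrightarrow> integrable M (Y i)"
    and int2: "\<And>i j. i \<in> I \<Longrightarrow> j \<in> I \<Longrightarrow> integrable M (\<lambda>\<omega>. Y i \<omega> * Y j \<omega>)"
    and unc: "\<And>i j. i \<in> I \<Longrightarrow> j \<in> I \<Longrightarrow> i \<noteq> j \<Longrightarrow>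
      expectation (\<lambda>\<omega>. Y i \<omega> * Y j \<omega>) = expectation (Y i) * expectation (Y j)"
  shows "variance (\<lambda>\<omega>. \<Sum>i\<in>I. Y i \<omega>) = (\<Sum>i\<in>I. variance (Y i))"
proof -
  have sq: "(\<lambda>\<omega>. (\<Sum>i\<in>I. Y i \<omega>)\<^sup>2) = (\<lambda>\<omega>. \<Sum>i\<in>I. \<Sum>j\<in>I. Y i \<omega> * Y j \<omega>)"
    by (simp add: power2_eq_square sum_product)
  have "variance (\<lambda>\<omega>. \<Sum>i\<in>I. Y i \<omega>)
      = expectation (\<lambda>\<omega>. (\<Sum>i\<in>I. Y i \<omega>)\<^sup>2) - (expectation (\<lambda>\<omega>. \<Sum>i\<in>I. Y i \<omega>))\<^sup>2"
    by (rule variance_eq) (auto simp: sq int int2)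
  also have "\<dots> = (\<Sum>i\<in>I. \<Sum>j\<in>I. expectation (\<lambda>\<omega>. Y i \<omega> * Y j \<omega>) - expectation (Y i) * expectation (Y j))"
    by (simp add: sq int int2 power2_eq_square sum_product sum_subtractf)
  also have "\<dots> = (\<Sum>i\<in>I. \<Sum>j\<in>I. if j = i then variance (Y i) else 0)"
  proof (intro sum.cong refl)
    fix i j assume ij: "i \<in> I" "j \<in> I"
    have "variance (Y i) = expectation (\<lambda>\<omega>. (Y i \<omega>)\<^sup>2) - (expectation (Y i))\<^sup>2"
      using int[OF ij(1)] int2[OF ij(1) ij(1)] by (intro variance_eq) (auto simp: power2_eq_square)
    then show "expectation (\<lambda>\<omega>. Y i \<omega> * Y j \<omega>) - expectation (Y i) * expectation (Y j)
        = (if j = i then variance (Y i) else 0)"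
      using unc[OF ij] by (auto simp: power2_eq_square)
  qed
  also have "\<dots> = (\<Sum>i\<in>I. variance (Y i))"
    using \<open>finite I\<close> by (simp)
  finally show ?thesis .
qed

text \<open>The sum of \<open>k\<close> variables is compared with the sum of the same variables truncated at
\<open>k\<close>: the two differ only if one of the variables exceeds \<open>k\<close>, and the
truncated sum has a variance, to which Chebyshev's inequality applies.\<close>
lemma (in prob_space) truncated_deviation_bound:
  fixes T :: "nat \<Rightarrow> 'a \<Rightarrow> real"
  assumes meas[measurable]: "\<And>i. random_variable borel (T i)"
    and nonneg: "\<And>i \<omega>. 0 \<le> T i \<omega>"
    and distr: "\<And>i. distr M borel (T i) = distr M borel (T 0)"
    and indep: "\<And>i j. i \<noteq> j \<Longrightarrow> indep_var borel (T i) borel (T j)"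
    and \<epsilon>: "\<epsilon> > 0" and k: "k > 0"
  shows "prob {\<omega>\<in>space M. \<epsilon> \<le> \<bar>(\<Sum>i<k. T i \<omega>) / k - expectation (\<lambda>\<omega>. T 0 \<omega> * of_bool (T 0 \<omega> \<le> k))\<bar>}
    \<le> k * prob {\<omega>\<in>space M. k < T 0 \<omega>} + expectation (\<lambda>\<omega>. (T 0 \<omega>)\<^sup>2 * of_bool (T 0 \<omega> \<le> k)) / (k * \<epsilon>\<^sup>2)"
    (is "prob ?E \<le> _")
proof -
  define h where "h x = x * of_bool (x \<le> k)" for x :: real
  have [measurable]: "h \<in> borel_measurable borel" unfolding h_def by measurable
  have h_bound: "\<bar>h (T i \<omega>)\<bar> \<le> k" for i \<omega> using nonneg[of i \<omega>] by (auto simp: h_def)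
  have h_int: "integrable M (\<lambda>\<omega>. h (T i \<omega>))" for i
    by (rule integrable_const_bound[where B="k"]) (use h_bound in auto)
  have hh_int: "integrable M (\<lambda>\<omega>. h (T i \<omega>) * h (T j \<omega>))" for i j
    by (rule integrable_const_bound[where B="k * k"])
       (use h_bound in \<open>auto simp: abs_mult intro!: mult_mono\<close>)
  have same: "expectation (\<lambda>\<omega>. g (T i \<omega>)) = expectation (\<lambda>\<omega>. g (T 0 \<omega>))"
    if [measurable]: "g \<in> borel_measurable borel" for g :: "real \<Rightarrow> real" and i
    using distr[of i] integral_distr[of "T i" M borel g] integral_distr[of "T 0" M borel g] by simp
  define Y where "Y \<omega> = (\<Sum>i<k. h (T i \<omega>))" for \<omega>
  have [measurable]: "Y \<in> borel_measurable M" unfolding Y_def by measurable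
  have EY: "expectation Y = k * expectation (\<lambda>\<omega>. h (T 0 \<omega>))"
  proof -
    have "expectation Y = (\<Sum>i<k. expectation (\<lambda>\<omega>. h (T i \<omega>)))"
      unfolding Y_def using h_int by simp
    also have "\<dots> = (\<Sum>i<k. expectation (\<lambda>\<omega>. h (T 0 \<omega>)))"
      by (intro sum.cong refl same) measurable
    finally show ?thesis by simp
  qed
  have Yb: "\<bar>Y \<omega>\<bar> \<le> real k * real k" for \<omega>
  proof -
    have "\<bar>Y \<omega>\<bar> \<le> (\<Sum>i<k. \<bar>h (T i \<omega>)\<bar>)" unfolding Y_def by (rule sum_abs)
    also have "\<dots> \<le> (\<Sum>i<k. real k)" by (intro sum_mono h_bound)
    finally show ?thesis by simp
  qed
  have Y2: "integrable M (\<lambda>\<omega>. (Y \<omega>)\<^sup>2)"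
    by (rule integrable_const_bound[where B="(real k * real k)^2"])
       (use Yb in \<open>auto intro!: AE_I2 abs_le_square_iff[THEN iffD1]\<close>)
  have varY: "variance Y \<le> k * expectation (\<lambda>\<omega>. (T 0 \<omega>)\<^sup>2 * of_bool (T 0 \<omega> \<le> k))"
  proof -
    have "variance Y = (\<Sum>i<k. variance (\<lambda>\<omega>. h (T i \<omega>)))"
      unfolding Y_def
    proof (rule variance_sum_uncorrelated)
      fix i j :: nat assume "i \<noteq> j"
      from indep_var_compose[OF indep[OF this], of h borel h borel]
      have "indep_var borel (\<lambda>\<omega>. h (T i \<omega>)) borel (\<lambda>\<omega>. h (T j \<omega>))" by (simp add: comp_def)
      then show "expectation (\<lambda>\<omega>. h (T i \<omega>) * h (T j \<omega>))
          = expectation (\<lambda>\<omega>. h (T i \<omega>)) * expectation (\<lambda>\<omega>. h (T j \<omega>))"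
        by (rule indep_var_lebesgue_integral) (auto intro: h_int)
    qed (auto intro: h_int hh_int)
    also have "\<dots> \<le> (\<Sum>i<k. expectation (\<lambda>\<omega>. (h (T i \<omega>))\<^sup>2))"
    proof (intro sum_mono)
      fix i
      show "variance (\<lambda>\<omega>. h (T i \<omega>)) \<le> expectation (\<lambda>\<omega>. (h (T i \<omega>))\<^sup>2)"
        using h_int[of i] hh_int[of i i] by (subst variance_eq) (auto simp: power2_eq_square)
    qed
    also have "\<dots> = k * expectation (\<lambda>\<omega>. (h (T 0 \<omega>))\<^sup>2)"
    proof -
      have "(\<Sum>i<k. expectation (\<lambda>\<omega>. (h (T i \<omega>))\<^sup>2)) = (\<Sum>i<k. expectation (\<lambda>\<omega>. (h (T 0 \<omega>))\<^sup>2))"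
        by (intro sum.cong refl same[of "\<lambda>x. (h x)\<^sup>2"]) measurable
      then show ?thesis by simp
    qed
    also have "(\<lambda>\<omega>. (h (T 0 \<omega>))\<^sup>2) = (\<lambda>\<omega>. (T 0 \<omega>)\<^sup>2 * of_bool (T 0 \<omega> \<le> k))"
      by (auto simp: h_def)
    finally show ?thesis .
  qed
  let ?B = "\<Union>i\<in>{..<k}. {\<omega>\<in>space M. k < T i \<omega>}"
  let ?C = "{\<omega>\<in>space M. real k * \<epsilon> \<le> \<bar>Y \<omega> - expectation Y\<bar>}"
  have "prob ?E \<le> prob (?B \<union> ?C)"
  proof (rule finite_measure_mono)
    show "?E \<subseteq> ?B \<union> ?C"
    proof
      fix \<omega> assume w: "\<omega> \<in> ?E"
      show "\<omega> \<in> ?B \<union> ?C"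
      proof (cases "\<exists>i<k. k < T i \<omega>")
        case True then show ?thesis using w by auto
      next
        case False
        then have "T i \<omega> \<le> k" if "i < k" for i using False that not_less by blast
        then have "Y \<omega> = (\<Sum>i<k. T i \<omega>)"
          unfolding Y_def h_def by (intro sum.cong) auto
        moreover have "real k * \<epsilon> \<le> real k * \<bar>(\<Sum>i<k. T i \<omega>) / k - expectation (\<lambda>\<omega>. h (T 0 \<omega>))\<bar>"
          using w by (intro mult_left_mono) (auto simp: h_def)
        moreover have "real k * \<bar>(\<Sum>i<k. T i \<omega>) / k - expectation (\<lambda>\<omega>. h (T 0 \<omega>))\<bar>
            = \<bar>(\<Sum>i<k. T i \<omega>) - k * expectation (\<lambda>\<omega>. h (T 0 \<omega>))\<bar>"
        proof -
          have "real k * \<bar>(\<Sum>i<k. T i \<omega>) / k - expectation (\<lambda>\<omega>. h (T 0 \<omega>))\<bar>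
              = \<bar>real k * ((\<Sum>i<k. T i \<omega>) / k - expectation (\<lambda>\<omega>. h (T 0 \<omega>)))\<bar>"
            by (simp add: abs_mult)
          then show ?thesis using k by (simp add: right_diff_distrib)
        qed
        ultimately show ?thesis using w EY by auto
      qed
    qed
  qed auto
  also have "\<dots> \<le> prob ?B + prob ?C"
    by (rule measure_Un_le) auto
  also have "prob ?B \<le> (\<Sum>i<k. prob {\<omega>\<in>space M. k < T i \<omega>})"
    by (rule measure_UNION_le) auto
  also have "\<dots> = (\<Sum>i<k. prob {\<omega>\<in>space M. k < T 0 \<omega>})"
  proof (intro sum.cong refl)
    fix i
    have "prob {\<omega>\<in>space M. k < T i \<omega>} = measure (distr M borel (T i)) {real k<..}" for i
      by (subst measure_distr) (auto intro!: arg_cong[where f=prob])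
    then show "prob {\<omega>\<in>space M. k < T i \<omega>} = prob {\<omega>\<in>space M. k < T 0 \<omega>}"
      using distr[of i] by simp
  qed
  also have "prob ?C \<le> variance Y / (real k * \<epsilon>)\<^sup>2"
    using k \<epsilon> by (intro Chebyshev_inequality Y2) auto
  also have "\<dots> \<le> (k * expectation (\<lambda>\<omega>. (T 0 \<omega>)\<^sup>2 * of_bool (T 0 \<omega> \<le> k))) / (real k * \<epsilon>)\<^sup>2"
    by (intro divide_right_mono varY) auto
  also have "\<dots> = expectation (\<lambda>\<omega>. (T 0 \<omega>)\<^sup>2 * of_bool (T 0 \<omega> \<le> k)) / (k * \<epsilon>\<^sup>2)"
    using k by (simp add: power2_eq_square)
  finally show ?thesis by simp
qed

text \<open>Summing the bound for \<open>k = \<lceil>a ^ n\<rceil>\<close> over \<open>n\<close> under the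
expectation leaves at most a multiple of the mean of \<open>T 0\<close>, by the two geometric sums
above; Borel--Cantelli then gives convergence along this subsequence.\<close>
lemma (in prob_space) strong_law_along_powers:
  fixes T :: "nat \<Rightarrow> 'a \<Rightarrow> real"
  assumes meas[measurable]: "\<And>i. random_variable borel (T i)"
    and int[simp]: "integrable M (T 0)"
    and nonneg: "\<And>i \<omega>. 0 \<le> T i \<omega>"
    and distr: "\<And>i. distr M borel (T i) = distr M borel (T 0)"
    and indep: "\<And>i j. i \<noteq> j \<Longrightarrow> indep_var borel (T i) borel (T j)"
    and a: "a > (1::real)"
  shows "AE \<omega> in M. (\<lambda>n. (\<Sum>i<nat \<lceil>a ^ n\<rceil>. T i \<omega>) / real (nat \<lceil>a ^ n\<rceil>)) \<longlonglongrightarrow> expectation (T 0)"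
proof -
  define k where "k n = nat \<lceil>a ^ n\<rceil>" for n
  \<comment> \<open>The centering is by the truncated means, which still converge to the mean of \<open>T 0\<close>.\<close>
  define m where "m n = expectation (\<lambda>\<omega>. T 0 \<omega> * of_bool (T 0 \<omega> \<le> k n))" for n
  define S where "S n \<omega> = (\<Sum>i<k n. T i \<omega>) / k n" for n \<omega>
  have [measurable]: "S n \<in> borel_measurable M" for n unfolding S_def by measurable
  have pow1: "1 \<le> a ^ n" for n using a by simp
  have k_ge: "a ^ n \<le> real (k n)" for n
    unfolding k_def using pow1[of n] by linarith
  have k_le: "real (k n) \<le> 2 * a ^ n" for n
    unfolding k_def using pow1[of n] by linarith
  have k_pos: "k n > 0" for n using k_ge[of n] pow1[of n] by linarith
  have k_lim: "filterlim (\<lambda>n. real (k n)) at_top sequentially"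
  proof (rule filterlim_at_top_mono)
    show "filterlim (\<lambda>n. a ^ n) at_top sequentially"
      using a by (intro filterlim_at_infinity_imp_filterlim_at_top filterlim_realpow_sequentially_gt1)
        (auto intro: always_eventually)
  qed (use k_ge in auto)
  have m_lim: "m \<longlonglongrightarrow> expectation (T 0)"
    unfolding m_def
  proof (rule integral_dominated_convergence[where w="T 0"])
    show "AE \<omega> in M. (\<lambda>n. T 0 \<omega> * of_bool (T 0 \<omega> \<le> k n)) \<longlonglongrightarrow> T 0 \<omega>"
    proof (rule AE_I2)
      fix \<omega>
      have "eventually (\<lambda>n. T 0 \<omega> \<le> k n) sequentially"
        using k_lim by (auto simp: filterlim_at_top)
      then show "(\<lambda>n. T 0 \<omega> * of_bool (T 0 \<omega> \<le> k n)) \<longlonglongrightarrow> T 0 \<omega>"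
        by (intro tendsto_eventually) (auto elim: eventually_mono)
    qed
  qed (use nonneg in auto)
  have dev: "AE \<omega> in M. eventually (\<lambda>n. \<bar>S n \<omega> - m n\<bar> < \<epsilon>) sequentially" if e: "\<epsilon> > 0" for \<epsilon> :: real
  proof -
    define A where "A n = {\<omega>\<in>space M. \<epsilon> \<le> \<bar>S n \<omega> - m n\<bar>}" for n
    have [measurable]: "A n \<in> sets M" for n unfolding A_def by measurable
    define C where "C = 2 * (a / (a - 1))"
    have below: "(\<Sum>n<N. real (k n) * of_bool (real (k n) < T 0 \<omega>)) \<le> C * T 0 \<omega>" for N \<omega>
    proof -
      have "(\<Sum>n<N. real (k n) * of_bool (real (k n) < T 0 \<omega>))
          \<le> (\<Sum>n<N. 2 * (if a ^ n < T 0 \<omega> then a ^ n else 0))"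
        using k_ge k_le pow1 by (intro sum_mono) (auto dest: order.strict_trans1 order_trans[OF zero_le_one])
      also have "\<dots> = 2 * (\<Sum>n<N. (if a ^ n < T 0 \<omega> then a ^ n else 0))"
        by (simp add: sum_distrib_left)
      also have "\<dots> \<le> C * T 0 \<omega>"
        unfolding C_def using sum_powers_below_le[OF a nonneg[of 0 \<omega>], of N] by simp
      finally show ?thesis .
    qed
    have above: "(\<Sum>n<N. (T 0 \<omega>)\<^sup>2 * of_bool (T 0 \<omega> \<le> real (k n)) / real (k n)) \<le> C * T 0 \<omega>" for N \<omega>
    proof (cases "T 0 \<omega> = 0")
      case False
      with nonneg[of 0 \<omega>] have pos: "T 0 \<omega> > 0" by simp
      have "(\<Sum>n<N. (T 0 \<omega>)\<^sup>2 * of_bool (T 0 \<omega> \<le> real (k n)) / real (k n))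
          \<le> (\<Sum>n<N. (T 0 \<omega>)\<^sup>2 * (if T 0 \<omega> / 2 \<le> a ^ n then 1 / a ^ n else 0))"
      proof (intro sum_mono)
        fix n
        have "1 / real (k n) \<le> 1 / a ^ n" using k_ge[of n] pow1[of n] by (intro divide_left_mono) auto
        then show "(T 0 \<omega>)\<^sup>2 * of_bool (T 0 \<omega> \<le> real (k n)) / real (k n)
            \<le> (T 0 \<omega>)\<^sup>2 * (if T 0 \<omega> / 2 \<le> a ^ n then 1 / a ^ n else 0)"
          using k_le[of n] pow1[of n] mult_left_mono[of "1 / real (k n)" "1 / a ^ n" "(T 0 \<omega>)\<^sup>2"]
          by auto
      qed
      also have "\<dots> = (T 0 \<omega>)\<^sup>2 * (\<Sum>n<N. if T 0 \<omega> / 2 \<le> a ^ n then 1 / a ^ n else 0)"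
        by (simp add: sum_distrib_left)
      also have "\<dots> \<le> (T 0 \<omega>)\<^sup>2 * (a / (a - 1) / (T 0 \<omega> / 2))"
        using pos by (intro mult_left_mono sum_inverse_powers_above_le[OF a]) auto
      also have "\<dots> = C * T 0 \<omega>"
        using pos by (simp add: C_def power2_eq_square)
      finally show ?thesis .
    qed simp
    have sq_int: "integrable M (\<lambda>\<omega>. (T 0 \<omega>)\<^sup>2 * of_bool (T 0 \<omega> \<le> real (k n)) / real (k n))" for n
    proof (rule integrable_const_bound[where B="real (k n)"])
      have "norm ((T 0 \<omega>)\<^sup>2 * of_bool (T 0 \<omega> \<le> real (k n)) / real (k n)) \<le> real (k n)" for \<omega>
        using mult_mono[of "T 0 \<omega>" "real (k n)" "T 0 \<omega>" "real (k n)"] nonneg[of 0 \<omega>] k_pos[of n]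
        by (cases "T 0 \<omega> \<le> real (k n)") (auto simp: power2_eq_square divide_le_eq)
      then show "AE \<omega> in M. norm ((T 0 \<omega>)\<^sup>2 * of_bool (T 0 \<omega> \<le> real (k n)) / real (k n)) \<le> real (k n)"
        by simp
    qed measurable
    have "summable (\<lambda>n. prob (A n))"
    proof (rule summableI_nonneg_bounded)
      fix N
      have "(\<Sum>n<N. prob (A n)) \<le> (\<Sum>n<N. expectation (\<lambda>\<omega>. real (k n) * of_bool (real (k n) < T 0 \<omega>))
          + expectation (\<lambda>\<omega>. (T 0 \<omega>)\<^sup>2 * of_bool (T 0 \<omega> \<le> real (k n)) / real (k n)) / \<epsilon>\<^sup>2)"
      proof (intro sum_mono)
        fix n
        have "prob {\<omega>\<in>space M. real (k n) < T 0 \<omega>} = expectation (\<lambda>\<omega>. of_bool (real (k n) < T 0 \<omega>))"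
        proof -
          have "expectation (\<lambda>\<omega>. of_bool (real (k n) < T 0 \<omega>) :: real) = expectation (indicator {\<omega>\<in>space M. real (k n) < T 0 \<omega>})"
            by (intro Bochner_Integration.integral_cong) (auto simp: indicator_def)
          then show ?thesis by simp
        qed
        then show "prob (A n) \<le> expectation (\<lambda>\<omega>. real (k n) * of_bool (real (k n) < T 0 \<omega>))
          + expectation (\<lambda>\<omega>. (T 0 \<omega>)\<^sup>2 * of_bool (T 0 \<omega> \<le> real (k n)) / real (k n)) / \<epsilon>\<^sup>2"
          using truncated_deviation_bound[of T, OF meas nonneg distr indep e k_pos[of n]]
          by (simp add: A_def S_def m_def)
      qed
      also have "\<dots> = expectation (\<lambda>\<omega>. \<Sum>n<N. real (k n) * of_bool (real (k n) < T 0 \<omega>))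
          + expectation (\<lambda>\<omega>. \<Sum>n<N. (T 0 \<omega>)\<^sup>2 * of_bool (T 0 \<omega> \<le> real (k n)) / real (k n)) / \<epsilon>\<^sup>2"
      proof -
        have 1: "integrable M (\<lambda>\<omega>. real (k n) * of_bool (real (k n) < T 0 \<omega>))" for n
          by (rule integrable_const_bound[where B="real (k n)"]) auto
        then show ?thesis
          by (simp only: sum.distrib sum_divide_distrib Bochner_Integration.integral_sum[OF 1]
              Bochner_Integration.integral_sum[OF sq_int])
      qed
      also have "\<dots> \<le> expectation (\<lambda>\<omega>. C * T 0 \<omega>) + expectation (\<lambda>\<omega>. C * T 0 \<omega>) / \<epsilon>\<^sup>2"
        using below above a nonneg
        by (intro add_mono divide_right_mono integral_mono_AE' AE_I2)
           (auto simp: C_def intro!: sum_nonneg)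
      finally show "(\<Sum>n<N. prob (A n)) \<le> expectation (\<lambda>\<omega>. C * T 0 \<omega>) + expectation (\<lambda>\<omega>. C * T 0 \<omega>) / \<epsilon>\<^sup>2" .
    qed simp
    then have "AE \<omega> in M. eventually (\<lambda>n. \<omega> \<in> space M - A n) sequentially"
      by (intro borel_cantelli_AE1) (auto simp: emeasure_eq_measure)
    then show ?thesis
      by eventually_elim (auto simp: A_def not_le elim: eventually_mono)
  qed
  have "AE \<omega> in M. \<forall>j. eventually (\<lambda>n. \<bar>S n \<omega> - m n\<bar> < 1 / real (Suc j)) sequentially"
    by (subst AE_all_countable) (auto intro: dev)
  then have "AE \<omega> in M. (\<lambda>n. S n \<omega>) \<longlonglongrightarrow> expectation (T 0)"
  proof eventually_elim
    fix \<omega> assume *: "\<forall>j. eventually (\<lambda>n. \<bar>S n \<omega> - m n\<bar> < 1 / real (Suc j)) sequentially"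
    have "(\<lambda>n. S n \<omega> - m n) \<longlonglongrightarrow> 0"
    proof (rule tendstoI)
      fix e :: real assume "e > 0"
      then obtain j where j: "1 / real (Suc j) < e" using nat_approx_posE by blast
      show "eventually (\<lambda>n. dist (S n \<omega> - m n) 0 < e) sequentially"
        using spec[OF *, of j] by eventually_elim (use j in \<open>simp add: dist_real_def\<close>)
    qed
    from tendsto_add[OF this m_lim] show "(\<lambda>n. S n \<omega>) \<longlonglongrightarrow> expectation (T 0)" by simp
  qed
  then show ?thesis unfolding S_def k_def .
qed

text \<open>Partial sums of nonnegative variables are monotone, so between two consecutive powers of
\<open>a\<close> the averages change at most by a factor close to \<open>a\<close>; letting
\<open>a\<close> decrease to 1 removes it.\<close>
theorem (in prob_space) strong_law_of_large_numbers_nonneg: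
  fixes T :: "nat \<Rightarrow> 'a \<Rightarrow> real"
  assumes meas[measurable]: "\<And>i. random_variable borel (T i)"
    and int[simp]: "integrable M (T 0)"
    and nonneg: "\<And>i \<omega>. 0 \<le> T i \<omega>"
    and distr: "\<And>i. distr M borel (T i) = distr M borel (T 0)"
    and indep: "\<And>i j. i \<noteq> j \<Longrightarrow> indep_var borel (T i) borel (T j)"
  shows "AE \<omega> in M. (\<lambda>n. (\<Sum>i<n. T i \<omega>) / real n) \<longlonglongrightarrow> expectation (T 0)"
proof -
  define e where "e = expectation (T 0)"
  have e0: "e \<ge> 0" unfolding e_def using nonneg by simp
  define a where "a j = 1 + 1 / real (Suc j)" for j
  have a1: "a j > 1" for j by (simp add: a_def)
  have "AE \<omega> in M. \<forall>j. (\<lambda>n. (\<Sum>i<nat \<lceil>a j ^ n\<rceil>. T i \<omega>) / real (nat \<lceil>a j ^ n\<rceil>)) \<longlonglongrightarrow> e"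
    unfolding e_def
    by (subst AE_all_countable) (auto intro!: strong_law_along_powers distr indep nonneg a1)
  then show ?thesis
  proof eventually_elim
    fix \<omega>
    assume lim: "\<forall>j. (\<lambda>n. (\<Sum>i<nat \<lceil>a j ^ n\<rceil>. T i \<omega>) / real (nat \<lceil>a j ^ n\<rceil>)) \<longlonglongrightarrow> e"
    define S where "S n = (\<Sum>i<n. T i \<omega>)" for n
    have S_mono: "S m \<le> S n" if "m \<le> n" for m n
      unfolding S_def using that nonneg by (intro sum_mono2) auto
    have S0: "S n \<ge> 0" for n unfolding S_def using nonneg by (intro sum_nonneg) auto
    \<comment> \<open>The factor \<open>1 + \<delta>\<close> absorbs the rounding in \<open>\<lceil>a j ^ n\<rceil>\<close>.\<close>
    have sandwich: "eventually (\<lambda>n. (e - \<delta>) / (a j * (1 + \<delta>)) \<le> S n / n \<and> S n / n \<le> (e + \<delta>) * (a j * (1 + \<delta>))) sequentially"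
      if d: "0 < \<delta>" for j :: nat and \<delta> :: real
    proof -
      define k where "k n = nat \<lceil>a j ^ n\<rceil>" for n
      have pow1: "1 \<le> a j ^ n" for n using a1[of j] by simp
      have k_ge: "a j ^ n \<le> real (k n)" for n
        unfolding k_def using pow1[of n] by linarith
      have k_le: "real (k n) \<le> a j ^ n + 1" for n
        unfolding k_def using pow1[of n] by linarith
      have k_pos: "k n > 0" for n using k_ge[of n] pow1[of n] by linarith
      have pow_lim: "filterlim (\<lambda>n. a j ^ n) at_top sequentially"
        using a1[of j] by (intro filterlim_at_infinity_imp_filterlim_at_top filterlim_realpow_sequentially_gt1)
          (auto intro: always_eventually)
      have "eventually (\<lambda>n. \<bar>S (k n) / k n - e\<bar> < \<delta>) sequentially"
        using tendstoD[OF spec[OF lim, of j] d] by (simp add: S_def k_def dist_real_def)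
      moreover have "eventually (\<lambda>n. 1 / \<delta> \<le> a j ^ n) sequentially"
        using pow_lim by (auto simp: filterlim_at_top)
      ultimately have "eventually (\<lambda>n. \<bar>S (k n) / k n - e\<bar> < \<delta> \<and> real (k (Suc n)) \<le> a j * (1 + \<delta>) * k n) sequentially"
      proof eventually_elim
        case (elim n)
        have "real (k (Suc n)) \<le> a j * a j ^ n + a j * 1" using k_le[of "Suc n"] a1[of j] by simp
        also have "\<dots> \<le> a j * a j ^ n + a j * (\<delta> * a j ^ n)"
          using elim d a1[of j] by (intro add_left_mono mult_left_mono) (auto simp: field_simps)
        also have "\<dots> = a j * (1 + \<delta>) * a j ^ n" by (simp add: algebra_simps)
        also have "\<dots> \<le> a j * (1 + \<delta>) * k n"
          using k_ge[of n] a1[of j] d by (intro mult_left_mono) auto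
        finally show ?case using elim by simp
      qed
      then obtain n0 where n0: "\<And>n. n \<ge> n0 \<Longrightarrow> \<bar>S (k n) / k n - e\<bar> < \<delta>"
          "\<And>n. n \<ge> n0 \<Longrightarrow> real (k (Suc n)) \<le> a j * (1 + \<delta>) * k n"
        by (auto simp: eventually_sequentially)
      show ?thesis
        unfolding eventually_sequentially
      proof (intro exI allI impI)
        fix N assume N: "k n0 \<le> N"
        have ex: "\<exists>n. N < k n"
        proof -
          have "eventually (\<lambda>n. real N + 1 \<le> a j ^ n) sequentially"
            using pow_lim by (auto simp: filterlim_at_top)
          then obtain n where "real N + 1 \<le> a j ^ n" by (auto simp: eventually_sequentially)
          then show ?thesis using k_ge[of n] by (intro exI[of _ n]) linarith
        qed
        define q where "q = (LEAST n. N < k n)"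
        have q: "N < k q" unfolding q_def by (rule LeastI_ex[OF ex])
        have k_mono: "k m \<le> k n" if "m \<le> n" for m n
          unfolding k_def using that a1[of j] by (intro nat_mono ceiling_mono power_increasing) auto
        have "q > n0" using q N k_mono[of q n0] by (cases "q \<le> n0") auto
        then obtain p where p: "q = Suc p" "p \<ge> n0" by (cases q) auto
        have pN: "k p \<le> N" using not_less_Least[of p "\<lambda>n. N < k n"] p by (auto simp: q_def)
        have Np: "N < k (Suc p)" using q p by simp
        have N0: "N > 0" using pN k_pos[of p] by simp
        let ?c = "a j * (1 + \<delta>)"
        have c0: "?c > 0" using a1[of j] d by simp
        note n1 = n0(1)[OF p(2)] and n1' = n0(1)[of "Suc p"] and n2 = n0(2)[OF p(2)]
        have lower: "(e - \<delta>) / ?c \<le> S N / N"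
        proof (cases "e \<ge> \<delta>")
          case True
          have "(e - \<delta>) * N \<le> (e - \<delta>) * (?c * k p)"
            using True n2 Np by (intro mult_left_mono) auto
          also have "\<dots> = ?c * ((e - \<delta>) * k p)" by simp
          also have "\<dots> \<le> ?c * S N"
          proof (intro mult_left_mono)
            have "(e - \<delta>) * k p \<le> S (k p)"
              using n1 k_pos[of p] by (auto simp: abs_less_iff field_simps)
            also have "S (k p) \<le> S N" by (rule S_mono[OF pN])
            finally show "(e - \<delta>) * k p \<le> S N" .
          qed (use c0 in simp)
          finally show ?thesis using c0 N0 by (simp add: field_simps)
        next
          case False
          then have "(e - \<delta>) / ?c \<le> 0" using c0 by (simp add: field_simps)
          also have "0 \<le> S N / N" using S0 by simp
          finally show ?thesis .
        qed
        have "S N \<le> S (k (Suc p))" using Np by (intro S_mono) simp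
        also have "S (k (Suc p)) \<le> (e + \<delta>) * k (Suc p)"
          using n1' p k_pos[of "Suc p"] by (auto simp: abs_less_iff field_simps)
        also have "\<dots> \<le> (e + \<delta>) * (?c * N)"
        proof (intro mult_left_mono)
          have "?c * k p \<le> ?c * N" using pN c0 by (intro mult_left_mono) auto
          then show "real (k (Suc p)) \<le> ?c * N" using n2 by linarith
        qed (use e0 d in auto)
        finally have "S N / N \<le> (e + \<delta>) * ?c" using N0 by (simp add: field_simps)
        with lower show "(e - \<delta>) / ?c \<le> S N / N \<and> S N / N \<le> (e + \<delta>) * ?c" by blast
      qed
    qed
    define d where "d j = 1 / real (Suc j)" for j
    have d_lim: "d \<longlonglongrightarrow> 0" unfolding d_def by (rule LIMSEQ_Suc[OF lim_1_over_n])
    have "(\<lambda>j. (e - d j) / (a j * (1 + d j))) \<longlonglongrightarrow> (e - 0) / ((1 + 0) * (1 + 0))"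
      unfolding a_def d_def[symmetric] by (intro tendsto_intros d_lim) auto
    then have lo: "(\<lambda>j. (e - d j) / (a j * (1 + d j))) \<longlonglongrightarrow> e" by simp
    have "(\<lambda>j. (e + d j) * (a j * (1 + d j))) \<longlonglongrightarrow> (e + 0) * ((1 + 0) * (1 + 0))"
      unfolding a_def d_def[symmetric] by (intro tendsto_intros d_lim)
    then have hi: "(\<lambda>j. (e + d j) * (a j * (1 + d j))) \<longlonglongrightarrow> e" by simp
    show "(\<lambda>n. (\<Sum>i<n. T i \<omega>) / real n) \<longlonglongrightarrow> expectation (T 0)"
      unfolding S_def[symmetric] e_def[symmetric]
    proof (rule order_tendstoI)
      fix y assume "y < e"
      then obtain j where "y < (e - d j) / (a j * (1 + d j))"
        using order_tendstoD(1)[OF lo] by (auto simp: eventually_sequentially)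
      moreover have "d j > 0" by (simp add: d_def)
      ultimately show "eventually (\<lambda>n. y < S n / n) sequentially"
        using sandwich[of "d j" j] by (auto elim!: eventually_mono)
    next
      fix y assume "e < y"
      then obtain j where "(e + d j) * (a j * (1 + d j)) < y"
        using order_tendstoD(2)[OF hi] by (auto simp: eventually_sequentially)
      moreover have "d j > 0" by (simp add: d_def)
      ultimately show "eventually (\<lambda>n. S n / n < y) sequentially"
        using sandwich[of "d j" j] by (auto elim!: eventually_mono)
    qed
  qed
qed

section \<open>Records and regeneration times of a real-valued walk\<close>

text \<open>A path is a list of steps, and \<open>l\<close> assigns to each step the change of level it
causes.\<close>
definition total :: "('e \<Rightarrow> real) \<Rightarrow> 'e list \<Rightarrow> real" where
  "total l s = (\<Sum>e\<leftarrow>s. l e)"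

definition strict_record :: "('e \<Rightarrow> real) \<Rightarrow> 'e list \<Rightarrow> bool" where
  "strict_record l s \<longleftrightarrow> (\<forall>k<length s. total l (take k s) < total l s)"

definition nonneg_path :: "('e \<Rightarrow> real) \<Rightarrow> 'e list \<Rightarrow> bool" where
  "nonneg_path l s \<longleftrightarrow> (\<forall>k\<le>length s. 0 \<le> total l (take k s))"

text \<open>These are the possible pieces of path between two consecutive regeneration times: the last
condition says that no inner point of \<open>h\<close> is a regeneration time.\<close>
definition block :: "('e \<Rightarrow> real) \<Rightarrow> 'e list \<Rightarrow> bool" where
  "block l h \<longleftrightarrow> h \<noteq> [] \<and> strict_record l h \<and> nonneg_path l h \<and>
     (\<forall>k. 0 < k \<and> k < length h \<longrightarrow> \<not> (strict_record l (take k h) \<and> nonneg_path l (drop k h)))"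

definition regen_times :: "(nat \<Rightarrow> real) \<Rightarrow> nat set" where
  "regen_times L = {n. (\<forall>k<n. L k < L n) \<and> (\<forall>k\<ge>n. L n \<le> L k)}"

lemma total_append [simp]: "total l (s @ t) = total l s + total l t"
  by (simp add: total_def)

lemma total_Nil [simp]: "total l [] = 0"
  by (simp add: total_def)

lemma strict_record_append:
  assumes g: "strict_record l g" and h: "strict_record l h" "nonneg_path l h"
  shows "strict_record l (g @ h)"
  unfolding strict_record_def
proof (intro allI impI)
  fix k assume k: "k < length (g @ h)"
  have "0 \<le> total l h" using h(2) unfolding nonneg_path_def by (auto dest: spec[of _ "length h"])
  show "total l (take k (g @ h)) < total l (g @ h)"
  proof (cases "k < length g")
    case True
    then have "total l (take k g) < total l g" using g by (simp add: strict_record_def)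
    with True \<open>0 \<le> total l h\<close> show ?thesis by simp
  next
    case False
    then have "total l (take (k - length g) h) < total l h"
      using k h(1) by (auto simp: strict_record_def)
    with False show ?thesis by simp
  qed
qed

lemma measurable_map_upt:
  fixes S :: "nat \<Rightarrow> 'w \<Rightarrow> 'e::countable"
  assumes "\<And>i. i < n \<Longrightarrow> S i \<in> measurable N (count_space UNIV)"
  shows "(\<lambda>\<omega>. map (\<lambda>i. S i \<omega>) [0..<n]) \<in> measurable N (count_space UNIV)"
  using assms
proof (induction n)
  case (Suc n)
  have "(\<lambda>\<omega>. (map (\<lambda>i. S i \<omega>) [0..<n], S n \<omega>)) \<in> measurable N (count_space UNIV \<Otimes>\<^sub>M count_space UNIV)"
    using Suc by (intro measurable_Pair) simp_all
  then have "(\<lambda>\<omega>. (map (\<lambda>i. S i \<omega>) [0..<n], S n \<omega>)) \<in> measurable N (count_space UNIV)"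
    by (simp add: pair_measure_countable)
  from measurable_compose[OF this, of "\<lambda>(s, e). s @ [e]" "count_space UNIV"]
  show ?case by simp
qed simp

locale step_process = prob_space M for M :: "'w measure" +
  fixes S :: "nat \<Rightarrow> 'w \<Rightarrow> 'e::countable"
    and l :: "'e \<Rightarrow> real"
  assumes S_measurable [measurable]: "\<And>n. S n \<in> measurable M (count_space UNIV)"
begin

definition hist :: "nat \<Rightarrow> 'w \<Rightarrow> 'e list" where
  "hist n \<omega> = map (\<lambda>i. S i \<omega>) [0..<n]"

definition level :: "nat \<Rightarrow> 'w \<Rightarrow> real" where
  "level n \<omega> = total l (hist n \<omega>)"

definition cyl :: "'e list \<Rightarrow> 'w set" where
  "cyl s = {\<omega>\<in>space M. hist (length s) \<omega> = s}"

definition weight :: "'e list \<Rightarrow> real" where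
  "weight s = prob (cyl s)"

abbreviation "R \<omega> \<equiv> regen_times (\<lambda>n. level n \<omega>)"

lemma weight_nonneg [simp]: "0 \<le> weight s"
  by (simp add: weight_def)

lemma length_hist [simp]: "length (hist n \<omega>) = n"
  by (simp add: hist_def)

lemma hist_0 [simp]: "hist 0 \<omega> = []"
  by (simp add: hist_def)

lemma hist_Suc: "hist (Suc n) \<omega> = hist n \<omega> @ [S n \<omega>]"
  by (simp add: hist_def)

lemma take_hist [simp]: "k \<le> n \<Longrightarrow> take k (hist n \<omega>) = hist k \<omega>"
  by (simp add: hist_def take_map)

lemma level_0 [simp]: "level 0 \<omega> = 0"
  by (simp add: level_def)

lemma level_Suc: "level (Suc n) \<omega> = level n \<omega> + l (S n \<omega>)"
  by (simp add: level_def hist_Suc total_def)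

lemma hist_split: "k \<le> n \<Longrightarrow> hist k \<omega> @ drop k (hist n \<omega>) = hist n \<omega>"
  using append_take_drop_id[of k "hist n \<omega>"] by simp

lemma total_slice: "k \<le> n \<Longrightarrow> total l (drop k (hist n \<omega>)) = level n \<omega> - level k \<omega>"
  using arg_cong[OF hist_split[of k n \<omega>], of "total l"] by (simp add: level_def)

lemma take_slice: "k + i \<le> n \<Longrightarrow> take i (drop k (hist n \<omega>)) = drop k (hist (k + i) \<omega>)"
  by (simp add: take_drop add.commute)

lemma strict_record_slice:
  assumes "k \<le> n"
  shows "strict_record l (drop k (hist n \<omega>)) \<longleftrightarrow> (\<forall>i. k \<le> i \<and> i < n \<longrightarrow> level i \<omega> < level n \<omega>)"
proof -
  have "strict_record l (drop k (hist n \<omega>)) \<longleftrightarrow> (\<forall>i<n - k. level (k + i) \<omega> < level n \<omega>)"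
    using assms unfolding strict_record_def by (auto simp: take_slice total_slice)
  also have "\<dots> \<longleftrightarrow> (\<forall>i. k \<le> i \<and> i < n \<longrightarrow> level i \<omega> < level n \<omega>)"
    using assms by (metis add_diff_inverse_nat le_add1 less_diff_conv2 add.commute not_less
      nat_add_left_cancel_less diff_add_inverse less_diff_conv)
  finally show ?thesis .
qed

lemma strict_record_hist: "strict_record l (hist n \<omega>) \<longleftrightarrow> (\<forall>i<n. level i \<omega> < level n \<omega>)"
  using strict_record_slice[of 0 n \<omega>] by simp

lemma nonneg_path_slice:
  assumes "k \<le> n"
  shows "nonneg_path l (drop k (hist n \<omega>)) \<longleftrightarrow> (\<forall>i. k \<le> i \<and> i \<le> n \<longrightarrow> level k \<omega> \<le> level i \<omega>)"
proof -
  have "nonneg_path l (drop k (hist n \<omega>)) \<longleftrightarrow> (\<forall>i\<le>n - k. level k \<omega> \<le> level (k + i) \<omega>)"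
    using assms unfolding nonneg_path_def by (auto simp: take_slice total_slice)
  also have "\<dots> \<longleftrightarrow> (\<forall>i. k \<le> i \<and> i \<le> n \<longrightarrow> level k \<omega> \<le> level i \<omega>)"
    using assms by (metis le_add1 le_add_diff_inverse nat_add_left_cancel_le)
  finally show ?thesis .
qed

lemma nonneg_path_hist: "nonneg_path l (hist n \<omega>) \<longleftrightarrow> (\<forall>i\<le>n. 0 \<le> level i \<omega>)"
  using nonneg_path_slice[of 0 n \<omega>] by simp

lemma regen_timesD:
  assumes "n \<in> R \<omega>"
  shows "k < n \<Longrightarrow> level k \<omega> < level n \<omega>" "n \<le> k \<Longrightarrow> level n \<omega> \<le> level k \<omega>"
  using assms by (auto simp: regen_times_def)

text \<open>Whether a time between two regeneration times \<open>n < m\<close> is itself one can be read off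
from the path between \<open>n\<close> and \<open>m\<close>: all levels before \<open>n\<close>
are lower and all levels after \<open>m\<close> are higher than the levels in between.\<close>
lemma block_between_regen_times_iff:
  assumes n: "n \<in> R \<omega>" and m: "m \<in> R \<omega>" and "n < m"
  shows "block l (drop n (hist m \<omega>)) \<longleftrightarrow> (\<forall>j. n < j \<and> j < m \<longrightarrow> j \<notin> R \<omega>)"
proof -
  have inner: "strict_record l (take k (drop n (hist m \<omega>))) \<and> nonneg_path l (drop k (drop n (hist m \<omega>)))
      \<longleftrightarrow> n + k \<in> R \<omega>" if "0 < k" "n + k < m" for k
  proof -
    have "n + k \<in> R \<omega> \<longleftrightarrow> (\<forall>i. n \<le> i \<and> i < n + k \<longrightarrow> level i \<omega> < level (n + k) \<omega>) \<and>
        (\<forall>i. n + k \<le> i \<and> i \<le> m \<longrightarrow> level (n + k) \<omega> \<le> level i \<omega>)" (is "_ \<longleftrightarrow> ?A \<and> ?B")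
    proof
      assume AB: "?A \<and> ?B"
      have "level i \<omega> < level (n + k) \<omega>" if "i < n + k" for i
      proof (cases "i < n")
        case True
        then have "level i \<omega> < level n \<omega>" by (rule regen_timesD[OF n])
        also have "level n \<omega> \<le> level (n + k) \<omega>" by (rule regen_timesD[OF n]) simp
        finally show ?thesis .
      qed (use AB that in auto)
      moreover have "level (n + k) \<omega> \<le> level i \<omega>" if "i \<ge> n + k" for i
      proof (cases "i \<le> m")
        case False
        have "level (n + k) \<omega> < level m \<omega>" using regen_timesD(1)[OF m] \<open>n + k < m\<close> .
        also have "level m \<omega> \<le> level i \<omega>" using False by (intro regen_timesD[OF m]) simp
        finally show ?thesis by simp
      qed (use AB that in auto)
      ultimately show "n + k \<in> R \<omega>" by (auto simp: regen_times_def)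
    qed (auto simp: regen_times_def)
    then show ?thesis
      using that \<open>n < m\<close> by (simp add: take_slice strict_record_slice nonneg_path_slice add.commute[of k n])
  qed
  have "strict_record l (drop n (hist m \<omega>))" "nonneg_path l (drop n (hist m \<omega>))"
    using n m \<open>n < m\<close> by (auto simp: strict_record_slice nonneg_path_slice regen_times_def)
  then have "block l (drop n (hist m \<omega>)) \<longleftrightarrow> (\<forall>k. 0 < k \<and> k < m - n \<longrightarrow> n + k \<notin> R \<omega>)"
    unfolding block_def using \<open>n < m\<close> inner by (auto simp: less_diff_conv2 less_diff_conv add.commute)
  also have "\<dots> \<longleftrightarrow> (\<forall>j. n < j \<and> j < m \<longrightarrow> j \<notin> R \<omega>)"
  proof safe
    fix j assume *: "\<forall>k. 0 < k \<and> k < m - n \<longrightarrow> n + k \<notin> R \<omega>" and j: "n < j" "j < m" "j \<in> R \<omega>"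
    show False using *[rule_format, of "j - n"] j by (auto simp: diff_less_mono)
  qed auto
  finally show ?thesis .
qed

text \<open>Being a regeneration time involves the whole future, but once \<open>n\<close> is known to be one,
the regeneration times before \<open>n\<close> are determined by the path up to \<open>n\<close>.\<close>
lemma regen_times_cong:
  assumes eq: "hist n \<omega> = hist n \<omega>'" and n: "n \<in> R \<omega>" "n \<in> R \<omega>'"
  shows "R \<omega> \<inter> {..n} = R \<omega>' \<inter> {..n}"
proof -
  have *: "R \<omega> \<inter> {..n} \<subseteq> R \<omega>'" if eq: "hist n \<omega> = hist n \<omega>'" and n: "n \<in> R \<omega>" "n \<in> R \<omega>'" for \<omega> \<omega>'
  proof
    fix j assume j: "j \<in> R \<omega> \<inter> {..n}"
    have lev: "level i \<omega> = level i \<omega>'" if "i \<le> n" for i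
      using arg_cong[OF eq, of "take i"] that by (simp add: level_def)
    have "level i \<omega>' < level j \<omega>'" if "i < j" for i
      using lev[of i] lev[of j] j that by (auto simp: regen_times_def)
    moreover have "level j \<omega>' \<le> level i \<omega>'" if "j \<le> i" for i
    proof (cases "i \<le> n")
      case True
      then show ?thesis using lev[of i] lev[of j] j that by (auto simp: regen_times_def)
    next
      case False
      have "level j \<omega>' \<le> level n \<omega>'" using lev[of n] lev[of j] j by (auto simp: regen_times_def)
      also have "\<dots> \<le> level i \<omega>'" using False n(2) by (auto simp: regen_times_def)
      finally show ?thesis .
    qed
    ultimately show "j \<in> R \<omega>'" by (auto simp: regen_times_def)
  qed
  show ?thesis using *[OF eq n] *[OF eq[symmetric] n(2,1)] by auto
qed

lemma hist_measurable [measurable]: "hist n \<in> measurable M (count_space UNIV)"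
  unfolding hist_def[abs_def] by (rule measurable_map_upt) (rule S_measurable)

lemma hist_pred [measurable]: "Measurable.pred M (\<lambda>\<omega>. P (hist n \<omega>))"
  using measurable_compose[OF hist_measurable, of P "count_space UNIV" n] by simp

lemma level_measurable [measurable]: "level n \<in> borel_measurable M"
  unfolding level_def[abs_def] using measurable_compose[OF hist_measurable, of "total l" borel n] by simp

lemma cyl_sets [measurable, simp]: "cyl s \<in> sets M"
  unfolding cyl_def by measurable

lemma regen_pred [measurable]: "Measurable.pred M (\<lambda>\<omega>. n \<in> R \<omega>)"
  unfolding regen_times_def mem_Collect_eq by measurable

end

section \<open>Renewal theory from a factorization of path probabilities\<close>

text \<open>The process may depend on its past in any way that respects \<open>fresh_start\<close>; the other
assumptions concern the level only.\<close>
locale regenerative_walk = step_process M S l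
  for M :: "'w measure" and S :: "nat \<Rightarrow> 'w \<Rightarrow> 'e::countable" and l :: "'e \<Rightarrow> real" +
  assumes fresh_start: "\<And>g h. strict_record l g \<Longrightarrow> nonneg_path l h \<Longrightarrow> weight (g @ h) = weight g * weight h"
    and never_back: "prob {\<omega>\<in>space M. \<forall>k. 0 \<le> level k \<omega>} > 0"
    and record_rate: "\<exists>c>0. \<forall>n. c * real n \<le> (\<Sum>k\<le>n. prob {\<omega>\<in>space M. strict_record l (hist k \<omega>)})"
    and transient: "AE \<omega> in M. filterlim (\<lambda>n. level n \<omega>) at_top sequentially"
begin

text \<open>By \<open>fresh_start\<close>, this is also the conditional probability, given any path that ends
in a strict record, that its end is a regeneration time.\<close>
definition no_return :: real where
  "no_return = prob {\<omega>\<in>space M. \<forall>k. 0 \<le> level k \<omega>}"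

definition regen_at :: "'e list \<Rightarrow> 'w set" where
  "regen_at g = {\<omega>\<in>space M. hist (length g) \<omega> = g \<and> length g \<in> R \<omega>}"

lemma regen_at_sets [measurable, simp]: "regen_at g \<in> sets M"
  unfolding regen_at_def by measurable

lemma no_return_pos: "no_return > 0"
  unfolding no_return_def by (rule never_back)

lemma emeasure_cyl: "emeasure M (cyl s) = ennreal (weight s)"
  by (simp add: weight_def emeasure_eq_measure)

lemma emeasure_cyl_family:
  assumes "disjoint_family_on (\<lambda>s. cyl (g @ s)) \<Gamma>"
  shows "emeasure M (\<Union>s\<in>\<Gamma>. cyl (g @ s)) = (\<integral>\<^sup>+s. ennreal (weight (g @ s)) \<partial>count_space \<Gamma>)"
  using assms by (subst emeasure_UN_countable) (auto simp: emeasure_cyl)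

text \<open>The event that \<open>g\<close> is followed by \<open>m\<close> steps which stay above its end is
a disjoint union of cylinders to which \<open>fresh_start\<close> applies; let \<open>m\<close>
tend to infinity.\<close>
lemma emeasure_regen_at:
  assumes g: "strict_record l g"
  shows "emeasure M (regen_at g) = ennreal no_return * emeasure M (cyl g)"
proof -
  define n where "n = length g"
  define H where "H m = {h. length h = m \<and> nonneg_path l h}" for m
  define A where "A m = {\<omega>\<in>space M. hist n \<omega> = g \<and> (\<forall>i. n \<le> i \<and> i \<le> n + m \<longrightarrow> level n \<omega> \<le> level i \<omega>)}" for m
  define D where "D m = {\<omega>\<in>space M. \<forall>k\<le>m. 0 \<le> level k \<omega>}" for m
  have [measurable]: "A m \<in> sets M" "D m \<in> sets M" for m unfolding A_def D_def by measurable
  have disj: "disjoint_family_on (\<lambda>h. cyl (g @ h)) (H m)" for g m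
    by (auto simp: disjoint_family_on_def cyl_def H_def)
  have A_eq: "A m = (\<Union>h\<in>H m. cyl (g @ h))" for m
  proof (intro set_eqI iffI)
    fix \<omega> assume w: "\<omega> \<in> A m"
    then have "hist (n + m) \<omega> = g @ drop n (hist (n + m) \<omega>)"
      using hist_split[of n "n + m" \<omega>] by (simp add: A_def)
    moreover have "drop n (hist (n + m) \<omega>) \<in> H m"
      using w nonneg_path_slice[of n "n + m" \<omega>] by (auto simp: A_def H_def)
    ultimately show "\<omega> \<in> (\<Union>h\<in>H m. cyl (g @ h))" 
      using w by (intro UN_I[of "drop n (hist (n + m) \<omega>)"]) (auto simp: A_def cyl_def n_def)
  next
    fix \<omega> assume "\<omega> \<in> (\<Union>h\<in>H m. cyl (g @ h))"
    then obtain h where h: "nonneg_path l h" "length h = m" "hist (n + m) \<omega> = g @ h" "\<omega> \<in> space M"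
      by (auto simp: H_def cyl_def n_def)
    then have "hist n \<omega> = g" "drop n (hist (n + m) \<omega>) = h"
      using take_hist[of n "n + m" \<omega>] by (auto simp: n_def)
    with h nonneg_path_slice[of n "n + m" \<omega>] show "\<omega> \<in> A m" by (auto simp: A_def)
  qed
  have D_eq: "D m = (\<Union>h\<in>H m. cyl ([] @ h))" for m
    by (auto simp: D_def H_def cyl_def nonneg_path_hist[symmetric])
  have eq: "emeasure M (A m) = ennreal (weight g) * emeasure M (D m)" for m
  proof -
    have "emeasure M (A m) = (\<integral>\<^sup>+h. ennreal (weight g) * ennreal (weight h) \<partial>count_space (H m))"
      unfolding A_eq emeasure_cyl_family[OF disj]
      by (intro nn_integral_cong) (auto simp: H_def fresh_start[OF g] ennreal_mult)
    also have "\<dots> = ennreal (weight g) * emeasure M (D m)"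
      unfolding D_eq emeasure_cyl_family[OF disj] by (subst nn_integral_cmult) auto
    finally show ?thesis .
  qed
  have limA: "(\<lambda>m. emeasure M (A m)) \<longlonglongrightarrow> emeasure M (\<Inter>m. A m)"
    by (intro Lim_emeasure_decseq) (auto simp: decseq_def A_def)
  have limD: "(\<lambda>m. emeasure M (D m)) \<longlonglongrightarrow> emeasure M (\<Inter>m. D m)"
    by (intro Lim_emeasure_decseq) (auto simp: decseq_def D_def)
  have "(\<Inter>m. A m) = {\<omega>\<in>space M. hist n \<omega> = g \<and> (\<forall>m i. n \<le> i \<and> i \<le> n + m \<longrightarrow> level n \<omega> \<le> level i \<omega>)}"
    unfolding A_def by blast
  also have "\<dots> = {\<omega>\<in>space M. hist n \<omega> = g \<and> (\<forall>i\<ge>n. level n \<omega> \<le> level i \<omega>)}"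
  proof -
    have "(\<forall>m i. n \<le> i \<and> i \<le> n + m \<longrightarrow> level n \<omega> \<le> level i \<omega>) \<longleftrightarrow> (\<forall>i\<ge>n. level n \<omega> \<le> level i \<omega>)" for \<omega>
      by (metis le_add_diff_inverse order_refl)
    then show ?thesis by simp
  qed
  also have "\<dots> = regen_at g"
  proof -
    have "\<forall>k<n. level k \<omega> < level n \<omega>" if "hist n \<omega> = g" for \<omega>
      using g that strict_record_hist[of n \<omega>] by simp
    then show ?thesis
      unfolding regen_at_def regen_times_def n_def[symmetric] by (intro Collect_cong) auto
  qed
  finally have A_Int: "(\<Inter>m. A m) = regen_at g" .
  have D_Int: "(\<Inter>m. D m) = {\<omega>\<in>space M. \<forall>k. 0 \<le> level k \<omega>}"
    unfolding D_def by auto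
  have "(\<lambda>m. emeasure M (A m)) \<longlonglongrightarrow> ennreal (weight g) * emeasure M (\<Inter>m. D m)"
    unfolding eq by (intro ennreal_tendsto_cmult limD) simp
  from LIMSEQ_unique[OF limA this] show ?thesis
    unfolding A_Int D_Int by (simp add: weight_def no_return_def emeasure_eq_measure mult.commute)
qed

lemma regen_at_append_subset:
  assumes "strict_record l g" "nonneg_path l h"
  shows "regen_at (g @ h) \<subseteq> regen_at g"
proof
  fix \<omega> assume w: "\<omega> \<in> regen_at (g @ h)"
  define n where "n = length g"
  define m where "m = length (g @ h)"
  have nm: "n \<le> m" by (simp add: n_def m_def)
  have hm: "hist m \<omega> = g @ h" "m \<in> R \<omega>" "\<omega> \<in> space M" using w by (auto simp: regen_at_def m_def)
  have hn: "hist n \<omega> = g" "drop n (hist m \<omega>) = h"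
    using hm take_hist[OF nm, of \<omega>] by (auto simp: n_def)
  have "level i \<omega> < level n \<omega>" if "i < n" for i
    using assms(1) that strict_record_hist[of n \<omega>] hn by simp
  moreover have "level n \<omega> \<le> level i \<omega>" if "n \<le> i" for i
  proof (cases "i \<le> m")
    case True then show ?thesis using assms(2) that hn nonneg_path_slice[OF nm, of \<omega>] by simp
  next
    case False
    have "level n \<omega> \<le> level m \<omega>" using assms(2) nm hn nonneg_path_slice[OF nm, of \<omega>] by simp
    also have "\<dots> \<le> level i \<omega>" using False hm(2) by (intro regen_timesD) auto
    finally show ?thesis .
  qed
  ultimately show "\<omega> \<in> regen_at g" using hn hm by (auto simp: regen_at_def regen_times_def n_def)
qed

text \<open>A family \<open>\<Gamma>\<close> with disjoint events \<open>regen_at g\<close> plays the role of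
a random regeneration time, the past of which is described by the member of
\<open>\<Gamma>\<close> that occurs.\<close>
lemma emeasure_regen_family:
  assumes \<Gamma>: "\<And>g. g \<in> \<Gamma> \<Longrightarrow> strict_record l g" and disj: "disjoint_family_on regen_at \<Gamma>"
  shows "emeasure M (\<Union>g\<in>\<Gamma>. regen_at g) = ennreal no_return * (\<integral>\<^sup>+g. ennreal (weight g) \<partial>count_space \<Gamma>)"
proof -
  have "emeasure M (\<Union>g\<in>\<Gamma>. regen_at g) = (\<integral>\<^sup>+g. ennreal no_return * ennreal (weight g) \<partial>count_space \<Gamma>)"
    using disj by (subst emeasure_UN_countable)
      (auto intro!: nn_integral_cong simp: emeasure_regen_at[OF \<Gamma>] emeasure_cyl)
  then show ?thesis by (subst (asm) nn_integral_cmult) auto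
qed

text \<open>The Markov property at such a time: it is followed by the path \<open>h\<close> and then by
another regeneration time with probability \<open>weight h\<close>, independently of the past.\<close>
lemma emeasure_regen_family_append:
  assumes \<Gamma>: "\<And>g. g \<in> \<Gamma> \<Longrightarrow> strict_record l g" and disj: "disjoint_family_on regen_at \<Gamma>"
    and h: "strict_record l h" "nonneg_path l h"
  shows "emeasure M (\<Union>g\<in>\<Gamma>. regen_at (g @ h)) = ennreal (weight h) * emeasure M (\<Union>g\<in>\<Gamma>. regen_at g)"
proof -
  have "disjoint_family_on (\<lambda>g. regen_at (g @ h)) \<Gamma>"
    using disj regen_at_append_subset[OF \<Gamma> h(2)] by (fastforce simp: disjoint_family_on_def)
  then have "emeasure M (\<Union>g\<in>\<Gamma>. regen_at (g @ h))
      = (\<integral>\<^sup>+g. ennreal (weight h) * (ennreal no_return * ennreal (weight g)) \<partial>count_space \<Gamma>)"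
    by (subst emeasure_UN_countable)
       (auto intro!: nn_integral_cong simp: emeasure_regen_at[OF strict_record_append[OF \<Gamma> h]] emeasure_cyl
          fresh_start[OF \<Gamma> h(2)] ennreal_mult ac_simps)
  also have "\<dots> = ennreal (weight h) * emeasure M (\<Union>g\<in>\<Gamma>. regen_at g)"
    using emeasure_regen_family[of \<Gamma>, OF \<Gamma> disj] by (simp add: nn_integral_cmult)
  finally show ?thesis .
qed

definition record_prob :: "nat \<Rightarrow> real" where
  "record_prob k = prob {\<omega>\<in>space M. strict_record l (hist k \<omega>)}"

text \<open>The probabilities of these events are, up to a factor depending on \<open>k\<close>, the tails of
the block length.\<close>
definition isolated :: "nat \<Rightarrow> nat \<Rightarrow> 'w set" where
  "isolated k j = {\<omega>\<in>space M. k \<in> R \<omega> \<and> (\<forall>i. k < i \<and> i \<le> k + j \<longrightarrow> i \<notin> R \<omega>)}"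

definition short_blocks :: "nat \<Rightarrow> 'e list set" where
  "short_blocks j = {h. block l h \<and> length h \<le> j}"

lemma isolated_sets [measurable, simp]: "isolated k j \<in> sets M"
  unfolding isolated_def by measurable

lemma prob_regen_at_time: "prob {\<omega>\<in>space M. k \<in> R \<omega>} = record_prob k * no_return"
proof -
  define \<Gamma> where "\<Gamma> = {g. strict_record l g \<and> length g = k}"
  have "{\<omega>\<in>space M. k \<in> R \<omega>} = (\<Union>g\<in>\<Gamma>. regen_at g)"
    by (auto simp: regen_at_def \<Gamma>_def strict_record_hist regen_times_def)
  moreover have "emeasure M (\<Union>g\<in>\<Gamma>. regen_at g) = ennreal no_return * (\<integral>\<^sup>+g. ennreal (weight g) \<partial>count_space \<Gamma>)"
    by (rule emeasure_regen_family) (auto simp: \<Gamma>_def disjoint_family_on_def regen_at_def)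
  moreover have "(\<integral>\<^sup>+g. ennreal (weight g) \<partial>count_space \<Gamma>) = emeasure M (\<Union>g\<in>\<Gamma>. cyl ([] @ g))"
    by (subst emeasure_cyl_family) (auto simp: \<Gamma>_def disjoint_family_on_def cyl_def)
  moreover have "(\<Union>g\<in>\<Gamma>. cyl ([] @ g)) = {\<omega>\<in>space M. strict_record l (hist k \<omega>)}"
    by (auto simp: \<Gamma>_def cyl_def)
  ultimately have "ennreal (prob {\<omega>\<in>space M. k \<in> R \<omega>}) = ennreal (record_prob k * no_return)"
    using no_return_pos by (simp add: emeasure_eq_measure record_prob_def ennreal_mult mult.commute)
  then show ?thesis using no_return_pos by (simp add: record_prob_def)
qed

lemma record_prob_0: "record_prob 0 = 1"
  by (simp add: record_prob_def strict_record_def prob_space)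

text \<open>The event is split according to the path between \<open>k\<close> and the next regeneration time.\<close>
lemma emeasure_next_regen:
  "emeasure M {\<omega>\<in>space M. k \<in> R \<omega> \<and> (\<exists>i. k < i \<and> i \<le> k + j \<and> i \<in> R \<omega>)}
   = (\<integral>\<^sup>+h. ennreal (weight h) \<partial>count_space (short_blocks j)) * emeasure M {\<omega>\<in>space M. k \<in> R \<omega>}" (is "emeasure M ?N = _")
proof -
  define \<Gamma> where "\<Gamma> = {g. strict_record l g \<and> length g = k}"
  have R_eq: "{\<omega>\<in>space M. k \<in> R \<omega>} = (\<Union>g\<in>\<Gamma>. regen_at g)"
    by (auto simp: regen_at_def \<Gamma>_def strict_record_hist regen_times_def)
  have slice: "k \<in> R \<omega> \<and> k + length h \<in> R \<omega> \<and> h = drop k (hist (k + length h) \<omega>)"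
    if "\<omega> \<in> regen_at (g @ h)" "g \<in> \<Gamma>" "block l h" for g h \<omega>
  proof -
    have "\<omega> \<in> regen_at g" using that regen_at_append_subset[of g h] by (auto simp: \<Gamma>_def block_def)
    then have "k \<in> R \<omega>" "hist (k + length h) \<omega> = g @ h" "k + length h \<in> R \<omega>"
      using that by (auto simp: \<Gamma>_def regen_at_def)
    then show ?thesis using that by (simp add: \<Gamma>_def)
  qed
  have N_eq: "?N = (\<Union>h\<in>short_blocks j. \<Union>g\<in>\<Gamma>. regen_at (g @ h))"
  proof (intro set_eqI iffI)
    fix \<omega> assume w: "\<omega> \<in> ?N"
    define m where "m = (LEAST i. k < i \<and> i \<in> R \<omega>)"
    have ex: "\<exists>i. k < i \<and> i \<in> R \<omega>" using w by blast
    have m: "k < m" "m \<in> R \<omega>" using LeastI_ex[OF ex] by (auto simp: m_def)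
    have "m \<le> k + j" using w Least_le[of "\<lambda>i. k < i \<and> i \<in> R \<omega>"] unfolding m_def by force
    moreover have "i \<notin> R \<omega>" if "k < i" "i < m" for i
      using not_less_Least[of i "\<lambda>i. k < i \<and> i \<in> R \<omega>"] that by (auto simp: m_def)
    ultimately have "drop k (hist m \<omega>) \<in> short_blocks j"
      using w m by (auto simp: short_blocks_def block_between_regen_times_iff)
    moreover have "hist k \<omega> \<in> \<Gamma>" using w by (auto simp: \<Gamma>_def strict_record_hist regen_times_def)
    moreover have "\<omega> \<in> regen_at (hist k \<omega> @ drop k (hist m \<omega>))"
      using m w by (simp add: hist_split regen_at_def)
    ultimately show "\<omega> \<in> (\<Union>h\<in>short_blocks j. \<Union>g\<in>\<Gamma>. regen_at (g @ h))" by blast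
  next
    fix \<omega> assume "\<omega> \<in> (\<Union>h\<in>short_blocks j. \<Union>g\<in>\<Gamma>. regen_at (g @ h))"
    then obtain g h where gh: "h \<in> short_blocks j" "g \<in> \<Gamma>" "\<omega> \<in> regen_at (g @ h)" by blast
    with slice[of \<omega> g h] show "\<omega> \<in> ?N"
      by (auto simp: short_blocks_def block_def regen_at_def intro!: exI[of _ "k + length h"])
  qed
  have disj: "disjoint_family_on (\<lambda>h. \<Union>g\<in>\<Gamma>. regen_at (g @ h)) (short_blocks j)"
  proof -
    have le: "length h \<le> length h'"
      if "h \<in> short_blocks j" "h' \<in> short_blocks j" "g \<in> \<Gamma>" "g' \<in> \<Gamma>" "\<omega> \<in> regen_at (g @ h)" "\<omega> \<in> regen_at (g' @ h')" for g g' h h' \<omega>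
    proof (rule ccontr)
      assume less: "\<not> length h \<le> length h'"
      note 1 = slice[OF that(5,3)] and 2 = slice[OF that(6,4)]
      have "block l h" "block l h'" using that by (auto simp: short_blocks_def)
      then show False
        using 1 2 less block_between_regen_times_iff[of k \<omega> "k + length h"]
        by (auto simp: block_def dest!: spec[of _ "k + length h'"])
    qed
    have "h = h'" if "h \<in> short_blocks j" "h' \<in> short_blocks j" "g \<in> \<Gamma>" "g' \<in> \<Gamma>" "\<omega> \<in> regen_at (g @ h)" "\<omega> \<in> regen_at (g' @ h')" for g g' h h' \<omega>
    proof -
      have "length h = length h'" using le[OF that] le[OF that(2,1,4,3,6,5)] by simp
      then show ?thesis using slice[OF that(5,3)] slice[OF that(6,4)] that by (auto simp: short_blocks_def)
    qed
    then show ?thesis unfolding disjoint_family_on_def by blast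
  qed
  have "emeasure M ?N = (\<integral>\<^sup>+h. ennreal (weight h) * emeasure M (\<Union>g\<in>\<Gamma>. regen_at g) \<partial>count_space (short_blocks j))"
    unfolding N_eq
  proof (subst emeasure_UN_countable[OF _ _ disj])
    show "(\<integral>\<^sup>+h. emeasure M (\<Union>g\<in>\<Gamma>. regen_at (g @ h)) \<partial>count_space (short_blocks j)) =
        (\<integral>\<^sup>+h. ennreal (weight h) * emeasure M (\<Union>g\<in>\<Gamma>. regen_at g) \<partial>count_space (short_blocks j))"
      by (intro nn_integral_cong emeasure_regen_family_append)
         (auto simp: \<Gamma>_def short_blocks_def block_def disjoint_family_on_def regen_at_def)
  qed auto
  then show ?thesis unfolding R_eq by (simp add: nn_integral_multc)
qed

lemma prob_isolated: "prob (isolated k j) = record_prob k * prob (isolated 0 j)"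
proof -
  define N where "N k = {\<omega>\<in>space M. k \<in> R \<omega> \<and> (\<exists>i. k < i \<and> i \<le> k + j \<and> i \<in> R \<omega>)}" for k
  have [measurable]: "N k \<in> sets M" for k unfolding N_def by measurable
  define F where "F = (\<integral>\<^sup>+h. ennreal (weight h) \<partial>count_space (short_blocks j))"
  have eN: "emeasure M (N k) = F * ennreal (record_prob k * no_return)" for k
    unfolding N_def emeasure_next_regen F_def by (simp add: emeasure_eq_measure prob_regen_at_time)
  have "F < \<top>"
    using eN[of 0] no_return_pos by (auto simp: record_prob_0 emeasure_eq_measure ennreal_top_mult less_top[symmetric])
  then obtain f where f: "F = ennreal f" "f \<ge> 0" by (cases F) auto
  have N: "prob (N k) = f * (record_prob k * no_return)" for k
    using eN[of k] f no_return_pos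
    by (simp add: emeasure_eq_measure ennreal_mult[symmetric] record_prob_def measure_nonneg)
  have "prob (isolated k j) = record_prob k * no_return - f * (record_prob k * no_return)" for k
  proof -
    have "isolated k j = {\<omega>\<in>space M. k \<in> R \<omega>} - N k" by (auto simp: isolated_def N_def)
    also have "prob \<dots> = prob {\<omega>\<in>space M. k \<in> R \<omega>} - prob (N k)"
      by (intro finite_measure_Diff) (auto simp: N_def)
    finally show ?thesis by (simp add: N prob_regen_at_time)
  qed
  note iso = this
  show ?thesis unfolding iso record_prob_0 by (simp add: algebra_simps)
qed

text \<open>The summand with index \<open>k\<close> is the probability that \<open>k\<close> is the last
regeneration time up to \<open>n\<close>.\<close>
lemma renewal_inequality: "(\<Sum>k\<le>n. record_prob k * prob (isolated 0 (n - k))) \<le> 1"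
proof -
  have "(\<Sum>k\<le>n. record_prob k * prob (isolated 0 (n - k))) = (\<Sum>k\<le>n. prob (isolated k (n - k)))"
    by (intro sum.cong refl prob_isolated[symmetric])
  also have "\<dots> = prob (\<Union>k\<le>n. isolated k (n - k))"
  proof (rule finite_measure_finite_Union[symmetric])
    have le: "k' \<le> k" if "\<omega> \<in> isolated k (n - k)" "\<omega> \<in> isolated k' (n - k')" "k \<le> n" "k' \<le> n" for \<omega> k k'
    proof (rule ccontr)
      assume "\<not> k' \<le> k"
      then have "k' \<notin> R \<omega>" using that by (auto simp: isolated_def)
      then show False using that by (simp add: isolated_def)
    qed
    have "k = k'" if "\<omega> \<in> isolated k (n - k)" "\<omega> \<in> isolated k' (n - k')" "k \<le> n" "k' \<le> n" for \<omega> k k'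
      using le[OF that] le[OF that(2,1,4,3)] by simp
    then show "disjoint_family_on (\<lambda>k. isolated k (n - k)) {..n}"
      unfolding disjoint_family_on_def by blast
  qed auto
  also have "\<dots> \<le> 1" by (rule prob_le_1)
  finally show ?thesis .
qed

text \<open>Adding the renewal inequalities for all \<open>n \<le> 2 * m\<close> bounds the product of the
expected number of records up to \<open>m\<close>, which is at least \<open>c * m\<close>, and of
the sum of the first \<open>m\<close> tails by \<open>2 * m + 1\<close>.\<close>
lemma summable_isolated: "summable (\<lambda>j. prob (isolated 0 j))"
proof -
  obtain c where c: "c > 0" "\<And>n. c * real n \<le> (\<Sum>k\<le>n. record_prob k)"
    using record_rate by (auto simp: record_prob_def)
  have "(\<Sum>j<m. prob (isolated 0 j)) \<le> 3 / c" for m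
  proof (cases "m = 0")
    case False
    have nn: "0 \<le> record_prob k" for k by (simp add: record_prob_def)
    have "c * real m * (\<Sum>j<m. prob (isolated 0 j)) \<le> (\<Sum>k\<le>m. record_prob k) * (\<Sum>j<m. prob (isolated 0 j))"
      by (intro mult_right_mono c sum_nonneg) auto
    also have "\<dots> = (\<Sum>(k, j)\<in>{..m} \<times> {..<m}. record_prob k * prob (isolated 0 j))"
      by (simp add: sum_product sum.cartesian_product)
    also have "\<dots> = (\<Sum>(n, k)\<in>(\<lambda>(k, j). (k + j, k)) ` ({..m} \<times> {..<m}). record_prob k * prob (isolated 0 (n - k)))"
      by (subst sum.reindex) (auto simp: inj_on_def intro!: sum.cong)
    also have "\<dots> \<le> (\<Sum>(n, k)\<in>(SIGMA n:{..2*m}. {..n}). record_prob k * prob (isolated 0 (n - k)))"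
      by (intro sum_mono2) (auto intro!: mult_nonneg_nonneg nn)
    also have "\<dots> = (\<Sum>n\<le>2*m. \<Sum>k\<le>n. record_prob k * prob (isolated 0 (n - k)))"
      by (subst sum.Sigma) auto
    also have "\<dots> \<le> (\<Sum>n\<le>2*m. 1)" by (intro sum_mono renewal_inequality)
    also have "\<dots> \<le> 3 * real m" using False by simp
    finally show ?thesis using False c(1) by (simp add: field_simps)
  qed (use c in simp)
  then show ?thesis by (intro summableI_nonneg_bounded) auto
qed

lemma AE_regen_unbounded_after: "AE \<omega> in M. \<forall>k\<in>R \<omega>. \<exists>i>k. i \<in> R \<omega>"
proof -
  have "AE \<omega> in M. k \<in> R \<omega> \<longrightarrow> (\<exists>i>k. i \<in> R \<omega>)" for k
  proof -
    let ?A = "{\<omega>\<in>space M. k \<in> R \<omega> \<and> (\<forall>i>k. i \<notin> R \<omega>)}"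
    have lim: "(\<lambda>j. record_prob k * prob (isolated 0 j)) \<longlonglongrightarrow> record_prob k * 0"
      by (intro tendsto_intros summable_LIMSEQ_zero summable_isolated)
    have "prob ?A \<le> record_prob k * prob (isolated 0 j)" for j
      unfolding prob_isolated[symmetric] by (intro finite_measure_mono) (auto simp: isolated_def)
    then have "prob ?A \<le> record_prob k * 0"
      by (intro tendsto_lowerbound[OF lim]) auto
    then have "prob ?A = 0" by (simp add: measure_le_0_iff)
    then have "AE \<omega> in M. \<not> (k \<in> R \<omega> \<and> (\<forall>i>k. i \<notin> R \<omega>))"
      by (subst (asm) prob_eq_0) (auto simp: measurable)
    then show ?thesis by eventually_elim auto
  qed
  then have "AE \<omega> in M. \<forall>k. k \<in> R \<omega> \<longrightarrow> (\<exists>i>k. i \<in> R \<omega>)"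
    by (subst AE_all_countable) auto
  then show ?thesis by eventually_elim auto
qed

lemma AE_record_after: "AE \<omega> in M. \<forall>m. \<exists>k>m. strict_record l (hist k \<omega>)"
  using transient
proof eventually_elim
  fix \<omega> assume lim: "filterlim (\<lambda>n. level n \<omega>) at_top sequentially"
  show "\<forall>m. \<exists>k>m. strict_record l (hist k \<omega>)"
  proof
    fix m
    define b where "b = Max ((\<lambda>j. level j \<omega>) ` {..m})"
    have b: "level j \<omega> \<le> b" if "j \<le> m" for j unfolding b_def using that by (intro Max_ge) auto
    have "eventually (\<lambda>n. b < level n \<omega>) sequentially" using lim by (auto simp: filterlim_at_top_dense)
    then have ex: "\<exists>k. b < level k \<omega>" by (auto simp: eventually_sequentially)
    define k where "k = (LEAST k. b < level k \<omega>)"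
    have k: "b < level k \<omega>" unfolding k_def by (rule LeastI_ex[OF ex])
    have "level j \<omega> < level k \<omega>" if "j < k" for j
      using not_less_Least[of j "\<lambda>k. b < level k \<omega>"] that k by (auto simp: k_def)
    moreover have "m < k" using k b[of k] by (force simp: not_less[symmetric])
    ultimately show "\<exists>k>m. strict_record l (hist k \<omega>)" by (auto simp: strict_record_hist)
  qed
qed

text \<open>Let \<open>E n\<close> be the event that there is no regeneration time up to \<open>n\<close>. It
is the increasing union over \<open>m\<close> of events \<open>C n m\<close> that are decided at
time \<open>n + m\<close>, by which time every record up to \<open>n\<close> has been undercut.
Given \<open>C n m\<close>, the first record after \<open>n + m\<close> is a regeneration time
with probability \<open>no_return\<close>, and then the event \<open>E'\<close> of having no
regeneration time at all does not occur. Hence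
\<open>prob E' + no_return * prob (E n) \<le> prob (E n)\<close>, and letting \<open>n\<close>
tend to infinity turns \<open>prob (E n)\<close> into \<open>prob E'\<close>.\<close>
lemma AE_regen_exists: "AE \<omega> in M. R \<omega> \<noteq> {}"
proof -
  define E where "E n = {\<omega>\<in>space M. \<forall>k\<le>n. k \<notin> R \<omega>}" for n
  define E' where "E' = {\<omega>\<in>space M. \<forall>k. k \<notin> R \<omega>}"
  define refuted :: "nat \<Rightarrow> 'e list \<Rightarrow> bool" where "refuted n s \<longleftrightarrow> (\<forall>k\<le>n. strict_record l (take k s) \<longrightarrow>
     (\<exists>j. k \<le> j \<and> j \<le> length s \<and> total l (take j s) < total l (take k s)))" for n s
  define C where "C n m = {\<omega>\<in>space M. refuted n (hist (n + m) \<omega>)}" for n m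
  have [measurable]: "E n \<in> sets M" "E' \<in> sets M" "C n m \<in> sets M" for n m
    unfolding E_def E'_def C_def by measurable
  have refuted_iff: "refuted n (hist (n + m) \<omega>) \<longleftrightarrow> (\<forall>k\<le>n. strict_record l (hist k \<omega>) \<longrightarrow> (\<exists>j. k \<le> j \<and> j \<le> n + m \<and> level j \<omega> < level k \<omega>))" for n m \<omega>
    unfolding refuted_def level_def by (auto simp: conj_commute cong: conj_cong)
  have mono_C: "C n m \<subseteq> C n m'" if "m \<le> m'" for n m m'
    using that unfolding C_def refuted_iff by force
  have regen_iff: "k \<in> R \<omega> \<longleftrightarrow> strict_record l (hist k \<omega>) \<and> (\<forall>j\<ge>k. \<not> level j \<omega> < level k \<omega>)" for k \<omega>
    by (auto simp: regen_times_def strict_record_hist not_less)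
  have C_Un: "(\<Union>m. C n m) = E n" for n
  proof (intro set_eqI iffI)
    fix \<omega> assume "\<omega> \<in> E n"
    then have w: "\<omega> \<in> space M" and "\<forall>k\<le>n. strict_record l (hist k \<omega>) \<longrightarrow> (\<exists>j\<ge>k. level j \<omega> < level k \<omega>)"
      by (auto simp: E_def regen_iff)
    then obtain J where J: "\<And>k. k \<le> n \<Longrightarrow> strict_record l (hist k \<omega>) \<Longrightarrow> J k \<ge> k \<and> level (J k) \<omega> < level k \<omega>"
      by metis
    define m where "m = (\<Sum>k\<le>n. J k)"
    have "J k \<le> n + m" if "k \<le> n" for k
      unfolding m_def using that by (intro trans_le_add2 member_le_sum) auto
    then have "\<omega> \<in> C n m" unfolding C_def refuted_iff using J w by blast
    then show "\<omega> \<in> (\<Union>m. C n m)" by blast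
  qed (unfold C_def refuted_iff E_def regen_iff, blast)
  have step: "prob E' + no_return * prob (C n m) \<le> prob (E n)" for n m
  proof -
    \<comment> \<open>On \<open>C n m\<close>, almost surely one of these is the path up to the first record after \<open>n + m\<close>.\<close>
    define \<Gamma> where "\<Gamma> = {g. strict_record l g \<and> n + m < length g \<and> refuted n (take (n + m) g) \<and>
      (\<forall>j. n + m < j \<and> j < length g \<longrightarrow> \<not> strict_record l (take j g))}"
    have same: "g = g'" if "g \<in> \<Gamma>" "g' \<in> \<Gamma>" "hist (length g) \<omega> = g" "hist (length g') \<omega> = g'" for g g' \<omega>
    proof -
      have "length g = length g'"
      proof (rule linorder_cases[of "length g" "length g'"])
        assume "length g < length g'"
        moreover have "take (length g) g' = g" using that take_hist[of "length g" "length g'" \<omega>] \<open>length g < length g'\<close> by simp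
        ultimately show ?thesis using that by (auto simp: \<Gamma>_def)
      next
        assume "length g' < length g"
        moreover have "take (length g') g = g'" using that take_hist[of "length g'" "length g" \<omega>] \<open>length g' < length g\<close> by simp
        ultimately show ?thesis using that by (auto simp: \<Gamma>_def)
      qed
      then show ?thesis using that by metis
    qed
    have "emeasure M (\<Union>g\<in>\<Gamma>. regen_at g) = ennreal no_return * (\<integral>\<^sup>+g. ennreal (weight g) \<partial>count_space \<Gamma>)"
    proof (rule emeasure_regen_family)
      show "disjoint_family_on regen_at \<Gamma>"
        using same unfolding disjoint_family_on_def regen_at_def by blast
    qed (auto simp: \<Gamma>_def)
    also have "(\<integral>\<^sup>+g. ennreal (weight g) \<partial>count_space \<Gamma>) = emeasure M (\<Union>g\<in>\<Gamma>. cyl ([] @ g))"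
    proof (subst emeasure_cyl_family)
      show "disjoint_family_on (\<lambda>s. cyl ([] @ s)) \<Gamma>"
        using same unfolding disjoint_family_on_def cyl_def append_Nil by blast
    qed simp
    finally have eq: "prob (\<Union>g\<in>\<Gamma>. regen_at g) = no_return * prob (\<Union>g\<in>\<Gamma>. cyl g)"
      using no_return_pos by (simp add: emeasure_eq_measure ennreal_mult[symmetric])
    have "prob (C n m) \<le> prob (\<Union>g\<in>\<Gamma>. cyl g)"
    proof (rule finite_measure_mono_AE)
      show "AE \<omega> in M. \<omega> \<in> C n m \<longrightarrow> \<omega> \<in> (\<Union>g\<in>\<Gamma>. cyl g)"
        using AE_record_after
      proof eventually_elim
        fix \<omega> assume "\<forall>m. \<exists>k>m. strict_record l (hist k \<omega>)"
        then have ex: "\<exists>k. n + m < k \<and> strict_record l (hist k \<omega>)" by blast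
        define k where "k = (LEAST k. n + m < k \<and> strict_record l (hist k \<omega>))"
        have k: "n + m < k" "strict_record l (hist k \<omega>)" using LeastI_ex[OF ex] by (auto simp: k_def)
        have no: "\<not> strict_record l (hist j \<omega>)" if "n + m < j" "j < k" for j
          using not_less_Least[of j "\<lambda>k. n + m < k \<and> strict_record l (hist k \<omega>)"] that by (auto simp: k_def)
        show "\<omega> \<in> C n m \<longrightarrow> \<omega> \<in> (\<Union>g\<in>\<Gamma>. cyl g)"
          using k no by (auto simp: C_def \<Gamma>_def cyl_def intro!: exI[of _ "hist k \<omega>"])
      qed
    qed simp_all
    then have "no_return * prob (C n m) \<le> prob (\<Union>g\<in>\<Gamma>. regen_at g)"
      unfolding eq using no_return_pos by (intro mult_left_mono) auto
    moreover have "prob E' + prob (\<Union>g\<in>\<Gamma>. regen_at g) = prob (E' \<union> (\<Union>g\<in>\<Gamma>. regen_at g))"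
    proof (rule finite_measure_Union[symmetric])
      show "E' \<inter> (\<Union>g\<in>\<Gamma>. regen_at g) = {}" by (auto simp: E'_def regen_at_def)
    qed simp_all
    moreover have "prob (E' \<union> (\<Union>g\<in>\<Gamma>. regen_at g)) \<le> prob (E n)"
    proof (rule finite_measure_mono)
      have "(\<Union>g\<in>\<Gamma>. regen_at g) \<subseteq> C n m"
      proof
        fix \<omega> assume "\<omega> \<in> (\<Union>g\<in>\<Gamma>. regen_at g)"
        then obtain g where "g \<in> \<Gamma>" "hist (length g) \<omega> = g" "\<omega> \<in> space M" by (auto simp: regen_at_def)
        then show "\<omega> \<in> C n m"
          using take_hist[of "n + m" "length g" \<omega>] by (simp add: \<Gamma>_def C_def)
      qed
      also have "C n m \<subseteq> E n" using C_Un by blast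
      finally show "E' \<union> (\<Union>g\<in>\<Gamma>. regen_at g) \<subseteq> E n" by (auto simp: E'_def E_def)
    qed auto
    ultimately show ?thesis by linarith
  qed
  have limC: "(\<lambda>m. prob (C n m)) \<longlonglongrightarrow> prob (E n)" for n
    unfolding C_Un[symmetric] using mono_C by (intro finite_Lim_measure_incseq) (auto simp: incseq_def)
  have step': "prob E' + no_return * prob (E n) \<le> prob (E n)" for n
    by (rule tendsto_upperbound[OF tendsto_add[OF tendsto_const tendsto_mult[OF tendsto_const limC]]])
       (auto intro: always_eventually step)
  have limE: "(\<lambda>n. prob (E n)) \<longlonglongrightarrow> prob E'"
  proof -
    have "(\<lambda>n. prob (E n)) \<longlonglongrightarrow> prob (\<Inter>n. E n)"
      by (intro finite_Lim_measure_decseq) (auto simp: decseq_def E_def)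
    also have "(\<Inter>n. E n) = E'" by (auto simp: E_def E'_def)
    finally show ?thesis .
  qed
  have "prob E' + no_return * prob E' \<le> prob E'"
    by (rule LIMSEQ_le[OF tendsto_add[OF tendsto_const tendsto_mult[OF tendsto_const limE]] limE]) (auto intro: step')
  then have "prob E' = 0" using no_return_pos by (simp add: mult_le_0_iff measure_le_0_iff)
  then have "AE \<omega> in M. \<omega> \<notin> E'" by (subst (asm) prob_eq_0) simp_all
  with AE_space show ?thesis by eventually_elim (auto simp: E'_def)
qed

lemma AE_infinite_regen: "AE \<omega> in M. infinite (R \<omega>)"
  using AE_regen_exists AE_regen_unbounded_after
  by eventually_elim (meson Max_ge Max_in not_less)

end

section \<open>Independent blocks between regeneration times\<close>

text \<open>For infinite \<open>T\<close> this is \<open>enumerate T\<close>; the least elements are written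
out so that the measurability of random times follows by recursion.\<close>
primrec nth_time :: "nat set \<Rightarrow> nat \<Rightarrow> nat" where
  "nth_time T 0 = (LEAST n. n \<in> T)"
| "nth_time T (Suc i) = (LEAST n. n \<in> T \<and> nth_time T i < n)"

declare nth_time.simps [simp del]

lemma nth_time_Suc:
  assumes "infinite T"
  shows "nth_time T (Suc i) \<in> T" "nth_time T i < nth_time T (Suc i)"
proof -
  have "\<exists>n. n \<in> T \<and> nth_time T i < n" using assms by (meson finite_nat_set_iff_bounded_le not_le)
  from LeastI_ex[OF this] show "nth_time T (Suc i) \<in> T" "nth_time T i < nth_time T (Suc i)"
    by (auto simp: nth_time.simps)
qed

lemma nth_time_in: "infinite T \<Longrightarrow> nth_time T i \<in> T"
proof (cases i)
  case 0
  assume "infinite T"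
  then have "\<exists>n. n \<in> T" using infinite_imp_nonempty by blast
  from LeastI_ex[OF this] show ?thesis using 0 by (simp add: nth_time.simps)
qed (simp add: nth_time_Suc)

lemma strict_mono_nth_time: "infinite T \<Longrightarrow> strict_mono (nth_time T)"
  by (simp add: strict_mono_Suc_iff nth_time_Suc)

lemma not_in_between_nth_times: "nth_time T i < n \<Longrightarrow> n < nth_time T (Suc i) \<Longrightarrow> n \<notin> T"
  using not_less_Least[of n "\<lambda>n. n \<in> T \<and> nth_time T i < n"] by (auto simp: nth_time.simps)

lemma nth_time_cong:
  assumes T: "infinite T" and eq: "T \<inter> {..nth_time T i} = T' \<inter> {..nth_time T i}" and "k \<le> i"
  shows "nth_time T' k = nth_time T k"
  using \<open>k \<le> i\<close>
proof (induction k)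
  case 0
  have le: "nth_time T 0 \<le> nth_time T i" using strict_mono_nth_time[OF T] by (simp add: strict_mono_less_eq)
  have in': "nth_time T 0 \<in> T'" using le nth_time_in[OF T, of 0] eq by blast
  show ?case unfolding nth_time.simps(1)[of T']
  proof (rule Least_equality)
    show "nth_time T 0 \<in> T'" by (rule in')
    fix y assume y: "y \<in> T'"
    show "nth_time T 0 \<le> y"
    proof (rule ccontr)
      assume "\<not> ?thesis"
      then have "y < nth_time T 0" "y \<in> T' \<inter> {..nth_time T i}" using y le by auto
      then have "y < nth_time T 0" "y \<in> T" using eq by blast+
      then show False using not_less_Least[of y "\<lambda>n. n \<in> T"] by (simp add: nth_time.simps)
    qed
  qed
next
  case (Suc k)
  have le: "nth_time T (Suc k) \<le> nth_time T i"
    using strict_mono_nth_time[OF T] Suc.prems by (simp add: strict_mono_less_eq)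
  have IH: "nth_time T' k = nth_time T k" using Suc by simp
  have in': "nth_time T (Suc k) \<in> T'" using le nth_time_Suc[OF T, of k] eq by blast
  show ?case unfolding nth_time.simps(2)[of T'] IH
  proof (rule Least_equality)
    show "nth_time T (Suc k) \<in> T' \<and> nth_time T k < nth_time T (Suc k)" using in' nth_time_Suc[OF T, of k] by simp
    fix y assume y: "y \<in> T' \<and> nth_time T k < y"
    show "nth_time T (Suc k) \<le> y"
    proof (rule ccontr)
      assume "\<not> ?thesis"
      then have "y < nth_time T (Suc k)" "y \<in> T' \<inter> {..nth_time T i}" using y le by auto
      then have "y < nth_time T (Suc k)" "y \<in> T" using eq by blast+
      then show False using not_in_between_nth_times[of T k y] y by blast
    qed
  qed
qed

lemma (in prob_space) indep_var_discrete:
  fixes U :: "'a \<Rightarrow> 'b::countable" and V :: "'a \<Rightarrow> 'b"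
  assumes [measurable]: "random_variable (count_space UNIV) U" "random_variable (count_space UNIV) V"
    and prod: "\<And>u v. prob {\<omega>\<in>space M. U \<omega> = u \<and> V \<omega> = v} = prob {\<omega>\<in>space M. U \<omega> = u} * prob {\<omega>\<in>space M. V \<omega> = v}"
  shows "indep_var (count_space UNIV) U (count_space UNIV) V"
  unfolding indep_var_distribution_eq
proof (intro conjI)
  let ?U = "distr M (count_space UNIV) U" and ?V = "distr M (count_space UNIV) V"
  interpret U: prob_space ?U by (rule prob_space_distr) simp
  interpret V: prob_space ?V by (rule prob_space_distr) simp
  have pair: "count_space (UNIV::'b set) \<Otimes>\<^sub>M count_space (UNIV::'b set) = count_space UNIV"
    by (simp add: pair_measure_countable)
  have [measurable]: "(\<lambda>x. (U x, V x)) \<in> measurable M (count_space UNIV)"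
    unfolding pair[symmetric] by measurable
  show "?U \<Otimes>\<^sub>M ?V = distr M (count_space UNIV \<Otimes>\<^sub>M count_space UNIV) (\<lambda>x. (U x, V x))"
  proof (rule measure_eqI_countable[where A=UNIV])
    have "sets (?U \<Otimes>\<^sub>M ?V) = sets (count_space (UNIV::'b set) \<Otimes>\<^sub>M count_space (UNIV::'b set))"
      by (intro sets_pair_measure_cong) auto
    then show "sets (?U \<Otimes>\<^sub>M ?V) = Pow UNIV" unfolding pair by simp
    show "sets (distr M (count_space UNIV \<Otimes>\<^sub>M count_space UNIV) (\<lambda>x. (U x, V x))) = Pow UNIV"
      unfolding pair by simp
    fix uv :: "'b \<times> 'b"
    obtain u v where uv: "uv = (u, v)" by (cases uv)
    have "emeasure (?U \<Otimes>\<^sub>M ?V) {uv} = emeasure (?U \<Otimes>\<^sub>M ?V) ({u} \<times> {v})" by (simp add: uv)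
    also have "\<dots> = emeasure ?U {u} * emeasure ?V {v}"
      by (rule V.emeasure_pair_measure_Times) auto
    also have "\<dots> = ennreal (prob {\<omega>\<in>space M. U \<omega> = u} * prob {\<omega>\<in>space M. V \<omega> = v})"
      by (simp add: emeasure_distr emeasure_eq_measure ennreal_mult vimage_def Int_def conj_commute)
    also have "\<dots> = ennreal (prob {\<omega>\<in>space M. U \<omega> = u \<and> V \<omega> = v})" by (simp only: prod)
    also have "\<dots> = emeasure (distr M (count_space UNIV \<Otimes>\<^sub>M count_space UNIV) (\<lambda>x. (U x, V x))) {uv}"
      unfolding pair by (simp add: emeasure_distr emeasure_eq_measure uv vimage_def Int_def conj_commute)
    finally show "emeasure (?U \<Otimes>\<^sub>M ?V) {uv} = emeasure (distr M (count_space UNIV \<Otimes>\<^sub>M count_space UNIV) (\<lambda>x. (U x, V x))) {uv}" .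
  qed simp
qed auto

text \<open>Between \<open>\<tau> k\<close> and \<open>\<tau> (Suc k)\<close> the quotient
\<open>C n / n\<close> lies between \<open>C (\<tau> k) / \<tau> (Suc k)\<close> and
\<open>C (\<tau> (Suc k)) / \<tau> k\<close>, both of which tend to \<open>r / t\<close>.\<close>
lemma ratio_tendsto_along_random_times:
  fixes \<tau> :: "nat \<Rightarrow> nat" and C :: "nat \<Rightarrow> real"
  assumes mono: "strict_mono \<tau>" and C: "incseq C" "\<And>n. 0 \<le> C n"
    and t: "(\<lambda>k. real (\<tau> k) / real k) \<longlonglongrightarrow> t" "t > 0"
    and r: "(\<lambda>k. C (\<tau> k) / real k) \<longlonglongrightarrow> r"
  shows "(\<lambda>n. C n / real n) \<longlonglongrightarrow> r / t"
proof -
  define lo where "lo k = C (\<tau> k) / real (\<tau> (Suc k))" for k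
  define hi where "hi k = C (\<tau> (Suc k)) / real (\<tau> k)" for k
  have t': "(\<lambda>k. real (\<tau> (Suc k)) / real (Suc k)) \<longlonglongrightarrow> t" using LIMSEQ_Suc[OF t(1)] .
  have r': "(\<lambda>k. C (\<tau> (Suc k)) / real (Suc k)) \<longlonglongrightarrow> r" using LIMSEQ_Suc[OF r] .
  have one: "(\<lambda>k. real k / real (Suc k)) \<longlonglongrightarrow> 1" by (rule LIMSEQ_n_over_Suc_n)
  have "(\<lambda>k. (C (\<tau> k) / real k) * (real k / real (Suc k)) / (real (\<tau> (Suc k)) / real (Suc k))) \<longlonglongrightarrow> r * 1 / t"
    using t by (intro tendsto_intros r one t') auto
  moreover have "eventually (\<lambda>k. (C (\<tau> k) / real k) * (real k / real (Suc k)) / (real (\<tau> (Suc k)) / real (Suc k)) = lo k) sequentially"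
    using eventually_gt_at_top[of 0] by eventually_elim (simp add: lo_def del: of_nat_Suc)
  ultimately have lo: "lo \<longlonglongrightarrow> r / t" by (simp add: tendsto_cong)
  have "(\<lambda>k. (C (\<tau> (Suc k)) / real (Suc k)) / ((real (\<tau> k) / real k) * (real k / real (Suc k)))) \<longlonglongrightarrow> r / (t * 1)"
    using t by (intro tendsto_intros r' one t) auto
  moreover have "eventually (\<lambda>k. (C (\<tau> (Suc k)) / real (Suc k)) / ((real (\<tau> k) / real k) * (real k / real (Suc k))) = hi k) sequentially"
    using eventually_gt_at_top[of 0] by eventually_elim (simp add: hi_def del: of_nat_Suc)
  ultimately have hi: "hi \<longlonglongrightarrow> r / t" by (simp add: tendsto_cong)
  have sandwich: "\<exists>k\<ge>K. lo k \<le> C n / n \<and> C n / n \<le> hi k" if n: "\<tau> (Suc K) \<le> n" for K n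
  proof -
    define q where "q = (LEAST k. n < \<tau> k)"
    have ex: "\<exists>k. n < \<tau> k" using strict_mono_imp_increasing[OF mono, of "Suc n"] by (intro exI[of _ "Suc n"]) simp
    have q: "n < \<tau> q" unfolding q_def by (rule LeastI_ex[OF ex])
    have "\<tau> (Suc K) < \<tau> q" using n q by simp
    then have Kq: "Suc K < q" using mono by (simp add: strict_mono_less)
    then obtain k where k: "q = Suc k" "K < k" by (cases q) auto
    have kn: "\<tau> k \<le> n" using not_less_Least[of k "\<lambda>k. n < \<tau> k"] k by (auto simp: q_def)
    have pos: "0 < \<tau> k" using k strict_mono_imp_increasing[OF mono, of k] by simp
    have n': "n < \<tau> (Suc k)" using q k by simp
    have "lo k \<le> C n / n" unfolding lo_def
      using C(2) incseqD[OF C(1) kn] n' pos kn by (intro frac_le) auto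
    moreover have "C n / n \<le> hi k" unfolding hi_def
      using C(2) incseqD[OF C(1), of n "\<tau> (Suc k)"] n' pos kn by (intro frac_le) auto
    ultimately show ?thesis using k by (intro exI[of _ k]) auto
  qed
  show ?thesis
  proof (rule order_tendstoI)
    fix y assume "y < r / t"
    then obtain K where K: "\<And>k. k \<ge> K \<Longrightarrow> y < lo k"
      using order_tendstoD(1)[OF lo] by (auto simp: eventually_sequentially)
    have "y < C n / n" if "\<tau> (Suc K) \<le> n" for n
      using sandwich[OF that] K by (meson less_le_trans)
    then show "eventually (\<lambda>n. y < C n / n) sequentially" by (auto simp: eventually_sequentially)
  next
    fix y assume "r / t < y"
    then obtain K where K: "\<And>k. k \<ge> K \<Longrightarrow> hi k < y"
      using order_tendstoD(2)[OF hi] by (auto simp: eventually_sequentially)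
    have "C n / n < y" if "\<tau> (Suc K) \<le> n" for n
      using sandwich[OF that] K by (meson le_less_trans)
    then show "eventually (\<lambda>n. C n / n < y) sequentially" by (auto simp: eventually_sequentially)
  qed
qed

context regenerative_walk begin

definition regen_time :: "nat \<Rightarrow> 'w \<Rightarrow> nat" where
  "regen_time i \<omega> = nth_time (R \<omega>) i"

definition regen_block :: "nat \<Rightarrow> 'w \<Rightarrow> 'e list" where
  "regen_block i \<omega> = drop (regen_time i \<omega>) (hist (regen_time (Suc i) \<omega>) \<omega>)"

lemma regen_time_measurable [measurable]: "regen_time i \<in> measurable M (count_space UNIV)"
proof (induction i)
  case 0
  show ?case unfolding regen_time_def[abs_def] nth_time.simps by measurable
next
  case (Suc i)
  have [measurable]: "(\<lambda>\<omega>. nth_time (R \<omega>) i) \<in> measurable M (count_space UNIV)"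
    using Suc by (simp add: regen_time_def[abs_def])
  show ?case unfolding regen_time_def[abs_def] nth_time.simps by measurable
qed

lemma regen_block_measurable [measurable]: "regen_block i \<in> measurable M (count_space UNIV)"
proof -
  have "(\<lambda>\<omega>. drop j (hist m \<omega>)) \<in> measurable M (count_space UNIV)" for j m
    using measurable_compose[OF hist_measurable[of m], of "drop j" "count_space UNIV"] by simp
  then have "(\<lambda>\<omega>. drop (regen_time i \<omega>) (hist m \<omega>)) \<in> measurable M (count_space UNIV)" for m
    by (rule measurable_compose_countable[OF _ regen_time_measurable])
  then show ?thesis unfolding regen_block_def[abs_def]
    by (rule measurable_compose_countable[OF _ regen_time_measurable])
qed

lemma regen_time_props:
  assumes "infinite (R \<omega>)"
  shows "regen_time i \<omega> \<in> R \<omega>" "regen_time i \<omega> < regen_time (Suc i) \<omega>" "block l (regen_block i \<omega>)"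
    and "strict_mono (\<lambda>i. regen_time i \<omega>)"
proof -
  show *: "regen_time i \<omega> \<in> R \<omega>" "regen_time i \<omega> < regen_time (Suc i) \<omega>" for i
    using nth_time_in[OF assms] nth_time_Suc[OF assms] by (auto simp: regen_time_def)
  show "block l (regen_block i \<omega>)" unfolding regen_block_def
    using *[of i] *[of "Suc i"] not_in_between_nth_times[of "R \<omega>" i]
    by (subst block_between_regen_times_iff) (auto simp: regen_time_def)
  show "strict_mono (\<lambda>i. regen_time i \<omega>)" using *(2) by (simp add: strict_mono_Suc_iff)
qed

lemma regen_time_Suc_eqI:
  assumes "infinite (R \<omega>)" "m \<in> R \<omega>" "regen_time i \<omega> < m" "block l (drop (regen_time i \<omega>) (hist m \<omega>))"
  shows "regen_time (Suc i) \<omega> = m"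
proof -
  have no: "j \<notin> R \<omega>" if "regen_time i \<omega> < j" "j < m" for j
    using block_between_regen_times_iff[OF regen_time_props(1)[OF assms(1)] assms(2,3)] assms(4) that by blast
  show ?thesis using regen_time_props(1,2)[OF assms(1)] assms(2,3) no[of "regen_time (Suc i) \<omega>"]
      not_in_between_nth_times[of "R \<omega>" i m] by (auto simp: regen_time_def not_less intro: linorder_cases)
qed

lemma regen_time_determined:
  assumes "infinite (R \<omega>)" and eq: "hist (regen_time i \<omega>) \<omega>' = hist (regen_time i \<omega>) \<omega>" and "regen_time i \<omega> \<in> R \<omega>'" and "k \<le> i"
  shows "regen_time k \<omega>' = regen_time k \<omega>"
  using nth_time_cong[OF assms(1), of i "R \<omega>'" k]
    regen_times_cong[OF eq[symmetric] regen_time_props(1)[OF assms(1)] assms(3)] \<open>k \<le> i\<close>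
  by (simp add: regen_time_def)

text \<open>The events \<open>E\<close> admitted here are those decided by the path up to the
\<open>i\<close>-th regeneration time. The paths up to that time, for outcomes in
\<open>E\<close>, form a family as in \<open>emeasure_regen_family_append\<close>. Different
members exclude each other since a path that ends in a regeneration time determines how many such
times precede its end.\<close>
lemma prob_next_block:
  assumes E: "E \<in> sets M" "\<And>\<omega>. \<omega> \<in> E \<Longrightarrow> infinite (R \<omega>)"
    and det: "\<And>\<omega> \<omega>'. \<omega> \<in> E \<Longrightarrow> \<omega>' \<in> space M \<Longrightarrow> infinite (R \<omega>') \<Longrightarrow>
      hist (regen_time i \<omega>) \<omega>' = hist (regen_time i \<omega>) \<omega> \<Longrightarrow> regen_time i \<omega> \<in> R \<omega>' \<Longrightarrow> \<omega>' \<in> E"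
    and h: "block l h"
  shows "prob {\<omega>\<in>space M. \<omega> \<in> E \<and> regen_block i \<omega> = h} = weight h * prob E"
proof -
  define \<Gamma> where "\<Gamma> = (\<lambda>\<omega>. hist (regen_time i \<omega>) \<omega>) ` E"
  have ES: "\<omega> \<in> space M" if "\<omega> \<in> E" for \<omega> using that sets.sets_into_space[OF E(1)] by blast
  have h': "strict_record l h" "nonneg_path l h" "h \<noteq> []" using h by (auto simp: block_def)
  have regen_time_eq: "regen_time i \<omega> = length g" if "\<omega> \<in> regen_at g" "g \<in> \<Gamma>" for \<omega> g
  proof -
    from that obtain \<omega>0 where w0: "\<omega>0 \<in> E" "g = hist (regen_time i \<omega>0) \<omega>0" unfolding \<Gamma>_def by blast
    have len: "length g = regen_time i \<omega>0" using w0(2) by simp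
    have "hist (length g) \<omega> = g" "length g \<in> R \<omega>" using that(1) unfolding regen_at_def by blast+
    note hg = this[unfolded len]
    have "regen_time i \<omega> = regen_time i \<omega>0"
      by (rule regen_time_determined[OF E(2)[OF w0(1)] trans[OF hg(1) w0(2)] hg(2) order_refl])
    then show ?thesis using len by simp
  qed
  have recg: "strict_record l g" if "g \<in> \<Gamma>" for g
    using that regen_time_props(1)[OF E(2)] by (auto simp: \<Gamma>_def strict_record_hist regen_times_def)
  have disj: "disjoint_family_on regen_at \<Gamma>"
    unfolding disjoint_family_on_def
  proof (intro ballI impI, rule ccontr)
    fix g g' assume g: "g \<in> \<Gamma>" "g' \<in> \<Gamma>" "g \<noteq> g'" and "regen_at g \<inter> regen_at g' \<noteq> {}"
    then obtain \<omega> where w: "\<omega> \<in> regen_at g" "\<omega> \<in> regen_at g'" by blast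
    then have "length g = length g'" using regen_time_eq[OF w(1) g(1)] regen_time_eq[OF w(2) g(2)] by simp
    then show False using w g(3) unfolding regen_at_def by auto
  qed
  have inE: "\<omega> \<in> E" if w: "\<omega> \<in> regen_at g" and g: "g \<in> \<Gamma>" and "infinite (R \<omega>)" for \<omega> g
  proof -
    from g obtain \<omega>0 where w0: "\<omega>0 \<in> E" "g = hist (regen_time i \<omega>0) \<omega>0" unfolding \<Gamma>_def by blast
    have len: "length g = regen_time i \<omega>0" using w0(2) by simp
    have ws: "\<omega> \<in> space M" and "hist (length g) \<omega> = g" "length g \<in> R \<omega>" using w unfolding regen_at_def by blast+
    note hg = this(2,3)[unfolded len]
    show ?thesis by (rule det[OF w0(1) ws that(3) trans[OF hg(1) w0(2)] hg(2)])
  qed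
  have 1: "\<omega> \<in> (\<Union>g\<in>\<Gamma>. regen_at g) \<longleftrightarrow> \<omega> \<in> E" if "infinite (R \<omega>)" for \<omega>
  proof
    assume "\<omega> \<in> E"
    then have "\<omega> \<in> regen_at (hist (regen_time i \<omega>) \<omega>)"
      using ES regen_time_props(1)[OF that, of i] by (simp add: regen_at_def)
    then show "\<omega> \<in> (\<Union>g\<in>\<Gamma>. regen_at g)" using \<open>\<omega> \<in> E\<close> unfolding \<Gamma>_def by blast
  qed (use inE[OF _ _ that] in blast)
  have 2: "\<omega> \<in> (\<Union>g\<in>\<Gamma>. regen_at (g @ h)) \<longleftrightarrow> \<omega> \<in> E \<and> regen_block i \<omega> = h" if inf: "infinite (R \<omega>)" for \<omega>
  proof
    assume "\<omega> \<in> (\<Union>g\<in>\<Gamma>. regen_at (g @ h))"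
    then obtain g where g: "g \<in> \<Gamma>" "\<omega> \<in> regen_at (g @ h)" by blast
    have w: "\<omega> \<in> regen_at g" using g regen_at_append_subset[OF recg h'(2)] by blast
    have t: "regen_time i \<omega> = length g" by (rule regen_time_eq[OF w g(1)])
    have hi: "hist (length g + length h) \<omega> = g @ h" "length g + length h \<in> R \<omega>"
      using g by (auto simp: regen_at_def)
    have "regen_time (Suc i) \<omega> = length g + length h"
      by (rule regen_time_Suc_eqI[OF inf hi(2)]) (use h h' hi in \<open>auto simp: t\<close>)
    then show "\<omega> \<in> E \<and> regen_block i \<omega> = h" using inE[OF w g(1) inf] by (simp add: regen_block_def t hi)
  next
    assume w: "\<omega> \<in> E \<and> regen_block i \<omega> = h"
    then have "hist (regen_time i \<omega>) \<omega> @ h = hist (regen_time (Suc i) \<omega>) \<omega>"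
      using regen_time_props(2)[OF inf, of i] by (auto simp: regen_block_def intro: hist_split)
    then have "\<omega> \<in> regen_at (hist (regen_time i \<omega>) \<omega> @ h)"
      using ES w regen_time_props(1)[OF inf, of "Suc i"] by (simp add: regen_at_def)
    then show "\<omega> \<in> (\<Union>g\<in>\<Gamma>. regen_at (g @ h))" using w by (auto simp: \<Gamma>_def)
  qed
  have AE2: "AE \<omega> in M. \<omega> \<in> {\<omega>\<in>space M. \<omega> \<in> E \<and> regen_block i \<omega> = h} \<longleftrightarrow> \<omega> \<in> (\<Union>g\<in>\<Gamma>. regen_at (g @ h))"
    using AE_infinite_regen by eventually_elim (use 2 ES in blast)
  have AE1: "AE \<omega> in M. \<omega> \<in> (\<Union>g\<in>\<Gamma>. regen_at g) \<longleftrightarrow> \<omega> \<in> E"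
    using AE_infinite_regen by eventually_elim (rule 1)
  have "emeasure M {\<omega>\<in>space M. \<omega> \<in> E \<and> regen_block i \<omega> = h} = emeasure M (\<Union>g\<in>\<Gamma>. regen_at (g @ h))"
    using E(1) by (intro emeasure_eq_AE[OF AE2]) auto
  also have "\<dots> = ennreal (weight h) * emeasure M (\<Union>g\<in>\<Gamma>. regen_at g)"
    by (rule emeasure_regen_family_append[OF recg disj h'(1,2)])
  also have "emeasure M (\<Union>g\<in>\<Gamma>. regen_at g) = emeasure M E"
    using E(1) by (intro emeasure_eq_AE[OF AE1]) auto
  finally show ?thesis by (simp add: emeasure_eq_measure ennreal_mult[symmetric])
qed

lemma infinite_regen_sets [measurable]: "Measurable.pred M (\<lambda>\<omega>. infinite (R \<omega>))"
  unfolding infinite_nat_iff_unbounded by measurable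

definition block_prob :: "'e list \<Rightarrow> real" where
  "block_prob h = (if block l h then weight h else 0)"

lemma prob_regen_block_not_block:
  assumes "\<not> block l h"
  shows "prob {\<omega>\<in>space M. P \<omega> \<and> regen_block i \<omega> = h} = 0"
proof -
  have "AE \<omega> in M. regen_block i \<omega> \<noteq> h" using AE_infinite_regen
    by eventually_elim (use regen_time_props(3) assms in auto)
  then have "prob {\<omega>\<in>space M. regen_block i \<omega> = h} = 0" by (subst prob_eq_0) auto
  moreover have "prob {\<omega>\<in>space M. P \<omega> \<and> regen_block i \<omega> = h} \<le> prob {\<omega>\<in>space M. regen_block i \<omega> = h}"
    by (intro finite_measure_mono) auto
  ultimately show ?thesis by (simp add: measure_le_0_iff)
qed

lemma prob_regen_block: "prob {\<omega>\<in>space M. regen_block i \<omega> = h} = block_prob h"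
proof (cases "block l h")
  case True
  let ?E = "{\<omega>\<in>space M. infinite (R \<omega>)}"
  have "prob {\<omega>\<in>space M. \<omega> \<in> ?E \<and> regen_block i \<omega> = h} = weight h * prob ?E"
    by (rule prob_next_block) (use True in auto)
  moreover have "prob ?E = 1" using AE_infinite_regen by (subst prob_Collect_eq_1) auto
  moreover have "prob {\<omega>\<in>space M. \<omega> \<in> ?E \<and> regen_block i \<omega> = h} = prob {\<omega>\<in>space M. regen_block i \<omega> = h}"
    using AE_infinite_regen by (intro finite_measure_eq_AE) (auto elim!: eventually_mono)
  ultimately show ?thesis using True by (simp add: block_prob_def)
qed (use prob_regen_block_not_block[of h "\<lambda>_. True"] in \<open>simp add: block_prob_def\<close>)

text \<open>The earlier block is determined by the path up to the \<open>i\<close>-th regeneration time.\<close>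
lemma prob_two_regen_blocks:
  assumes "j < i"
  shows "prob {\<omega>\<in>space M. regen_block j \<omega> = h' \<and> regen_block i \<omega> = h} = block_prob h' * block_prob h"
proof (cases "block l h")
  case True
  let ?E = "{\<omega>\<in>space M. infinite (R \<omega>) \<and> regen_block j \<omega> = h'}"
  have a: "prob {\<omega>\<in>space M. \<omega> \<in> ?E \<and> regen_block i \<omega> = h} = weight h * prob ?E"
  proof (rule prob_next_block)
    fix \<omega> \<omega>' assume w: "\<omega> \<in> ?E" "\<omega>' \<in> space M" "infinite (R \<omega>')"
      and eq: "hist (regen_time i \<omega>) \<omega>' = hist (regen_time i \<omega>) \<omega>" and R': "regen_time i \<omega> \<in> R \<omega>'"
    have inf: "infinite (R \<omega>)" using w by simp
    have le: "regen_time (Suc j) \<omega> \<le> regen_time i \<omega>"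
      using strict_mono_less_eq[OF regen_time_props(4)[OF inf], of "Suc j" i] assms by simp
    have "regen_time j \<omega>' = regen_time j \<omega>" "regen_time (Suc j) \<omega>' = regen_time (Suc j) \<omega>"
      using regen_time_determined[OF inf eq R'] assms by auto
    moreover have "hist (regen_time (Suc j) \<omega>) \<omega>' = hist (regen_time (Suc j) \<omega>) \<omega>"
      using arg_cong[OF eq, of "take (regen_time (Suc j) \<omega>)"] le by simp
    ultimately have "regen_block j \<omega>' = regen_block j \<omega>" by (simp add: regen_block_def)
    then show "\<omega>' \<in> ?E" using w by simp
  qed (use True in auto)
  have b: "prob ?E = prob {\<omega>\<in>space M. regen_block j \<omega> = h'}"
    using AE_infinite_regen by (intro finite_measure_eq_AE) (auto elim!: eventually_mono)
  have c: "prob {\<omega>\<in>space M. \<omega> \<in> ?E \<and> regen_block i \<omega> = h} = prob {\<omega>\<in>space M. regen_block j \<omega> = h' \<and> regen_block i \<omega> = h}"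
    using AE_infinite_regen by (intro finite_measure_eq_AE) (auto elim!: eventually_mono)
  show ?thesis unfolding c[symmetric] a b prob_regen_block using True by (simp add: block_prob_def)
qed (simp add: prob_regen_block_not_block block_prob_def)

lemma indep_regen_blocks: "i \<noteq> j \<Longrightarrow> indep_var (count_space UNIV) (regen_block i) (count_space UNIV) (regen_block j)"
proof (rule indep_var_discrete)
  fix h h' assume "i \<noteq> j"
  show "prob {\<omega>\<in>space M. regen_block i \<omega> = h \<and> regen_block j \<omega> = h'} = prob {\<omega>\<in>space M. regen_block i \<omega> = h} * prob {\<omega>\<in>space M. regen_block j \<omega> = h'}"
  proof (cases "i < j")
    case True
    then show ?thesis by (simp only: prob_two_regen_blocks prob_regen_block)
  next
    case False
    have "{\<omega>\<in>space M. regen_block i \<omega> = h \<and> regen_block j \<omega> = h'} = {\<omega>\<in>space M. regen_block j \<omega> = h' \<and> regen_block i \<omega> = h}" by blast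
    then show ?thesis using False \<open>i \<noteq> j\<close> by (simp only: prob_two_regen_blocks prob_regen_block linorder_neq_iff mult.commute simp_thms)
  qed
qed auto

lemma distr_regen_block: "distr M (count_space UNIV) (regen_block i) = distr M (count_space UNIV) (regen_block 0)"
proof (rule measure_eqI_countable[where A=UNIV])
  fix h
  show "emeasure (distr M (count_space UNIV) (regen_block i)) {h} = emeasure (distr M (count_space UNIV) (regen_block 0)) {h}"
    using prob_regen_block[of _ h] by (simp add: emeasure_distr emeasure_eq_measure vimage_def Int_def conj_commute)
qed auto

text \<open>The tails of the block length are the summable probabilities of \<open>summable_isolated\<close>,
up to the factor \<open>no_return\<close>, which is the probability that time 0 is a regeneration
time.\<close>
lemma integrable_block_length: "integrable M (\<lambda>\<omega>. real (length (regen_block 0 \<omega>)))"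
proof (rule integrableI_nonneg)
  have [measurable]: "(\<lambda>\<omega>. length (regen_block 0 \<omega>)) \<in> measurable M (count_space UNIV)"
    using measurable_compose[OF regen_block_measurable, of length "count_space UNIV"] by simp
  have le: "emeasure M {\<omega>\<in>space M. length (regen_block 0 \<omega>) \<le> j} = (\<integral>\<^sup>+h. ennreal (weight h) \<partial>count_space (short_blocks j))" for j
  proof -
    have "emeasure M {\<omega>\<in>space M. length (regen_block 0 \<omega>) \<le> j} = emeasure M (\<Union>h\<in>short_blocks j. {\<omega>\<in>space M. regen_block 0 \<omega> = h})"
      using AE_infinite_regen by (intro emeasure_eq_AE) (auto elim!: eventually_mono simp: short_blocks_def regen_time_props(3))
    also have "\<dots> = (\<integral>\<^sup>+h. emeasure M {\<omega>\<in>space M. regen_block 0 \<omega> = h} \<partial>count_space (short_blocks j))"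
      by (intro emeasure_UN_countable) (auto simp: disjoint_family_on_def)
    also have "\<dots> = (\<integral>\<^sup>+h. ennreal (weight h) \<partial>count_space (short_blocks j))"
      by (intro nn_integral_cong) (auto simp: emeasure_eq_measure prob_regen_block block_prob_def short_blocks_def)
    finally show ?thesis .
  qed
  have tail: "prob {\<omega>\<in>space M. j < length (regen_block 0 \<omega>)} = prob (isolated 0 j) / no_return" for j
  proof -
    let ?N = "{\<omega>\<in>space M. 0 \<in> R \<omega> \<and> (\<exists>i. 0 < i \<and> i \<le> 0 + j \<and> i \<in> R \<omega>)}"
    have "emeasure M ?N = emeasure M {\<omega>\<in>space M. length (regen_block 0 \<omega>) \<le> j} * emeasure M {\<omega>\<in>space M. 0 \<in> R \<omega>}"
      unfolding emeasure_next_regen le ..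
    then have N: "prob ?N = prob {\<omega>\<in>space M. length (regen_block 0 \<omega>) \<le> j} * no_return"
      using no_return_pos
      by (simp add: emeasure_eq_measure ennreal_mult[symmetric] prob_regen_at_time record_prob_0)
    have R0: "prob {\<omega>\<in>space M. 0 \<in> R \<omega>} = no_return"
      using prob_regen_at_time[of 0] record_prob_0 by simp
    have "isolated 0 j = {\<omega>\<in>space M. 0 \<in> R \<omega>} - ?N" by (auto simp: isolated_def)
    then have "prob (isolated 0 j) = prob ({\<omega>\<in>space M. 0 \<in> R \<omega>} - ?N)" by simp
    also have "\<dots> = prob {\<omega>\<in>space M. 0 \<in> R \<omega>} - prob ?N" by (intro finite_measure_Diff) auto
    also have "\<dots> = no_return * (1 - prob {\<omega>\<in>space M. length (regen_block 0 \<omega>) \<le> j})"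
      unfolding N R0 by (simp add: right_diff_distrib mult.commute)
    also have "1 - prob {\<omega>\<in>space M. length (regen_block 0 \<omega>) \<le> j} = prob (space M - {\<omega>\<in>space M. length (regen_block 0 \<omega>) \<le> j})"
      by (rule prob_compl[symmetric]) measurable
    also have "space M - {\<omega>\<in>space M. length (regen_block 0 \<omega>) \<le> j} = {\<omega>\<in>space M. j < length (regen_block 0 \<omega>)}"
      by auto
    finally show ?thesis using no_return_pos by simp
  qed
  have "(\<integral>\<^sup>+\<omega>. ennreal (real (length (regen_block 0 \<omega>))) \<partial>M) = (\<integral>\<^sup>+\<omega>. of_nat (length (regen_block 0 \<omega>)) \<partial>M)"
    by (simp add: ennreal_of_nat_eq_real_of_nat)
  also have "\<dots> = (\<Sum>j. emeasure M {\<omega>\<in>space M. j < length (regen_block 0 \<omega>)})"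
    by (rule nn_integral_nat_function) measurable
  also have "\<dots> = (\<Sum>j. ennreal (prob (isolated 0 j) / no_return))"
    by (simp add: emeasure_eq_measure tail)
  also have "\<dots> = ennreal (\<Sum>j. prob (isolated 0 j) / no_return)"
    using no_return_pos by (intro suminf_ennreal2 summable_divide summable_isolated) auto
  also have "\<dots> < \<infinity>" by simp
  finally show "(\<integral>\<^sup>+\<omega>. ennreal (real (length (regen_block 0 \<omega>))) \<partial>M) < \<infinity>" .
qed (auto intro!: measurable_compose[OF regen_block_measurable, of "\<lambda>h. real (length h)"])

lemma block_strong_law:
  fixes f :: "'e list \<Rightarrow> real"
  assumes f: "\<And>h. 0 \<le> f h" "\<And>h. f h \<le> real (length h)"
  shows "AE \<omega> in M. (\<lambda>n. (\<Sum>i<n. f (regen_block i \<omega>)) / real n) \<longlonglongrightarrow> expectation (\<lambda>\<omega>. f (regen_block 0 \<omega>))"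
proof (rule strong_law_of_large_numbers_nonneg)
  show meas: "random_variable borel (\<lambda>\<omega>. f (regen_block i \<omega>))" for i
    using measurable_compose[OF regen_block_measurable, of f borel i] by simp
  show "integrable M (\<lambda>\<omega>. f (regen_block 0 \<omega>))"
    by (rule Bochner_Integration.integrable_bound[OF integrable_block_length meas]) (use f in auto)
  show "distr M borel (\<lambda>\<omega>. f (regen_block i \<omega>)) = distr M borel (\<lambda>\<omega>. f (regen_block 0 \<omega>))" for i
    using distr_distr[of f "count_space UNIV" borel "regen_block i" M] distr_distr[of f "count_space UNIV" borel "regen_block 0" M]
    by (simp add: distr_regen_block[of i] comp_def)
  show "indep_var borel (\<lambda>\<omega>. f (regen_block i \<omega>)) borel (\<lambda>\<omega>. f (regen_block j \<omega>))" if "i \<noteq> j" for i j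
    using indep_var_compose[OF indep_regen_blocks[OF that], of f borel f borel] by (simp add: comp_def)
qed (use f in auto)

text \<open>Both the time and the sum of \<open>c\<close> up to the \<open>n\<close>-th regeneration time are
sums over independent, identically distributed blocks, apart from the piece before the first
regeneration time, which is negligible after division by \<open>n\<close>.\<close>
theorem step_averages_converge:
  fixes c :: "'e \<Rightarrow> real"
  assumes c: "\<And>e. 0 \<le> c e" "\<And>e. c e \<le> 1"
  shows "\<exists>\<alpha>. AE \<omega> in M. (\<lambda>n. (\<Sum>i<n. c (S i \<omega>)) / real n) \<longlonglongrightarrow> \<alpha>"
proof -
  define f where "f h = (\<Sum>e\<leftarrow>h. c e)" for h
  have f: "0 \<le> f h" "f h \<le> real (length h)" for h
    unfolding f_def using c by (induction h) (auto intro: add_mono order_trans)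
  define t where "t = expectation (\<lambda>\<omega>. real (length (regen_block 0 \<omega>)))"
  define r where "r = expectation (\<lambda>\<omega>. f (regen_block 0 \<omega>))"
  have "1 \<le> t"
  proof -
    have "expectation (\<lambda>_. 1) \<le> t" unfolding t_def
    proof (rule integral_mono_AE)
      show "AE \<omega> in M. 1 \<le> real (length (regen_block 0 \<omega>))"
        using AE_infinite_regen by eventually_elim (use regen_time_props(3)[of _ 0] in \<open>auto simp: block_def Suc_le_eq\<close>)
    qed (auto intro: integrable_block_length)
    then show ?thesis by (simp add: prob_space)
  qed
  have "AE \<omega> in M. (\<lambda>n. (\<Sum>i<n. real (length (regen_block i \<omega>))) / real n) \<longlonglongrightarrow> t"
    unfolding t_def by (rule block_strong_law) auto
  moreover have "AE \<omega> in M. (\<lambda>n. (\<Sum>i<n. f (regen_block i \<omega>)) / real n) \<longlonglongrightarrow> r"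
    unfolding r_def by (rule block_strong_law) (use f in auto)
  ultimately have "AE \<omega> in M. (\<lambda>n. (\<Sum>i<n. c (S i \<omega>)) / real n) \<longlonglongrightarrow> r / t"
    using AE_infinite_regen
  proof eventually_elim
    case (elim \<omega>)
    \<comment> \<open>Written as a function of the history, the sum splits at the regeneration times.\<close>
    define C where "C n = f (hist n \<omega>)" for n
    have C_eq: "C n = (\<Sum>i<n. c (S i \<omega>))" for n
      unfolding C_def f_def hist_def by (simp add: interv_sum_list_conv_sum_set_nat lessThan_atLeast0 comp_def)
    have f_app: "f (g @ h) = f g + f h" for g h by (simp add: f_def)
    have regen_time_sum: "regen_time n \<omega> = regen_time 0 \<omega> + (\<Sum>i<n. length (regen_block i \<omega>))" for n
    proof (induction n)
      case (Suc n)
      have "length (regen_block n \<omega>) = regen_time (Suc n) \<omega> - regen_time n \<omega>" by (simp add: regen_block_def)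
      with Suc regen_time_props(2)[OF elim(3), of n] show ?case unfolding sum.lessThan_Suc by linarith
    qed simp
    have C_sum: "C (regen_time n \<omega>) = C (regen_time 0 \<omega>) + (\<Sum>i<n. f (regen_block i \<omega>))" for n
    proof (induction n)
      case (Suc n)
      have "hist (regen_time (Suc n) \<omega>) \<omega> = hist (regen_time n \<omega>) \<omega> @ regen_block n \<omega>"
        unfolding regen_block_def using regen_time_props(2)[OF elim(3), of n] by (intro hist_split[symmetric]) simp
      then show ?case using Suc by (simp add: C_def f_app)
    qed simp
    have const: "(\<lambda>n. x / real n) \<longlonglongrightarrow> 0" for x :: real by (rule lim_const_over_n)
    have "(\<lambda>n. real (regen_time 0 \<omega>) / real n + (\<Sum>i<n. real (length (regen_block i \<omega>))) / real n) \<longlonglongrightarrow> 0 + t"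
      using elim(1) by (intro tendsto_add const)
    then have t: "(\<lambda>n. real (regen_time n \<omega>) / real n) \<longlonglongrightarrow> t"
      by (subst regen_time_sum) (simp add: add_divide_distrib)
    have "(\<lambda>n. C (regen_time 0 \<omega>) / real n + (\<Sum>i<n. f (regen_block i \<omega>)) / real n) \<longlonglongrightarrow> 0 + r"
      using elim(2) by (intro tendsto_add const)
    then have r: "(\<lambda>n. C (regen_time n \<omega>) / real n) \<longlonglongrightarrow> r"
      by (subst C_sum) (simp add: add_divide_distrib)
    have "(\<lambda>n. C n / real n) \<longlonglongrightarrow> r / t"
    proof (rule ratio_tendsto_along_random_times[OF regen_time_props(4)[OF elim(3)] _ _ t _ r])
      show "incseq C" by (rule incseq_SucI) (simp add: C_eq c)
    qed (use \<open>1 \<le> t\<close> f in \<open>auto simp: C_def\<close>)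
    then show ?case by (simp add: C_eq)
  qed
  then show ?thesis ..
qed

end

section \<open>Processes with a given one-step law\<close>

lemma (in prob_space) nn_integral_discrete:
  fixes U :: "'a \<Rightarrow> 'b::countable" and F :: "'b \<Rightarrow> ennreal"
  assumes [measurable]: "random_variable (count_space UNIV) U"
  shows "(\<integral>\<^sup>+\<omega>. F (U \<omega>) \<partial>M) = (\<integral>\<^sup>+u. F u * ennreal (prob {\<omega>\<in>space M. U \<omega> = u}) \<partial>count_space UNIV)"
proof -
  have "(\<integral>\<^sup>+\<omega>. F (U \<omega>) \<partial>M) = (\<integral>\<^sup>+\<omega>. \<integral>\<^sup>+u. F u * indicator {\<omega>\<in>space M. U \<omega> = u} \<omega> \<partial>count_space UNIV \<partial>M)"
  proof (intro nn_integral_cong)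
    fix \<omega> assume w: "\<omega> \<in> space M"
    have "(\<integral>\<^sup>+u. F u * indicator {\<omega>\<in>space M. U \<omega> = u} \<omega> \<partial>count_space UNIV)
        = (\<integral>\<^sup>+u. F u * indicator {U \<omega>} u \<partial>count_space UNIV)"
      by (intro nn_integral_cong) (use w in \<open>auto simp: indicator_def\<close>)
    also have "\<dots> = F (U \<omega>)" by (subst nn_integral_indicator_singleton) auto
    finally show "F (U \<omega>) = (\<integral>\<^sup>+u. F u * indicator {\<omega>\<in>space M. U \<omega> = u} \<omega> \<partial>count_space UNIV)" ..
  qed
  also have "\<dots> = (\<integral>\<^sup>+u. \<integral>\<^sup>+\<omega>. F u * indicator {\<omega>\<in>space M. U \<omega> = u} \<omega> \<partial>M \<partial>count_space UNIV)"
    by (rule nn_integral_count_space_nn_integral) auto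
  also have "\<dots> = (\<integral>\<^sup>+u. F u * ennreal (prob {\<omega>\<in>space M. U \<omega> = u}) \<partial>count_space UNIV)"
    by (intro nn_integral_cong) (simp add: nn_integral_cmult_indicator emeasure_eq_measure)
  finally show ?thesis .
qed

text \<open>\<open>K s\<close> is the conditional law of the next step after the path \<open>s\<close>.\<close>
locale kernel_process = step_process M S l
  for M :: "'w measure" and S :: "nat \<Rightarrow> 'w \<Rightarrow> 'e::countable" and l :: "'e \<Rightarrow> real" +
  fixes K :: "'e list \<Rightarrow> 'e pmf"
  assumes kernel: "\<And>n s e. prob {\<omega>\<in>space M. hist n \<omega> = s \<and> S n \<omega> = e} = prob {\<omega>\<in>space M. hist n \<omega> = s} * pmf (K s) e"
begin

lemma nn_integral_one_step:
  fixes F :: "'e list \<Rightarrow> 'e \<Rightarrow> ennreal"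
  shows "(\<integral>\<^sup>+\<omega>. F (hist n \<omega>) (S n \<omega>) \<partial>M) = (\<integral>\<^sup>+\<omega>. (\<integral>\<^sup>+e. F (hist n \<omega>) e \<partial>K (hist n \<omega>)) \<partial>M)"
proof -
  have "(\<lambda>\<omega>. (hist n \<omega>, S n \<omega>)) \<in> measurable M (count_space UNIV \<Otimes>\<^sub>M count_space UNIV)"
    by measurable
  then have [measurable]: "(\<lambda>\<omega>. (hist n \<omega>, S n \<omega>)) \<in> measurable M (count_space UNIV)"
    by (simp add: pair_measure_countable)
  have "(\<integral>\<^sup>+\<omega>. F (hist n \<omega>) (S n \<omega>) \<partial>M)
      = (\<integral>\<^sup>+u. case_prod F u * ennreal (prob {\<omega>\<in>space M. (hist n \<omega>, S n \<omega>) = u}) \<partial>count_space UNIV)"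
    using nn_integral_discrete[of "\<lambda>\<omega>. (hist n \<omega>, S n \<omega>)" "case_prod F"] by simp
  also have "\<dots> = (\<integral>\<^sup>+s. \<integral>\<^sup>+e. F s e * ennreal (prob {\<omega>\<in>space M. hist n \<omega> = s} * pmf (K s) e) \<partial>count_space UNIV \<partial>count_space UNIV)"
    by (subst nn_integral_fst_count_space[symmetric]) (simp add: kernel[symmetric])
  also have "\<dots> = (\<integral>\<^sup>+s. (\<integral>\<^sup>+e. F s e \<partial>K s) * ennreal (prob {\<omega>\<in>space M. hist n \<omega> = s}) \<partial>count_space UNIV)"
  proof (intro nn_integral_cong)
    fix s
    have "(\<integral>\<^sup>+e. F s e * ennreal (prob {\<omega>\<in>space M. hist n \<omega> = s} * pmf (K s) e) \<partial>count_space UNIV)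
        = (\<integral>\<^sup>+e. (ennreal (pmf (K s) e) * F s e) * ennreal (prob {\<omega>\<in>space M. hist n \<omega> = s}) \<partial>count_space UNIV)"
      by (intro nn_integral_cong) (simp add: ennreal_mult ac_simps)
    also have "\<dots> = (\<integral>\<^sup>+e. ennreal (pmf (K s) e) * F s e \<partial>count_space UNIV) * ennreal (prob {\<omega>\<in>space M. hist n \<omega> = s})"
      by (rule nn_integral_multc) simp
    finally show "(\<integral>\<^sup>+e. F s e * ennreal (prob {\<omega>\<in>space M. hist n \<omega> = s} * pmf (K s) e) \<partial>count_space UNIV)
        = (\<integral>\<^sup>+e. F s e \<partial>K s) * ennreal (prob {\<omega>\<in>space M. hist n \<omega> = s})"
      by (simp add: nn_integral_measure_pmf)
  qed
  also have "\<dots> = (\<integral>\<^sup>+\<omega>. (\<integral>\<^sup>+e. F (hist n \<omega>) e \<partial>K (hist n \<omega>)) \<partial>M)"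
    by (rule nn_integral_discrete[symmetric]) simp
  finally show ?thesis .
qed

lemma hist_fun_borel [measurable]: "(\<lambda>\<omega>. F (hist n \<omega>)) \<in> borel_measurable M" for F :: "'e list \<Rightarrow> 'b::topological_space"
  using measurable_compose[OF hist_measurable, of F borel n] by simp

lemma step_fun_borel [measurable]: "(\<lambda>\<omega>. F (S n \<omega>)) \<in> borel_measurable M" for F :: "'e \<Rightarrow> 'b::topological_space"
  using measurable_compose[OF S_measurable, of F borel n] by simp

text \<open>Expanding \<open>(z + f e) ^ 4\<close>, the term that is linear in \<open>f e\<close> has mean 0,
so the fourth moment of the sum grows in each step only by the order of its second moment, which
is linear in \<open>n\<close>.\<close>
lemma martingale_fourth_moment:
  fixes f :: "'e \<Rightarrow> real" and C :: real
  assumes int: "\<And>s. integrable (K s) f" "\<And>s. integrable (K s) (\<lambda>e. f e ^ 2)"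
      "\<And>s. integrable (K s) (\<lambda>e. f e ^ 3)" "\<And>s. integrable (K s) (\<lambda>e. f e ^ 4)"
    and mean: "\<And>s. (\<integral>e. f e \<partial>K s) = 0"
    and mom: "\<And>s. (\<integral>e. f e ^ 2 \<partial>K s) \<le> C" "\<And>s. \<bar>\<integral>e. f e ^ 3 \<partial>K s\<bar> \<le> C" "\<And>s. (\<integral>e. f e ^ 4 \<partial>K s) \<le> C"
  shows "(\<integral>\<^sup>+\<omega>. ennreal ((\<Sum>i<n. f (S i \<omega>)) ^ 4) \<partial>M) \<le> ennreal ((10 * C^2 + 5 * C) * real n ^ 2)"
proof -
  define Z where "Z s = (\<Sum>e\<leftarrow>s. f e)" for s
  have Z_hist: "Z (hist n \<omega>) = (\<Sum>i<n. f (S i \<omega>))" for n \<omega>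
    unfolding Z_def hist_def by (simp add: interv_sum_list_conv_sum_set_nat lessThan_atLeast0 comp_def)
  have C0: "C \<ge> 0" using mom(2)[of "[]"] by linarith
  have sq: "(\<integral>\<^sup>+e. ennreal ((z + f e) ^ 2) \<partial>K s) \<le> ennreal (z ^ 2 + C)" for z s
  proof -
    have "(\<lambda>e. (z + f e) ^ 2) = (\<lambda>e. z ^ 2 + 2 * z * f e + f e ^ 2)"
      by (auto simp: power2_eq_square algebra_simps)
    then have "(\<integral>\<^sup>+e. ennreal ((z + f e) ^ 2) \<partial>K s) = ennreal (z ^ 2 + (\<integral>e. f e ^ 2 \<partial>K s))"
      by (subst nn_integral_eq_integral) (auto simp: int mean)
    also have "\<dots> \<le> ennreal (z ^ 2 + C)" by (intro ennreal_leI add_left_mono mom)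
    finally show ?thesis .
  qed
  have quart: "(\<integral>\<^sup>+e. ennreal ((z + f e) ^ 4) \<partial>K s) \<le> ennreal (z ^ 4 + 10 * C * z ^ 2 + 5 * C)" for z s
  proof -
    have eq: "(\<lambda>e. (z + f e) ^ 4) = (\<lambda>e. z ^ 4 + 4 * z ^ 3 * f e + 6 * z ^ 2 * f e ^ 2 + 4 * z * f e ^ 3 + f e ^ 4)"
      by (auto simp: power4_eq_xxxx power2_eq_square power3_eq_cube algebra_simps)
    have "(\<integral>\<^sup>+e. ennreal ((z + f e) ^ 4) \<partial>K s) = ennreal (\<integral>e. (z + f e) ^ 4 \<partial>K s)"
      by (rule nn_integral_eq_integral) (auto simp: eq int)
    also have "(\<integral>e. (z + f e) ^ 4 \<partial>K s) = z ^ 4 + 6 * z ^ 2 * (\<integral>e. f e ^ 2 \<partial>K s) + 4 * z * (\<integral>e. f e ^ 3 \<partial>K s) + (\<integral>e. f e ^ 4 \<partial>K s)"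
      unfolding eq by (simp add: int mean)
    also have "\<dots> \<le> z ^ 4 + 6 * z ^ 2 * C + 4 * ((z ^ 2 + 1) * C) + C"
    proof (intro add_mono mult_left_mono mom order_refl)
      have "\<bar>z\<bar> \<le> z ^ 2 + 1"
        using zero_le_power2[of "\<bar>z\<bar> - 1"] zero_le_power2[of z] by (simp add: power2_eq_square algebra_simps)
      then have "\<bar>z\<bar> * \<bar>\<integral>e. f e ^ 3 \<partial>K s\<bar> \<le> (z ^ 2 + 1) * C" by (intro mult_mono mom) auto
      then have "z * (\<integral>e. f e ^ 3 \<partial>K s) \<le> (z ^ 2 + 1) * C"
        by (metis abs_le_D1 abs_mult)
      then show "4 * z * (\<integral>e. f e ^ 3 \<partial>K s) \<le> 4 * ((z ^ 2 + 1) * C)" by simp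
    qed auto
    also have "\<dots> = z ^ 4 + 10 * C * z ^ 2 + 5 * C" by (simp add: algebra_simps)
    finally show ?thesis using ennreal_leI by blast
  qed
  have E2: "(\<integral>\<^sup>+\<omega>. ennreal (Z (hist n \<omega>) ^ 2) \<partial>M) \<le> ennreal (C * real n)" for n
  proof (induction n)
    case (Suc n)
    have "(\<integral>\<^sup>+\<omega>. ennreal (Z (hist (Suc n) \<omega>) ^ 2) \<partial>M) = (\<integral>\<^sup>+\<omega>. ennreal ((Z (hist n \<omega>) + f (S n \<omega>)) ^ 2) \<partial>M)"
      by (simp add: hist_Suc Z_def)
    also have "\<dots> = (\<integral>\<^sup>+\<omega>. (\<integral>\<^sup>+e. ennreal ((Z (hist n \<omega>) + f e) ^ 2) \<partial>K (hist n \<omega>)) \<partial>M)"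
      by (rule nn_integral_one_step)
    also have "\<dots> \<le> (\<integral>\<^sup>+\<omega>. ennreal (Z (hist n \<omega>) ^ 2 + C) \<partial>M)" by (intro nn_integral_mono sq)
    also have "\<dots> = (\<integral>\<^sup>+\<omega>. ennreal (Z (hist n \<omega>) ^ 2) \<partial>M) + ennreal C"
      using C0 by (simp add: nn_integral_add emeasure_space_1)
    also have "\<dots> \<le> ennreal (C * real n) + ennreal C" by (intro add_right_mono Suc)
    also have "\<dots> = ennreal (C * real (Suc n))" using C0 by (simp add: ennreal_plus[symmetric] algebra_simps del: ennreal_plus)
    finally show ?case .
  qed (simp add: Z_def)
  have "(\<integral>\<^sup>+\<omega>. ennreal (Z (hist n \<omega>) ^ 4) \<partial>M) \<le> ennreal ((10 * C^2 + 5 * C) * real n ^ 2)"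
  proof (induction n)
    case (Suc n)
    have "(\<integral>\<^sup>+\<omega>. ennreal (Z (hist (Suc n) \<omega>) ^ 4) \<partial>M) = (\<integral>\<^sup>+\<omega>. ennreal ((Z (hist n \<omega>) + f (S n \<omega>)) ^ 4) \<partial>M)"
      by (simp add: hist_Suc Z_def)
    also have "\<dots> = (\<integral>\<^sup>+\<omega>. (\<integral>\<^sup>+e. ennreal ((Z (hist n \<omega>) + f e) ^ 4) \<partial>K (hist n \<omega>)) \<partial>M)"
      by (rule nn_integral_one_step)
    also have "\<dots> \<le> (\<integral>\<^sup>+\<omega>. ennreal (Z (hist n \<omega>) ^ 4 + 10 * C * Z (hist n \<omega>) ^ 2 + 5 * C) \<partial>M)"
      by (intro nn_integral_mono quart)
    also have "\<dots> = (\<integral>\<^sup>+\<omega>. ennreal (Z (hist n \<omega>) ^ 4) \<partial>M) + ennreal (10 * C) * (\<integral>\<^sup>+\<omega>. ennreal (Z (hist n \<omega>) ^ 2) \<partial>M) + ennreal (5 * C)"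
      using C0 by (simp add: nn_integral_add nn_integral_cmult emeasure_space_1 ennreal_mult)
    also have "\<dots> \<le> ennreal ((10 * C^2 + 5 * C) * real n ^ 2) + ennreal (10 * C) * ennreal (C * real n) + ennreal (5 * C)"
      by (intro add_mono mult_left_mono Suc E2) auto
    also have "\<dots> = ennreal ((10 * C^2 + 5 * C) * real n ^ 2 + 10 * C * (C * real n) + 5 * C)"
      using C0 by (simp add: ennreal_mult[symmetric] ennreal_plus[symmetric] del: ennreal_plus)
    also have "\<dots> \<le> ennreal ((10 * C^2 + 5 * C) * real (Suc n) ^ 2)"
      using C0 by (intro ennreal_leI) (simp add: power2_eq_square algebra_simps)
    finally show ?case .
  qed (simp add: Z_def)
  then show ?thesis by (simp add: Z_hist)
qed

text \<open>The fourth moments of the averages are of order \<open>1 / n\<^sup>2\<close>, hence summable, so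
the fourth powers of the averages form an almost surely convergent series.\<close>
lemma martingale_strong_law:
  fixes f :: "'e \<Rightarrow> real" and C :: real
  assumes int: "\<And>s. integrable (K s) f" "\<And>s. integrable (K s) (\<lambda>e. f e ^ 2)"
      "\<And>s. integrable (K s) (\<lambda>e. f e ^ 3)" "\<And>s. integrable (K s) (\<lambda>e. f e ^ 4)"
    and mean: "\<And>s. (\<integral>e. f e \<partial>K s) = 0"
    and mom: "\<And>s. (\<integral>e. f e ^ 2 \<partial>K s) \<le> C" "\<And>s. \<bar>\<integral>e. f e ^ 3 \<partial>K s\<bar> \<le> C" "\<And>s. (\<integral>e. f e ^ 4 \<partial>K s) \<le> C"
  shows "AE \<omega> in M. (\<lambda>n. (\<Sum>i<n. f (S i \<omega>)) / real n) \<longlonglongrightarrow> 0"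
proof -
  define D where "D = 10 * C^2 + 5 * C"
  have D0: "D \<ge> 0" using mom(2)[of "[]"] by (simp add: D_def)
  define Y where "Y n \<omega> = ((\<Sum>i<Suc n. f (S i \<omega>)) / real (Suc n)) ^ 4" for n \<omega>
  have [measurable]: "Y n \<in> borel_measurable M" for n unfolding Y_def by measurable
  have EY: "(\<integral>\<^sup>+\<omega>. ennreal (Y n \<omega>) \<partial>M) \<le> ennreal (D * inverse (real (Suc n) ^ 2))" for n
  proof -
    have "Y n \<omega> = (1 / real (Suc n) ^ 4) * (\<Sum>i<Suc n. f (S i \<omega>)) ^ 4" for \<omega>
      by (simp add: Y_def power_divide del: of_nat_Suc sum.lessThan_Suc)
    then have "(\<integral>\<^sup>+\<omega>. ennreal (Y n \<omega>) \<partial>M) = (\<integral>\<^sup>+\<omega>. ennreal (1 / real (Suc n) ^ 4) * ennreal ((\<Sum>i<Suc n. f (S i \<omega>)) ^ 4) \<partial>M)"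
      by (simp add: ennreal_mult[symmetric] del: of_nat_Suc sum.lessThan_Suc)
    also have "\<dots> = ennreal (1 / real (Suc n) ^ 4) * (\<integral>\<^sup>+\<omega>. ennreal ((\<Sum>i<Suc n. f (S i \<omega>)) ^ 4) \<partial>M)"
      by (intro nn_integral_cmult) measurable
    also have "\<dots> \<le> ennreal (1 / real (Suc n) ^ 4) * ennreal (D * real (Suc n) ^ 2)"
      unfolding D_def by (intro mult_left_mono martingale_fourth_moment int mean mom) auto
    also have "\<dots> = ennreal (D * inverse (real (Suc n) ^ 2))"
      using D0 by (simp add: ennreal_mult[symmetric] power2_eq_square power4_eq_xxxx field_simps del: of_nat_Suc)
    finally show ?thesis .
  qed
  have "(\<integral>\<^sup>+\<omega>. (\<Sum>n. ennreal (Y n \<omega>)) \<partial>M) = (\<Sum>n. \<integral>\<^sup>+\<omega>. ennreal (Y n \<omega>) \<partial>M)"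
    by (rule nn_integral_suminf) measurable
  also have "\<dots> \<le> (\<Sum>n. ennreal (D * inverse (real (Suc n) ^ 2)))"
    by (intro suminf_le EY) auto
  also have "\<dots> = ennreal (\<Sum>n. D * inverse (real (Suc n) ^ 2))"
    using D0 inverse_squares_sums by (intro suminf_ennreal2 summable_mult) (auto simp: sums_iff inverse_eq_divide add.commute)
  finally have "(\<integral>\<^sup>+\<omega>. (\<Sum>n. ennreal (Y n \<omega>)) \<partial>M) \<noteq> \<infinity>" by (auto simp: top_unique)
  then have "AE \<omega> in M. (\<Sum>n. ennreal (Y n \<omega>)) \<noteq> \<infinity>"
    by (intro nn_integral_PInf_AE) auto
  then show ?thesis
  proof eventually_elim
    case (elim \<omega>)
    have "summable (\<lambda>n. Y n \<omega>)"
      by (rule summable_suminf_not_top) (use elim in \<open>auto simp: Y_def\<close>)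
    then have "(\<lambda>n. Y n \<omega>) \<longlonglongrightarrow> 0" by (rule summable_LIMSEQ_zero)
    then have "(\<lambda>n. root 4 (Y n \<omega>)) \<longlonglongrightarrow> root 4 0" by (rule tendsto_real_root)
    then have "(\<lambda>n. \<bar>(\<Sum>i<Suc n. f (S i \<omega>)) / real (Suc n)\<bar>) \<longlonglongrightarrow> 0"
      unfolding Y_def by (subst (asm) power_even_abs[symmetric]) (simp_all add: real_root_power_cancel del: power_even_abs of_nat_Suc sum.lessThan_Suc)
    then have "(\<lambda>n. (\<Sum>i<Suc n. f (S i \<omega>)) / real (Suc n)) \<longlonglongrightarrow> 0"
      by (rule tendsto_rabs_zero_cancel)
    then show ?case by (rule LIMSEQ_imp_Suc)
  qed
qed

text \<open>One more step multiplies the conditional expectation by at most \<open>\<gamma>\<close>, whatever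
the past. The set \<open>G\<close> of paths is kept so that the bound can be used conditionally on
the first \<open>m\<close> steps.\<close>
lemma exp_level_decay:
  assumes \<gamma>: "0 \<le> \<gamma>" "\<And>s. (\<integral>\<^sup>+e. ennreal (exp (- \<theta> * l e)) \<partial>K s) \<le> ennreal \<gamma>"
  shows "(\<integral>\<^sup>+\<omega>. indicator {\<omega>\<in>space M. hist m \<omega> \<in> G} \<omega> * ennreal (exp (- \<theta> * (level (m + i) \<omega> - level m \<omega>))) \<partial>M)
    \<le> ennreal (\<gamma> ^ i) * emeasure M {\<omega>\<in>space M. hist m \<omega> \<in> G}"
proof (induction i)
  case 0
  have "(\<integral>\<^sup>+\<omega>. indicator {\<omega>\<in>space M. hist m \<omega> \<in> G} \<omega> \<partial>M) = emeasure M {\<omega>\<in>space M. hist m \<omega> \<in> G}"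
    by (rule nn_integral_indicator) measurable
  then show ?case by simp
next
  case (Suc i)
  define F where "F s = (indicator G (take m s) * ennreal (exp (- \<theta> * (total l s - total l (take m s)))) :: ennreal)" for s
  have F_eq: "indicator {\<omega>\<in>space M. hist m \<omega> \<in> G} \<omega> * ennreal (exp (- \<theta> * (level (m + i) \<omega> - level m \<omega>))) = F (hist (m + i) \<omega>)"
    if "\<omega> \<in> space M" for i \<omega> using that by (auto simp: F_def level_def indicator_def)
  have step: "(\<integral>\<^sup>+e. F (hist (m + i) \<omega> @ [e]) \<partial>K (hist (m + i) \<omega>)) \<le> F (hist (m + i) \<omega>) * ennreal \<gamma>" for \<omega>
  proof -
    have "F (hist (m + i) \<omega> @ [e]) = F (hist (m + i) \<omega>) * ennreal (exp (- \<theta> * l e))" for e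
      by (simp add: F_def total_def mult.assoc ennreal_mult[symmetric] exp_add[symmetric] algebra_simps)
    then show ?thesis using mult_left_mono[OF \<gamma>(2)[of "hist (m + i) \<omega>"], of "F (hist (m + i) \<omega>)"]
      by (simp add: nn_integral_cmult)
  qed
  have "(\<integral>\<^sup>+\<omega>. indicator {\<omega>\<in>space M. hist m \<omega> \<in> G} \<omega> * ennreal (exp (- \<theta> * (level (m + Suc i) \<omega> - level m \<omega>))) \<partial>M)
     = (\<integral>\<^sup>+\<omega>. F (hist (m + i) \<omega> @ [S (m + i) \<omega>]) \<partial>M)"
    using F_eq[of _ "Suc i"] by (intro nn_integral_cong) (simp add: hist_Suc)
  also have "\<dots> = (\<integral>\<^sup>+\<omega>. (\<integral>\<^sup>+e. F (hist (m + i) \<omega> @ [e]) \<partial>K (hist (m + i) \<omega>)) \<partial>M)"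
    by (rule nn_integral_one_step)
  also have "\<dots> \<le> (\<integral>\<^sup>+\<omega>. F (hist (m + i) \<omega>) * ennreal \<gamma> \<partial>M)" by (intro nn_integral_mono step)
  also have "\<dots> = (\<integral>\<^sup>+\<omega>. F (hist (m + i) \<omega>) \<partial>M) * ennreal \<gamma>" by (intro nn_integral_multc) measurable
  also have "(\<integral>\<^sup>+\<omega>. F (hist (m + i) \<omega>) \<partial>M) = (\<integral>\<^sup>+\<omega>. indicator {\<omega>\<in>space M. hist m \<omega> \<in> G} \<omega> * ennreal (exp (- \<theta> * (level (m + i) \<omega> - level m \<omega>))) \<partial>M)"
    by (intro nn_integral_cong F_eq[symmetric])
  also have "\<dots> * ennreal \<gamma> \<le> (ennreal (\<gamma> ^ i) * emeasure M {\<omega>\<in>space M. hist m \<omega> \<in> G}) * ennreal \<gamma>"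
    by (intro mult_right_mono Suc) auto
  also have "\<dots> = ennreal (\<gamma> ^ Suc i) * emeasure M {\<omega>\<in>space M. hist m \<omega> \<in> G}"
    using \<gamma>(1) by (simp add: ennreal_mult ac_simps)
  finally show ?case .
qed

lemma AE_level_at_top:
  assumes \<gamma>: "0 \<le> \<gamma>" "\<gamma> < 1" "\<And>s. (\<integral>\<^sup>+e. ennreal (exp (- \<theta> * l e)) \<partial>K s) \<le> ennreal \<gamma>" and \<theta>: "\<theta> > 0"
  shows "AE \<omega> in M. filterlim (\<lambda>n. level n \<omega>) at_top sequentially"
proof -
  have E: "(\<integral>\<^sup>+\<omega>. ennreal (exp (- \<theta> * level n \<omega>)) \<partial>M) \<le> ennreal (\<gamma> ^ n)" for n
  proof -
    have "(\<integral>\<^sup>+\<omega>. ennreal (exp (- \<theta> * level n \<omega>)) \<partial>M)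
      = (\<integral>\<^sup>+\<omega>. indicator {\<omega>\<in>space M. hist 0 \<omega> \<in> UNIV} \<omega> * ennreal (exp (- \<theta> * (level (0 + n) \<omega> - level 0 \<omega>))) \<partial>M)"
      by (intro nn_integral_cong) simp
    also have "\<dots> \<le> ennreal (\<gamma> ^ n) * emeasure M {\<omega>\<in>space M. hist 0 \<omega> \<in> UNIV}"
      by (rule exp_level_decay[OF \<gamma>(1,3)])
    finally show ?thesis by (simp add: emeasure_space_1)
  qed
  have "(\<integral>\<^sup>+\<omega>. (\<Sum>n. ennreal (exp (- \<theta> * level n \<omega>))) \<partial>M) = (\<Sum>n. \<integral>\<^sup>+\<omega>. ennreal (exp (- \<theta> * level n \<omega>)) \<partial>M)"
    by (rule nn_integral_suminf) measurable
  also have "\<dots> \<le> (\<Sum>n. ennreal (\<gamma> ^ n))" by (intro suminf_le E) auto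
  also have "\<dots> = ennreal (\<Sum>n. \<gamma> ^ n)" using \<gamma> by (intro suminf_ennreal2 summable_geometric) auto
  finally have "(\<integral>\<^sup>+\<omega>. (\<Sum>n. ennreal (exp (- \<theta> * level n \<omega>))) \<partial>M) \<noteq> \<infinity>" by (auto simp: top_unique)
  then have "AE \<omega> in M. (\<Sum>n. ennreal (exp (- \<theta> * level n \<omega>))) \<noteq> \<infinity>"
    by (intro nn_integral_PInf_AE) auto
  then show ?thesis
  proof eventually_elim
    case (elim \<omega>)
    have "summable (\<lambda>n. exp (- \<theta> * level n \<omega>))"
      by (rule summable_suminf_not_top) (use elim in auto)
    then have lim: "(\<lambda>n. exp (- \<theta> * level n \<omega>)) \<longlonglongrightarrow> 0" by (rule summable_LIMSEQ_zero)
    show ?case unfolding filterlim_at_top_dense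
    proof
      fix b
      have "eventually (\<lambda>n. exp (- \<theta> * level n \<omega>) < exp (- \<theta> * b)) sequentially"
        by (rule order_tendstoD(2)[OF lim]) simp
      then show "eventually (\<lambda>n. b < level n \<omega>) sequentially"
        using \<theta> by (auto elim!: eventually_mono)
    qed
  qed
qed

text \<open>With positive probability the first \<open>m\<close> steps all go up by at least
\<open>\<eta>\<close>. After this head start of \<open>m * \<eta>\<close> the probability of ever
falling below level 0 is, by Markov's inequality and a geometric sum, at most
\<open>exp (- \<theta> * m * \<eta>) / (1 - \<gamma>)\<close>, which is less than 1 for large
\<open>m\<close>.\<close>
lemma never_back_positive:
  assumes \<gamma>: "0 \<le> \<gamma>" "\<gamma> < 1" "\<And>s. (\<integral>\<^sup>+e. ennreal (exp (- \<theta> * l e)) \<partial>K s) \<le> ennreal \<gamma>" and \<theta>: "\<theta> > 0"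
    and up: "\<eta> > 0" "p > 0" "\<And>s. p \<le> measure (K s) {e. \<eta> \<le> l e}"
  shows "prob {\<omega>\<in>space M. \<forall>k. 0 \<le> level k \<omega>} > 0"
proof -
  define G where "G = {s. \<forall>e\<in>set s. \<eta> \<le> l e}"
  define Gw where "Gw m = {\<omega>\<in>space M. hist m \<omega> \<in> G}" for m
  have [measurable]: "Gw m \<in> sets M" for m unfolding Gw_def by measurable
  have G_pos: "ennreal (p ^ m) \<le> emeasure M (Gw m)" for m
  proof (induction m)
    case 0
    then show ?case by (simp add: Gw_def G_def emeasure_space_1)
  next
    case (Suc m)
    have "ennreal (p ^ Suc m) = ennreal (p ^ m) * ennreal p" using up by (simp add: ennreal_mult ac_simps)
    also have "\<dots> \<le> emeasure M (Gw m) * ennreal p" by (intro mult_right_mono Suc) auto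
    also have "\<dots> = (\<integral>\<^sup>+\<omega>. indicator (Gw m) \<omega> * ennreal p \<partial>M)" by (simp add: nn_integral_multc)
    also have "\<dots> \<le> (\<integral>\<^sup>+\<omega>. (\<integral>\<^sup>+e. indicator G (hist m \<omega>) * indicator {e. \<eta> \<le> l e} e \<partial>K (hist m \<omega>)) \<partial>M)"
    proof (intro nn_integral_mono)
      fix \<omega> assume "\<omega> \<in> space M"
      then show "indicator (Gw m) \<omega> * ennreal p \<le> (\<integral>\<^sup>+e. indicator G (hist m \<omega>) * indicator {e. \<eta> \<le> l e} e \<partial>K (hist m \<omega>))"
        using up(3)[of "hist m \<omega>"]
        by (auto simp: Gw_def indicator_def[of G] nn_integral_cmult measure_pmf.emeasure_eq_measure intro!: ennreal_leI split: split_indicator)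
    qed
    also have "\<dots> = (\<integral>\<^sup>+\<omega>. indicator G (hist m \<omega>) * indicator {e. \<eta> \<le> l e} (S m \<omega>) \<partial>M)"
      by (rule nn_integral_one_step[symmetric])
    also have "\<dots> = (\<integral>\<^sup>+\<omega>. indicator (Gw (Suc m)) \<omega> \<partial>M)"
      by (intro nn_integral_cong) (auto simp: Gw_def G_def hist_Suc indicator_def)
    also have "\<dots> = emeasure M (Gw (Suc m))" by simp
    finally show ?case .
  qed
  have level_G: "real k * \<eta> \<le> level k \<omega>" if "\<omega> \<in> Gw m" "k \<le> m" for k m \<omega>
    using that(2)
  proof (induction k)
    case (Suc k)
    have "S k \<omega> \<in> set (hist m \<omega>)" using Suc.prems by (auto simp: hist_def)
    then have "\<eta> \<le> l (S k \<omega>)" using that(1) by (auto simp: Gw_def G_def)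
    then show ?case using Suc by (simp add: level_Suc algebra_simps)
  qed simp
  have "(\<lambda>m. exp (- (\<theta> * \<eta>)) ^ m / (1 - \<gamma>)) \<longlonglongrightarrow> 0 / (1 - \<gamma>)"
    using \<theta> up \<gamma> by (intro tendsto_intros LIMSEQ_power_zero) auto
  then have lim0: "(\<lambda>m. exp (- (\<theta> * \<eta>)) ^ m / (1 - \<gamma>)) \<longlonglongrightarrow> 0" by simp
  have "eventually (\<lambda>m. exp (- (\<theta> * \<eta>)) ^ m / (1 - \<gamma>) < 1) sequentially"
    by (rule order_tendstoD(2)[OF lim0]) simp
  then obtain m where m: "exp (- (\<theta> * \<eta>)) ^ m / (1 - \<gamma>) < 1" by (auto simp: eventually_sequentially)
  define r where "r = exp (- (\<theta> * \<eta>)) ^ m"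
  have r_eq: "r = exp (- \<theta> * (real m * \<eta>))" by (simp add: r_def exp_of_nat_mult[symmetric] algebra_simps)
  define Bad where "Bad i = {\<omega>\<in>space M. \<omega> \<in> Gw m \<and> level (m + i) \<omega> < 0}" for i
  have [measurable]: "Bad i \<in> sets M" for i unfolding Bad_def by measurable
  have Bad: "emeasure M (Bad i) \<le> ennreal (r * \<gamma> ^ i) * emeasure M (Gw m)" for i
  proof -
    have "emeasure M (Bad i) = (\<integral>\<^sup>+\<omega>. indicator (Bad i) \<omega> \<partial>M)" by simp
    also have "\<dots> \<le> (\<integral>\<^sup>+\<omega>. ennreal r * (indicator (Gw m) \<omega> * ennreal (exp (- \<theta> * (level (m + i) \<omega> - level m \<omega>)))) \<partial>M)"
    proof (intro nn_integral_mono)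
      fix \<omega> assume "\<omega> \<in> space M"
      show "indicator (Bad i) \<omega> \<le> ennreal r * (indicator (Gw m) \<omega> * ennreal (exp (- \<theta> * (level (m + i) \<omega> - level m \<omega>))))"
      proof (cases "\<omega> \<in> Bad i")
        case True
        then have g: "\<omega> \<in> Gw m" and neg: "level (m + i) \<omega> < 0" by (auto simp: Bad_def)
        have "real m * \<eta> \<le> level m \<omega>" using level_G[OF g] by simp
        then have "0 \<le> - \<theta> * (real m * \<eta> + (level (m + i) \<omega> - level m \<omega>))"
          using \<theta> neg by (intro mult_nonpos_nonpos) auto
        then have "1 \<le> r * exp (- \<theta> * (level (m + i) \<omega> - level m \<omega>))"
          unfolding r_eq exp_add[symmetric] by (simp add: algebra_simps)
        then show ?thesis using True g by (simp add: ennreal_mult[symmetric] r_def)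
      qed simp
    qed
    also have "\<dots> = ennreal r * (\<integral>\<^sup>+\<omega>. indicator (Gw m) \<omega> * ennreal (exp (- \<theta> * (level (m + i) \<omega> - level m \<omega>))) \<partial>M)"
      by (intro nn_integral_cmult) measurable
    also have "\<dots> \<le> ennreal r * (ennreal (\<gamma> ^ i) * emeasure M (Gw m))"
      unfolding Gw_def by (intro mult_left_mono exp_level_decay \<gamma>) auto
    also have "\<dots> = ennreal (r * \<gamma> ^ i) * emeasure M (Gw m)"
      using \<gamma> by (simp add: ennreal_mult r_def ac_simps)
    finally show ?thesis .
  qed
  have "emeasure M (\<Union>i. Bad i) \<le> (\<Sum>i. emeasure M (Bad i))"
    by (rule emeasure_subadditive_countably) auto
  also have "\<dots> \<le> (\<Sum>i. ennreal (r * \<gamma> ^ i) * emeasure M (Gw m))"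
    by (intro suminf_le Bad) auto
  also have "\<dots> = (\<Sum>i. ennreal (r * \<gamma> ^ i)) * emeasure M (Gw m)" by simp
  also have "(\<Sum>i. ennreal (r * \<gamma> ^ i)) = ennreal (\<Sum>i. r * \<gamma> ^ i)"
    using \<gamma> by (intro suminf_ennreal2 summable_mult summable_geometric) (auto simp: r_def)
  also have "(\<Sum>i. r * \<gamma> ^ i) = r / (1 - \<gamma>)"
    using \<gamma> by (simp add: suminf_mult suminf_geometric)
  finally have "emeasure M (\<Union>i. Bad i) \<le> ennreal (r / (1 - \<gamma>)) * emeasure M (Gw m)" .
  moreover have "ennreal (r / (1 - \<gamma>)) * emeasure M (Gw m) = ennreal (r / (1 - \<gamma>) * prob (Gw m))"
    using \<gamma> unfolding emeasure_eq_measure by (intro ennreal_mult[symmetric]) (auto simp: r_def)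
  moreover have "0 \<le> r / (1 - \<gamma>) * prob (Gw m)" using \<gamma> by (simp add: r_def)
  ultimately have bad: "prob (\<Union>i. Bad i) \<le> r / (1 - \<gamma>) * prob (Gw m)"
    by (simp add: emeasure_eq_measure)
  have "p ^ m \<le> prob (Gw m)" using G_pos[of m] by (simp add: emeasure_eq_measure)
  then have G0: "0 < prob (Gw m)" using up(2) zero_less_power[of p m] by linarith
  have "0 < prob (Gw m) - r / (1 - \<gamma>) * prob (Gw m)"
    using mult_strict_right_mono[of "r / (1 - \<gamma>)" 1 "prob (Gw m)"] m G0 unfolding r_def by simp
  also have "\<dots> \<le> prob (Gw m) - prob (\<Union>i. Bad i)" using bad by simp
  also have "\<dots> = prob (Gw m - (\<Union>i. Bad i))"
    by (rule finite_measure_Diff[symmetric]) (auto simp: Bad_def)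
  also have "\<dots> \<le> prob {\<omega>\<in>space M. \<forall>k. 0 \<le> level k \<omega>}"
  proof (rule finite_measure_mono)
    show "Gw m - (\<Union>i. Bad i) \<subseteq> {\<omega>\<in>space M. \<forall>k. 0 \<le> level k \<omega>}"
    proof
      fix \<omega> assume w: "\<omega> \<in> Gw m - (\<Union>i. Bad i)"
      have ws: "\<omega> \<in> space M" using w by (auto simp: Gw_def)
      have "0 \<le> level k \<omega>" for k
      proof (cases "k \<le> m")
        case True
        have "0 \<le> real k * \<eta>" using up by simp
        also have "\<dots> \<le> level k \<omega>" using level_G[of \<omega> m k] w True by simp
        finally show ?thesis .
      next
        case False
        then show ?thesis using w ws by (auto simp: Bad_def not_less dest: spec[of _ "k - m"])
      qed
      then show "\<omega> \<in> {\<omega>\<in>space M. \<forall>k. 0 \<le> level k \<omega>}" using ws by simp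
    qed
  qed measurable
  finally show ?thesis .
qed

text \<open>The running maximum of the level increases only at records, and then by at most the last step
\<open>x\<close>, which is bounded by \<open>b + x\<^sup>2 / (4 * b)\<close>. So the mean of the
level, which is at least \<open>\<rho> * n\<close>, is at most \<open>b\<close> times the expected
number of records plus \<open>n * C / (4 * b)\<close>; the choice
\<open>b = C / (2 * \<rho>)\<close> makes the last term equal to \<open>\<rho> * n / 2\<close>.\<close>
lemma records_grow_linearly:
  assumes int: "\<And>s. integrable (K s) l" "\<And>s. integrable (K s) (\<lambda>e. l e ^ 2)"
    and mean: "\<rho> > 0" "\<And>s. \<rho> \<le> (\<integral>e. l e \<partial>K s)"
    and mom: "C > 0" "\<And>s. (\<integral>e. l e ^ 2 \<partial>K s) \<le> C"
  shows "\<rho>\<^sup>2 / C * real n \<le> (\<Sum>k\<le>n. prob {\<omega>\<in>space M. strict_record l (hist k \<omega>)})"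
proof -
  define b where "b = C / (2 * \<rho>)"
  have b: "b > 0" using mean mom by (simp add: b_def)
  \<comment> \<open>The excess of \<open>b + x\<^sup>2 / (4 * b)\<close> over \<open>x\<close> is nonnegative, so that all expectations can be
    taken of nonnegative functions.\<close>
  define q where "q e = l e ^ 2 / (4 * b) - l e + b" for e
  have q_alt: "q e = (l e - 2 * b)\<^sup>2 / (4 * b)" for e
    using b by (simp add: q_def power2_eq_square field_simps)
  have q0: "q e \<ge> 0" for e unfolding q_alt using b by simp
  define rec where "rec k \<omega> = (of_bool (strict_record l (hist k \<omega>)) :: real)" for k \<omega>
  have [measurable]: "rec k \<in> borel_measurable M" for k unfolding rec_def by measurable
  define B where "B n \<omega> = (\<Sum>k<n. b * rec (Suc k) \<omega> + l (S k \<omega>) ^ 2 / (4 * b))" for n \<omega>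
  have B_Suc: "B (Suc n) \<omega> = B n \<omega> + (b * rec (Suc n) \<omega> + l (S n \<omega>) ^ 2 / (4 * b))" for n \<omega>
    by (simp add: B_def)
  have B_mono: "B n \<omega> \<le> B (Suc n) \<omega>" for n \<omega>
    using b by (simp add: B_Suc rec_def)
  have level_B: "\<forall>j\<le>n. level j \<omega> \<le> B n \<omega>" for n \<omega>
  proof (induction n)
    case (Suc n)
    have "level (Suc n) \<omega> \<le> B (Suc n) \<omega>"
    proof (cases "strict_record l (hist (Suc n) \<omega>)")
      case True
      have "l (S n \<omega>) \<le> b + l (S n \<omega>) ^ 2 / (4 * b)" using q0[of "S n \<omega>"] by (simp add: q_def)
      then show ?thesis using Suc True by (simp add: level_Suc B_Suc rec_def add_mono)
    next
      case False
      then obtain i where "i \<le> n" "level (Suc n) \<omega> \<le> level i \<omega>"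
        by (auto simp: strict_record_hist not_less less_Suc_eq_le)
      then show ?thesis using Suc B_mono[of n \<omega>] by (meson order_trans)
    qed
    then show ?case using Suc B_mono[of n \<omega>] by (auto simp: le_Suc_eq intro: order_trans)
  qed (simp add: B_def)
  have path: "real n * b \<le> b * (\<Sum>k\<le>n. rec k \<omega>) + (\<Sum>k<n. q (S k \<omega>))" for \<omega>
  proof -
    have lev: "level n \<omega> = (\<Sum>k<n. l (S k \<omega>))" by (induction n) (auto simp: level_Suc)
    have "(\<Sum>k\<le>n. rec k \<omega>) = rec 0 \<omega> + (\<Sum>k<n. rec (Suc k) \<omega>)"
      by (simp only: lessThan_Suc_atMost[symmetric] sum.lessThan_Suc_shift)
    moreover have "0 \<le> rec 0 \<omega>" by (simp add: rec_def)
    ultimately have "(\<Sum>k<n. rec (Suc k) \<omega>) \<le> (\<Sum>k\<le>n. rec k \<omega>)" by simp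
    then have "b * (\<Sum>k<n. rec (Suc k) \<omega>) \<le> b * (\<Sum>k\<le>n. rec k \<omega>)" using b by simp
    moreover have "(\<Sum>k<n. q (S k \<omega>)) = (\<Sum>k<n. l (S k \<omega>) ^ 2 / (4 * b)) - level n \<omega> + real n * b"
      unfolding lev q_def by (simp add: sum.distrib sum_subtractf)
    moreover have "B n \<omega> = b * (\<Sum>k<n. rec (Suc k) \<omega>) + (\<Sum>k<n. l (S k \<omega>) ^ 2 / (4 * b))"
      unfolding B_def by (simp add: sum.distrib sum_distrib_left)
    moreover have "level n \<omega> \<le> B n \<omega>" using level_B[of n \<omega>] by simp
    ultimately show ?thesis by linarith
  qed
  define \<kappa> where "\<kappa> = b - \<rho> / 2"
  have Eq: "(\<integral>\<^sup>+e. ennreal (q e) \<partial>K s) \<le> ennreal \<kappa>" for s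
  proof -
    have "(\<integral>\<^sup>+e. ennreal (q e) \<partial>K s) = ennreal (\<integral>e. q e \<partial>K s)"
      by (rule nn_integral_eq_integral) (auto simp: q0, auto simp: q_def int)
    also have "(\<integral>e. q e \<partial>K s) = (\<integral>e. l e ^ 2 \<partial>K s) / (4 * b) - (\<integral>e. l e \<partial>K s) + b"
      unfolding q_def by (simp add: int)
    also have "\<dots> \<le> C / (4 * b) - \<rho> + b"
      using b by (intro add_mono diff_mono divide_right_mono mom mean) auto
    also have "C / (4 * b) = \<rho> / 2" using mean mom by (simp add: b_def)
    finally show ?thesis by (simp add: \<kappa>_def ennreal_leI)
  qed
  have "0 \<le> (\<integral>e. q e \<partial>K [])" using q0 by simp
  have \<kappa>0: "0 \<le> \<kappa>"
  proof (rule ccontr)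
    assume "\<not> ?thesis"
    then have "ennreal \<kappa> = 0" by (simp add: ennreal_neg)
    have "(\<integral>e. q e \<partial>K []) = (\<integral>e. l e ^ 2 \<partial>K []) / (4 * b) - (\<integral>e. l e \<partial>K []) + b"
      unfolding q_def by (simp add: int)
    also have "\<dots> \<le> C / (4 * b) - \<rho> + b"
      using b by (intro add_mono diff_mono divide_right_mono mom mean) auto
    also have "C / (4 * b) = \<rho> / 2" using mean mom by (simp add: b_def)
    finally show False using \<open>0 \<le> (\<integral>e. q e \<partial>K [])\<close> \<open>\<not> 0 \<le> \<kappa>\<close> by (simp add: \<kappa>_def)
  qed
  have Erec: "(\<integral>\<^sup>+\<omega>. ennreal (rec k \<omega>) \<partial>M) = ennreal (prob {\<omega>\<in>space M. strict_record l (hist k \<omega>)})" for k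
  proof -
    have "(\<integral>\<^sup>+\<omega>. ennreal (rec k \<omega>) \<partial>M) = (\<integral>\<^sup>+\<omega>. indicator {\<omega>\<in>space M. strict_record l (hist k \<omega>)} \<omega> \<partial>M)"
      by (intro nn_integral_cong) (auto simp: rec_def indicator_def)
    then show ?thesis by (simp add: emeasure_eq_measure)
  qed
  let ?P = "\<lambda>k. prob {\<omega>\<in>space M. strict_record l (hist k \<omega>)}"
  have "ennreal (real n * b) = (\<integral>\<^sup>+\<omega>. ennreal (real n * b) \<partial>M)" by (simp add: emeasure_space_1)
  also have "\<dots> \<le> (\<integral>\<^sup>+\<omega>. ennreal (b * (\<Sum>k\<le>n. rec k \<omega>) + (\<Sum>k<n. q (S k \<omega>))) \<partial>M)"
    by (intro nn_integral_mono ennreal_leI path)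
  also have "\<dots> = (\<integral>\<^sup>+\<omega>. ennreal b * (\<Sum>k\<le>n. ennreal (rec k \<omega>)) + (\<Sum>k<n. ennreal (q (S k \<omega>))) \<partial>M)"
    using b q0 by (intro nn_integral_cong) (simp add: ennreal_mult sum_nonneg rec_def)
  also have "\<dots> = ennreal b * (\<Sum>k\<le>n. \<integral>\<^sup>+\<omega>. ennreal (rec k \<omega>) \<partial>M) + (\<Sum>k<n. \<integral>\<^sup>+\<omega>. ennreal (q (S k \<omega>)) \<partial>M)"
    by (simp add: nn_integral_add nn_integral_cmult nn_integral_sum)
  also have "\<dots> \<le> ennreal b * (\<Sum>k\<le>n. ennreal (?P k)) + (\<Sum>k<n. ennreal \<kappa>)"
  proof (intro add_mono sum_mono mult_left_mono)
    fix k
    have "(\<integral>\<^sup>+\<omega>. ennreal (q (S k \<omega>)) \<partial>M) = (\<integral>\<^sup>+\<omega>. (\<integral>\<^sup>+e. ennreal (q e) \<partial>K (hist k \<omega>)) \<partial>M)"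
      using nn_integral_one_step[of "\<lambda>_ e. ennreal (q e)" k] .
    also have "\<dots> \<le> (\<integral>\<^sup>+\<omega>. ennreal \<kappa> \<partial>M)" by (intro nn_integral_mono Eq)
    finally show "(\<integral>\<^sup>+\<omega>. ennreal (q (S k \<omega>)) \<partial>M) \<le> ennreal \<kappa>" by (simp add: emeasure_space_1)
  qed (auto simp: Erec)
  also have "\<dots> = ennreal (b * (\<Sum>k\<le>n. ?P k) + real n * \<kappa>)"
    using b \<kappa>0 by (simp add: ennreal_mult sum_nonneg ennreal_of_nat_eq_real_of_nat)
  finally have "real n * b \<le> b * (\<Sum>k\<le>n. ?P k) + real n * \<kappa>"
    using b \<kappa>0 by (subst (asm) ennreal_le_iff) (auto intro!: add_nonneg_nonneg mult_nonneg_nonneg sum_nonneg)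
  then have "real n * (\<rho> / 2) \<le> b * (\<Sum>k\<le>n. ?P k)" by (simp add: \<kappa>_def algebra_simps)
  then have "real n * (\<rho> / 2) / b \<le> (\<Sum>k\<le>n. ?P k)" using b by (simp add: field_simps)
  moreover have "real n * (\<rho> / 2) / b = \<rho>\<^sup>2 / C * real n" using mean mom by (simp add: b_def power2_eq_square)
  ultimately show ?thesis by simp
qed

end

section \<open>Path probabilities of a learning walker\<close>

definition choice_step :: "'a pmf \<Rightarrow> ('a \<Rightarrow> 's pmf) \<Rightarrow> ('a \<times> 's) pmf" where
  "choice_step p \<nu> = bind_pmf p (\<lambda>a. map_pmf (Pair a) (\<nu> a))"

lemma pmf_choice_step:
  fixes p :: "'a::finite pmf"
  shows "pmf (choice_step p \<nu>) (a, \<xi>) = pmf p a * pmf (\<nu> a) \<xi>"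
proof -
  have "pmf (map_pmf (Pair b) (\<nu> b)) (a, \<xi>) = (if b = a then pmf (\<nu> a) \<xi> else 0)" for b
  proof (cases "b = a")
    case True
    then show ?thesis by (simp add: pmf_map_inj' inj_on_def)
  next
    case False
    then show ?thesis by (auto intro!: pmf_map_outside)
  qed
  then have "pmf (choice_step p \<nu>) (a, \<xi>) = (\<integral>b. (if b = a then pmf (\<nu> a) \<xi> else 0) \<partial>p)"
    unfolding choice_step_def pmf_bind by simp
  also have "\<dots> = (\<Sum>b\<in>UNIV. (if b = a then pmf (\<nu> a) \<xi> else 0) * pmf p b)"
    by (rule integral_measure_pmf_real) auto
  also have "\<dots> = (\<Sum>b\<in>UNIV. if b = a then pmf (\<nu> a) \<xi> * pmf p a else 0)"
    by (intro sum.cong) auto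
  also have "\<dots> = pmf p a * pmf (\<nu> a) \<xi>" by simp
  finally show ?thesis .
qed

lemma nn_integral_choice_step:
  "(\<integral>\<^sup>+e. F e \<partial>choice_step p \<nu>) = (\<integral>\<^sup>+a. (\<integral>\<^sup>+\<xi>. F (a, \<xi>) \<partial>\<nu> a) \<partial>p)"
  by (simp add: choice_step_def)

lemma nn_integral_choice_step_le:
  fixes p :: "'a pmf" and \<nu> :: "'a \<Rightarrow> 's pmf" and F :: "'a \<times> 's \<Rightarrow> ennreal"
  assumes "\<And>a. (\<integral>\<^sup>+\<xi>. F (a, \<xi>) \<partial>\<nu> a) \<le> c"
  shows "(\<integral>\<^sup>+e. F e \<partial>choice_step p \<nu>) \<le> c"
proof -
  have "(\<integral>\<^sup>+e. F e \<partial>choice_step p \<nu>) \<le> (\<integral>\<^sup>+a. c \<partial>p)"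
    unfolding nn_integral_choice_step by (intro nn_integral_mono assms)
  then show ?thesis by (simp add: measure_pmf.emeasure_space_1[simplified])
qed

text \<open>Reduced to nonnegative \<open>f\<close>, for which it follows from
\<open>nn_integral_choice_step\<close>, by splitting into positive and negative parts.\<close>
lemma has_integral_choice_step:
  fixes p :: "'a::finite pmf" and \<nu> :: "'a \<Rightarrow> 's pmf" and f :: "'a \<times> 's \<Rightarrow> real"
  assumes int: "\<And>a. integrable (\<nu> a) (\<lambda>\<xi>. f (a, \<xi>))"
  shows "has_bochner_integral (choice_step p \<nu>) f (\<Sum>a\<in>UNIV. pmf p a * (\<integral>\<xi>. f (a, \<xi>) \<partial>\<nu> a))"
proof -
  have nonneg: "has_bochner_integral (choice_step p \<nu>) g (\<Sum>a\<in>UNIV. pmf p a * (\<integral>\<xi>. g (a, \<xi>) \<partial>\<nu> a))"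
    if int: "\<And>a. integrable (\<nu> a) (\<lambda>\<xi>. g (a, \<xi>))" and g: "\<And>e. 0 \<le> g e" for g :: "'a \<times> 's \<Rightarrow> real"
  proof (rule has_bochner_integral_nn_integral)
    have "(\<integral>\<^sup>+e. ennreal (g e) \<partial>choice_step p \<nu>) = (\<integral>\<^sup>+a. ennreal (\<integral>\<xi>. g (a, \<xi>) \<partial>\<nu> a) \<partial>p)"
      unfolding nn_integral_choice_step using int g by (simp add: nn_integral_eq_integral)
    also have "\<dots> = ennreal (\<integral>a. (\<integral>\<xi>. g (a, \<xi>) \<partial>\<nu> a) \<partial>p)"
      using g by (intro nn_integral_eq_integral integrable_measure_pmf_finite AE_I2 integral_nonneg_AE) auto
    also have "(\<integral>a. (\<integral>\<xi>. g (a, \<xi>) \<partial>\<nu> a) \<partial>p) = (\<Sum>a\<in>UNIV. (\<integral>\<xi>. g (a, \<xi>) \<partial>\<nu> a) * pmf p a)"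
      by (rule integral_measure_pmf_real) auto
    finally show "(\<integral>\<^sup>+e. ennreal (g e) \<partial>choice_step p \<nu>) = ennreal (\<Sum>a\<in>UNIV. pmf p a * (\<integral>\<xi>. g (a, \<xi>) \<partial>\<nu> a))"
      by (simp add: mult.commute)
  qed (use g in \<open>auto intro!: sum_nonneg mult_nonneg_nonneg integral_nonneg_AE\<close>)
  have pos: "integrable (\<nu> a) (\<lambda>\<xi>. max 0 (f (a, \<xi>)))" "integrable (\<nu> a) (\<lambda>\<xi>. max 0 (- f (a, \<xi>)))" for a
    using int[of a] by auto
  have f_eq: "f = (\<lambda>e. max 0 (f e) - max 0 (- f e))" by (auto simp: max_def)
  have val: "(\<Sum>a\<in>UNIV. pmf p a * (\<integral>\<xi>. f (a, \<xi>) \<partial>\<nu> a))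
      = (\<Sum>a\<in>UNIV. pmf p a * (\<integral>\<xi>. max 0 (f (a, \<xi>)) \<partial>\<nu> a)) - (\<Sum>a\<in>UNIV. pmf p a * (\<integral>\<xi>. max 0 (- f (a, \<xi>)) \<partial>\<nu> a))"
  proof -
    have "(\<integral>\<xi>. f (a, \<xi>) \<partial>\<nu> a) = (\<integral>\<xi>. max 0 (f (a, \<xi>)) \<partial>\<nu> a) - (\<integral>\<xi>. max 0 (- f (a, \<xi>)) \<partial>\<nu> a)" for a
      by (subst f_eq) (rule Bochner_Integration.integral_diff[OF pos])
    then show ?thesis by (simp add: sum_subtractf right_diff_distrib)
  qed
  show ?thesis
    unfolding val
    by (subst f_eq) (intro has_bochner_integral_diff nonneg pos; simp)
qed

lemma power_le_fact_exp:
  fixes y :: real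
  assumes "0 \<le> y"
  shows "y ^ k \<le> fact k * exp y"
proof -
  obtain t where t: "exp y = (\<Sum>m<Suc k. y ^ m / fact m) + exp t / fact (Suc k) * y ^ Suc k"
    using Maclaurin_exp_le[of y "Suc k"] by blast
  have "y ^ k / fact k \<le> (\<Sum>m<Suc k. y ^ m / fact m)"
    using assms by (intro member_le_sum) auto
  also have "\<dots> \<le> exp y" unfolding t using assms by (simp del: sum.lessThan_Suc power_Suc fact_Suc)
  finally show ?thesis by (simp add: field_simps)
qed

lemma exp_le_quadratic:
  fixes y :: real
  shows "exp y \<le> 1 + y + y\<^sup>2 * exp \<bar>y\<bar>"
proof -
  obtain t where t: "\<bar>t\<bar> \<le> \<bar>y\<bar>" "exp y = (\<Sum>m<2. y ^ m / fact m) + exp t / fact 2 * y ^ 2"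
    using Maclaurin_exp_le[of y 2] by blast
  have "exp t / 2 \<le> exp \<bar>y\<bar>"
  proof -
    have "exp t \<le> exp \<bar>y\<bar>" using t(1) by simp
    then show ?thesis using exp_gt_zero[of t] by linarith
  qed
  then have "exp t / 2 * y\<^sup>2 \<le> exp \<bar>y\<bar> * y\<^sup>2" by (intro mult_right_mono) auto
  then show ?thesis using t(2) by (simp add: numeral_2_eq_2 mult.commute)
qed

lemma integrable_power_of_exp_moment:
  fixes r g :: "'x \<Rightarrow> real" and p :: "'x pmf"
  assumes exp_int: "integrable p (\<lambda>x. exp (c * r x))" and c: "c > 0"
    and g: "\<And>x. \<bar>g x\<bar> \<le> r x + d"
  shows "integrable p (\<lambda>x. g x ^ k)"
proof (rule Bochner_Integration.integrable_bound)
  show "integrable p (\<lambda>x. fact k / c ^ k * exp (c * d) * exp (c * r x))"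
    using exp_int by (intro integrable_mult_right)
  show "AE x in p. norm (g x ^ k) \<le> norm (fact k / c ^ k * exp (c * d) * exp (c * r x))"
  proof (rule AE_I2)
    fix x
    have nn: "0 \<le> c * (r x + d)" using g[of x] c by (intro mult_nonneg_nonneg) linarith+
    have "c ^ k * \<bar>g x\<bar> ^ k \<le> (c * (r x + d)) ^ k"
      using g[of x] c by (simp add: power_mult_distrib power_mono mult_left_mono)
    also have "\<dots> \<le> fact k * exp (c * (r x + d))" by (rule power_le_fact_exp[OF nn])
    also have "\<dots> = fact k * exp (c * d) * exp (c * r x)" by (simp add: exp_add[symmetric] algebra_simps)
    finally show "norm (g x ^ k) \<le> norm (fact k / c ^ k * exp (c * d) * exp (c * r x))"
      using c by (simp add: power_abs field_simps)
  qed
qed simp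

text \<open>By the quadratic bound on \<open>exp\<close>, the linear term contributes the drift and the
remainder is of order \<open>\<theta>\<^sup>2\<close>; the exponential moment at \<open>c\<close>
dominates the remainder as long as \<open>\<theta> \<le> c / 2\<close>.\<close>
lemma exp_drift_bound:
  fixes r f :: "'x \<Rightarrow> real" and p :: "'x pmf"
  assumes exp_int: "integrable p (\<lambda>x. exp (c * r x))" and c: "c > 0"
    and f: "\<And>x. \<bar>f x\<bar> \<le> r x" and mean: "\<rho> \<le> (\<integral>x. f x \<partial>p)"
    and \<theta>: "0 < \<theta>" "\<theta> \<le> c / 2" and D: "8 / c\<^sup>2 * (\<integral>x. exp (c * r x) \<partial>p) \<le> D"
  shows "(\<integral>\<^sup>+x. ennreal (exp (- \<theta> * f x)) \<partial>p) \<le> ennreal (1 - \<theta> * \<rho> + \<theta>\<^sup>2 * D)"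
proof -
  have f_int: "integrable p f" using integrable_power_of_exp_moment[OF exp_int c, of f 0 1] f by simp
  have r0: "0 \<le> r x" for x using f[of x] by linarith
  have bound: "exp (- \<theta> * f x) \<le> 1 - \<theta> * f x + \<theta>\<^sup>2 * (8 / c\<^sup>2 * exp (c * r x))" for x
  proof -
    have "exp (- \<theta> * f x) \<le> 1 - \<theta> * f x + (\<theta> * f x)\<^sup>2 * exp \<bar>\<theta> * f x\<bar>"
      using exp_le_quadratic[of "- \<theta> * f x"] by simp
    also have "(\<theta> * f x)\<^sup>2 * exp \<bar>\<theta> * f x\<bar> \<le> \<theta>\<^sup>2 * (8 / c\<^sup>2 * exp (c * r x))"
    proof -
      have "(c / 2 * r x) ^ 2 \<le> fact 2 * exp (c / 2 * r x)" using c r0 by (intro power_le_fact_exp) auto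
      then have "(r x)\<^sup>2 \<le> 8 / c\<^sup>2 * exp (c / 2 * r x)"
        using c by (simp add: power_mult_distrib power_divide field_simps numeral_2_eq_2)
      moreover have "(f x)\<^sup>2 \<le> (r x)\<^sup>2" using f[of x] r0[of x] by (simp add: abs_le_square_iff[symmetric])
      ultimately have 1: "(f x)\<^sup>2 \<le> 8 / c\<^sup>2 * exp (c / 2 * r x)" by linarith
      have "\<bar>\<theta> * f x\<bar> \<le> c / 2 * r x" using \<theta> f[of x] c unfolding abs_mult by (intro mult_mono) auto
      then have 2: "exp \<bar>\<theta> * f x\<bar> \<le> exp (c / 2 * r x)" by simp
      have "(f x)\<^sup>2 * exp \<bar>\<theta> * f x\<bar> \<le> (8 / c\<^sup>2 * exp (c / 2 * r x)) * exp (c / 2 * r x)"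
        by (intro mult_mono 1 2) auto
      also have "\<dots> = 8 / c\<^sup>2 * exp (c * r x)" by (simp add: exp_add[symmetric] mult.assoc)
      finally have "\<theta>\<^sup>2 * ((f x)\<^sup>2 * exp \<bar>\<theta> * f x\<bar>) \<le> \<theta>\<^sup>2 * (8 / c\<^sup>2 * exp (c * r x))"
        by (intro mult_left_mono) auto
      then show ?thesis by (simp add: power_mult_distrib mult.assoc)
    qed
    finally show ?thesis by simp
  qed
  have int: "integrable p (\<lambda>x. 1 - \<theta> * f x + \<theta>\<^sup>2 * (8 / c\<^sup>2 * exp (c * r x)))"
    using f_int exp_int by simp
  have "(\<integral>\<^sup>+x. ennreal (exp (- \<theta> * f x)) \<partial>p) \<le> (\<integral>\<^sup>+x. ennreal (1 - \<theta> * f x + \<theta>\<^sup>2 * (8 / c\<^sup>2 * exp (c * r x))) \<partial>p)"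
    by (intro nn_integral_mono ennreal_leI bound)
  also have "\<dots> = ennreal (\<integral>x. 1 - \<theta> * f x + \<theta>\<^sup>2 * (8 / c\<^sup>2 * exp (c * r x)) \<partial>p)"
    using order_trans[OF less_imp_le[OF exp_gt_zero] bound] by (intro nn_integral_eq_integral int AE_I2)
  also have "(\<integral>x. 1 - \<theta> * f x + \<theta>\<^sup>2 * (8 / c\<^sup>2 * exp (c * r x)) \<partial>p) = 1 - \<theta> * (\<integral>x. f x \<partial>p) + \<theta>\<^sup>2 * (8 / c\<^sup>2 * (\<integral>x. exp (c * r x) \<partial>p))"
    using f_int exp_int by simp
  also have "\<dots> \<le> 1 - \<theta> * \<rho> + \<theta>\<^sup>2 * D"
    using \<theta> mean D by (intro add_mono diff_mono mult_left_mono) auto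
  finally show ?thesis using ennreal_leI by blast
qed

lemma pmf_positive_value:
  fixes f :: "'x \<Rightarrow> real" and p :: "'x pmf"
  assumes "0 < (\<integral>x. f x \<partial>p)"
  obtains x where "0 < f x" "0 < pmf p x"
proof -
  have "\<exists>x\<in>set_pmf p. 0 < f x"
  proof (rule ccontr)
    assume "\<not> ?thesis"
    then have "AE x in p. f x \<le> 0" by (auto simp: AE_measure_pmf_iff not_less)
    then have "AE x in p. 0 \<le> - f x" by eventually_elim simp
    then have "0 \<le> (\<integral>x. - f x \<partial>p)" by (rule integral_nonneg_AE)
    then show False using assms by simp
  qed
  then show thesis using that by (auto simp: pmf_positive_iff)
qed

text \<open>A state consists of the position and the whole environment; it is a deterministic function of the
initial state and of the steps taken, a step being an action together with an increment.\<close>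
definition next_state ::
  "(('a \<Rightarrow> real) \<Rightarrow> ('a \<Rightarrow> real) \<Rightarrow> 's \<Rightarrow> 'a \<Rightarrow> real) \<Rightarrow> 's::group_add \<times> ('s \<Rightarrow> 'a \<Rightarrow> real) \<Rightarrow> 'a \<times> 's
    \<Rightarrow> 's \<times> ('s \<Rightarrow> 'a \<Rightarrow> real)" where
  "next_state \<psi> = (\<lambda>(x, \<beta>) (a, \<xi>). (x + \<xi>, \<lambda>y b. if (y, b) = (x, a) then \<psi> (\<beta> x) (\<beta> (x + \<xi>)) \<xi> a else \<beta> y b))"

definition step_law :: "(('a \<Rightarrow> real) \<Rightarrow> 'a pmf) \<Rightarrow> ('a \<Rightarrow> 's pmf) \<Rightarrow> 's \<times> ('s \<Rightarrow> 'a \<Rightarrow> real) \<Rightarrow> ('a \<times> 's) pmf" where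
  "step_law \<phi> \<nu> = (\<lambda>(x, \<beta>). choice_step (\<phi> (\<beta> x)) \<nu>)"

definition run where
  "run \<psi> = foldl (next_state \<psi>)"

primrec path_prob where
  "path_prob \<phi> \<psi> \<nu> st [] = 1"
| "path_prob \<phi> \<psi> \<nu> st (e # s) = pmf (step_law \<phi> \<nu> st) e * path_prob \<phi> \<psi> \<nu> (next_state \<psi> st e) s"

lemma run_simps [simp]: "run \<psi> st [] = st" "run \<psi> st (s @ [e]) = next_state \<psi> (run \<psi> st s) e"
  by (simp_all add: run_def)

lemma path_prob_append: "path_prob \<phi> \<psi> \<nu> st (g @ h) = path_prob \<phi> \<psi> \<nu> st g * path_prob \<phi> \<psi> \<nu> (run \<psi> st g) h"
  by (induction g arbitrary: st) (simp_all add: run_def mult.assoc)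

lemma fst_run: "fst (run \<psi> st s) = fst st + (\<Sum>e\<leftarrow>s. snd e)"
  by (induction s rule: rev_induct) (auto simp: next_state_def case_prod_beta add.assoc)

lemma env_run_unvisited:
  assumes "\<And>k. k < length s \<Longrightarrow> y \<noteq> fst (run \<psi> st (take k s))"
  shows "snd (run \<psi> st s) y = snd st y"
  using assms
proof (induction s rule: rev_induct)
  case (snoc e s)
  have "snd (run \<psi> st s) y = snd st y"
  proof (rule snoc.IH)
    fix k assume "k < length s"
    then show "y \<noteq> fst (run \<psi> st (take k s))" using snoc.prems[of k] by simp
  qed
  moreover have "y \<noteq> fst (run \<psi> st s)" using snoc.prems[of "length s"] by simp
  ultimately show ?case by (auto simp: next_state_def case_prod_beta)
qed simp

text \<open>Two states that agree, up to a translation, on all sites at relative level at least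
\<open>- c\<close> give the same probability to every path that never goes below relative level
\<open>- c\<close>: decisions and updates use the environment at the current and at the next site
only, and positions enter only through increments.\<close>
lemma path_prob_local:
  fixes L :: "'s::group_add \<Rightarrow> real" and \<beta> \<beta>' :: "'s \<Rightarrow> 'a \<Rightarrow> real"
  assumes L: "\<And>x y. L (x + y) = L x + L y"
    and agree: "\<And>y. - c \<le> L y \<Longrightarrow> \<beta> (x + y) = \<beta>' (x' + y)"
    and above: "\<And>k. k \<le> length h \<Longrightarrow> - c \<le> total (\<lambda>e. L (snd e)) (take k h)"
  shows "path_prob \<phi> \<psi> \<nu> (x, \<beta>) h = path_prob \<phi> \<psi> \<nu> (x', \<beta>') h"
  using agree above
proof (induction h arbitrary: x x' \<beta> \<beta>' c)
  case (Cons e h)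
  obtain a \<xi> where e: "e = (a, \<xi>)" by (cases e)
  have L0: "L 0 = 0" using L[of 0 0] by simp
  have c0: "0 \<le> c" using Cons.prems(2)[of 0] by simp
  have c1: "- c \<le> L \<xi>" using Cons.prems(2)[of 1] by (simp add: e total_def)
  have here: "\<beta> x = \<beta>' x'" using Cons.prems(1)[of 0] c0 by (simp add: L0)
  have there: "\<beta> (x + \<xi>) = \<beta>' (x' + \<xi>)" using Cons.prems(1)[OF c1] .
  define \<beta>1 where "\<beta>1 = snd (next_state \<psi> (x, \<beta>) e)"
  define \<beta>1' where "\<beta>1' = snd (next_state \<psi> (x', \<beta>') e)"
  have "path_prob \<phi> \<psi> \<nu> (x + \<xi>, \<beta>1) h = path_prob \<phi> \<psi> \<nu> (x' + \<xi>, \<beta>1') h"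
  proof (rule Cons.IH)
    fix y assume y: "- (c + L \<xi>) \<le> L y"
    have "- c \<le> L (\<xi> + y)" using y by (simp add: L)
    then have "\<beta> (x + (\<xi> + y)) = \<beta>' (x' + (\<xi> + y))" by (rule Cons.prems(1))
    moreover have "x + (\<xi> + y) = x \<longleftrightarrow> \<xi> + y = 0" "x' + (\<xi> + y) = x' \<longleftrightarrow> \<xi> + y = 0"
      using add_left_cancel[of x "\<xi> + y" 0] add_left_cancel[of x' "\<xi> + y" 0] by simp_all
    ultimately show "\<beta>1 (x + \<xi> + y) = \<beta>1' (x' + \<xi> + y)"
      using here there by (intro ext) (simp add: \<beta>1_def \<beta>1'_def next_state_def e add.assoc)
  next
    fix k assume "k \<le> length h"
    then show "- (c + L \<xi>) \<le> total (\<lambda>e. L (snd e)) (take k h)"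
      using Cons.prems(2)[of "Suc k"] by (simp add: e total_def)
  qed
  then show ?case
    using here by (simp add: step_law_def \<beta>1_def \<beta>1'_def next_state_def e)
qed simp

text \<open>When \<open>g\<close> ends in a strict record, all sites occupied before its end are strictly
below that end, so at and above this level the environment is the initial one, and
\<open>path_prob_local\<close> applies with \<open>c = 0\<close>.\<close>
lemma path_prob_fresh_start:
  fixes L :: "'s::group_add \<Rightarrow> real" and b0 :: "'s \<Rightarrow> 'a \<Rightarrow> real"
  assumes L: "\<And>x y. L (x + y) = L x + L y" and hom: "\<And>x y. b0 x = b0 y"
    and g: "strict_record (\<lambda>e. L (snd e)) g" and h: "nonneg_path (\<lambda>e. L (snd e)) h"
  shows "path_prob \<phi> \<psi> \<nu> (x0, b0) (g @ h) = path_prob \<phi> \<psi> \<nu> (x0, b0) g * path_prob \<phi> \<psi> \<nu> (x0, b0) h"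
proof -
  let ?l = "\<lambda>e. L (snd e)"
  have L0: "L 0 = 0" using L[of 0 0] by simp
  have pos: "L (fst (run \<psi> (x0, b0) s)) = L x0 + total ?l s" for s
    by (induction s rule: rev_induct) (simp_all del: run_simps add: fst_run L L0 total_def add.assoc)
  obtain x \<beta> where run: "run \<psi> (x0, b0) g = (x, \<beta>)" by (cases "run \<psi> (x0, b0) g")
  have "path_prob \<phi> \<psi> \<nu> (x, \<beta>) h = path_prob \<phi> \<psi> \<nu> (x0, b0) h"
  proof (rule path_prob_local[where c=0 and L=L])
    fix y assume y: "- 0 \<le> L y"
    have "snd (run \<psi> (x0, b0) g) (x + y) = snd (x0, b0) (x + y)"
    proof (rule env_run_unvisited)
      fix k assume "k < length g"
      then have "total ?l (take k g) < total ?l g" using g by (simp add: strict_record_def)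
      then have "L (fst (run \<psi> (x0, b0) (take k g))) < L x" using pos[of g] pos[of "take k g"] run by simp
      also have "L x \<le> L (x + y)" using y by (simp add: L)
      finally show "x + y \<noteq> fst (run \<psi> (x0, b0) (take k g))" by auto
    qed
    then show "\<beta> (x + y) = b0 (x0 + y)" using run hom[of "x + y" "x0 + y"] by simp
  next
    fix k assume "k \<le> length h"
    then show "- 0 \<le> total ?l (take k h)" using h by (simp add: nonneg_path_def)
  qed (rule L)
  then show ?thesis by (simp add: path_prob_append run)
qed

section \<open>Local learning processes in Model 2\<close>

text \<open>This turns the conditional expectations in the definition of the process into elementary
conditional probabilities, given an event of the past on which they are constant.\<close>
lemma (in prob_space) prob_Int_of_cond_exp_const:
  assumes F: "subalgebra M F" and C: "C \<in> sets F" and B: "B \<in> sets M"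
    and ce: "AE \<omega> in M. \<omega> \<in> C \<longrightarrow> real_cond_exp M F (indicator B) \<omega> = q"
  shows "prob (C \<inter> B) = prob C * q"
proof -
  interpret sigma_finite_subalgebra M F
    by (rule finite_measure_subalgebra_is_sigma_finite)
       (simp add: finite_measure_subalgebra_def finite_measure_subalgebra_axioms_def F finite_measure_axioms)
  have CM: "C \<in> sets M" using F C by (auto simp: subalgebra_def)
  have int: "integrable M (indicator B :: _ \<Rightarrow> real)" using B by (simp add: emeasure_eq_measure)
  have "prob (C \<inter> B) = (\<integral>\<omega>\<in>C. indicator B \<omega> \<partial>M)"
    using CM B by (simp add: set_lebesgue_integral_def indicator_inter_arith[symmetric])
  also have "\<dots> = (\<integral>\<omega>\<in>C. real_cond_exp M F (indicator B) \<omega> \<partial>M)"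
    by (rule real_cond_exp_intA[OF int C])
  also have "\<dots> = (\<integral>\<omega>\<in>C. q \<partial>M)"
    unfolding set_lebesgue_integral_def
  proof (rule integral_cong_AE)
    show "AE \<omega> in M. indicator C \<omega> *\<^sub>R real_cond_exp M F (indicator B) \<omega> = indicator C \<omega> *\<^sub>R q"
      using ce by eventually_elim (auto simp: indicator_def)
  qed (use CM in measurable)
  also have "\<dots> = prob C * q" using CM by (simp add: set_lebesgue_integral_def)
  finally show ?thesis .
qed

locale model2_process =
  local_learning_process M "model2_transition \<mu>" x0 b0 \<phi> \<psi> X A \<beta>
  for M :: "'w measure"
    and \<mu> :: "action \<Rightarrow> (int \<times> int) pmf"
    and x0 :: "int \<times> int"
    and b0 :: "int \<times> int \<Rightarrow> action \<Rightarrow> real"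
    and \<phi> :: "(action \<Rightarrow> real) \<Rightarrow> action pmf"
    and \<psi> :: "(action \<Rightarrow> real) \<Rightarrow> (action \<Rightarrow> real) \<Rightarrow> int \<times> int \<Rightarrow> action \<Rightarrow> real"
    and X :: "nat \<Rightarrow> 'w \<Rightarrow> int \<times> int"
    and A :: "nat \<Rightarrow> 'w \<Rightarrow> action"
    and \<beta> :: "nat \<Rightarrow> 'w \<Rightarrow> int \<times> int \<Rightarrow> action \<Rightarrow> real"
begin

definition S :: "nat \<Rightarrow> 'w \<Rightarrow> action \<times> (int \<times> int)" where
  "S n \<omega> = (A n \<omega>, X (Suc n) \<omega> - X n \<omega>)"

abbreviation steps :: "nat \<Rightarrow> 'w \<Rightarrow> (action \<times> (int \<times> int)) list" where
  "steps n \<omega> \<equiv> map (\<lambda>i. S i \<omega>) [0..<n]"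

lemma space_past: "space (past M X A \<beta> n m) = space M"
  using subalgebra_past by (simp add: subalgebra_def)

lemma past_measurable:
  "k \<le> n \<Longrightarrow> X k \<in> measurable (past M X A \<beta> n m) (count_space UNIV)"
  "k < m \<Longrightarrow> A k \<in> measurable (past M X A \<beta> n m) (count_space UNIV)"
proof -
  let ?G = "{X k -` B \<inter> space M | k B. k \<le> n} \<union> {A k -` B \<inter> space M | k B. k < m} \<union>
      {\<beta> k -` B \<inter> space M | k B. k \<le> n \<and> B \<in> sets env_algebra}"
  have *: "sets (past M X A \<beta> n m) = sigma_sets (space M) ?G"
    unfolding past_def by (intro sets_measure_of) auto
  show "X k \<in> measurable (past M X A \<beta> n m) (count_space UNIV)" if "k \<le> n"
  proof (rule measurableI)
    fix B
    have "X k -` B \<inter> space M \<in> ?G"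
      by (rule UnI1, rule UnI1, rule CollectI, rule exI[of _ k], rule exI[of _ B]) (simp add: that)
    then have "X k -` B \<inter> space M \<in> sigma_sets (space M) ?G" by (rule sigma_sets.Basic)
    then show "X k -` B \<inter> space (past M X A \<beta> n m) \<in> sets (past M X A \<beta> n m)" unfolding * space_past .
  qed simp
  show "A k \<in> measurable (past M X A \<beta> n m) (count_space UNIV)" if "k < m"
  proof (rule measurableI)
    fix B
    have "A k -` B \<inter> space M \<in> ?G"
      by (rule UnI1, rule UnI2, rule CollectI, rule exI[of _ k], rule exI[of _ B]) (simp add: that)
    then have "A k -` B \<inter> space M \<in> sigma_sets (space M) ?G" by (rule sigma_sets.Basic)
    then show "A k -` B \<inter> space (past M X A \<beta> n m) \<in> sets (past M X A \<beta> n m)" unfolding * space_past .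
  qed simp
qed

lemma S_measurable_of:
  assumes "A n \<in> measurable N (count_space UNIV)" "X n \<in> measurable N (count_space UNIV)"
    "X (Suc n) \<in> measurable N (count_space UNIV)"
  shows "S n \<in> measurable N (count_space UNIV)"
proof -
  have "(\<lambda>\<omega>. (A n \<omega>, X n \<omega>, X (Suc n) \<omega>)) \<in> measurable N (count_space UNIV \<Otimes>\<^sub>M (count_space UNIV \<Otimes>\<^sub>M count_space UNIV))"
    using assms by (intro measurable_Pair)
  then have "(\<lambda>\<omega>. (A n \<omega>, X n \<omega>, X (Suc n) \<omega>)) \<in> measurable N (count_space UNIV)"
    by (simp add: pair_measure_countable)
  from measurable_compose[OF this, of "\<lambda>(a, x, y). (a, y - x)" "count_space UNIV"]
  show ?thesis by (simp add: S_def[abs_def])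
qed

lemma S_measurable: "S n \<in> measurable M (count_space UNIV)"
  by (intro S_measurable_of A_measurable X_measurable)

text \<open>The environment is almost surely a function of the finite sequence of steps so far; hence, up to
null sets, the past at a given time is generated by countably many atoms, the finite paths.\<close>
lemma AE_state_eq_run: "AE \<omega> in M. \<forall>n. run \<psi> (x0, b0) (steps n \<omega>) = (X n \<omega>, \<beta> n \<omega>)"
proof -
  have "AE \<omega> in M. \<forall>n. \<forall>x a. \<beta> (Suc n) \<omega> x a =
      (if (x, a) = (X n \<omega>, A n \<omega>)
       then \<psi> (\<beta> n \<omega> (X n \<omega>)) (\<beta> n \<omega> (X (Suc n) \<omega>)) (X (Suc n) \<omega> - X n \<omega>) (A n \<omega>)
       else \<beta> n \<omega> x a)"
    by (subst AE_all_countable) (use update in blast)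
  with X_init env_init show ?thesis
  proof eventually_elim
    case (elim \<omega>)
    show ?case
    proof
      fix n
      show "run \<psi> (x0, b0) (steps n \<omega>) = (X n \<omega>, \<beta> n \<omega>)"
      proof (induction n)
        case (Suc n)
        have "run \<psi> (x0, b0) (steps (Suc n) \<omega>) = next_state \<psi> (X n \<omega>, \<beta> n \<omega>) (S n \<omega>)"
          using Suc by simp
        also have "\<dots> = (X (Suc n) \<omega>, \<beta> (Suc n) \<omega>)"
        proof -
          have env: "\<beta> (Suc n) \<omega> = (\<lambda>x a. if (x, a) = (X n \<omega>, A n \<omega>)
             then \<psi> (\<beta> n \<omega> (X n \<omega>)) (\<beta> n \<omega> (X (Suc n) \<omega>)) (X (Suc n) \<omega> - X n \<omega>) (A n \<omega>)
             else \<beta> n \<omega> x a)"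
            using elim(3) by (intro ext) blast
          have "X n \<omega> + (X (Suc n) \<omega> - X n \<omega>) = X (Suc n) \<omega>" by (simp add: algebra_simps)
          then show ?thesis by (simp only: next_state_def S_def prod.case env)
        qed
        finally show ?case .
      qed (use elim in simp)
    qed
  qed
qed

text \<open>On the event that the first \<open>n\<close> steps are \<open>s\<close> the state is known, so
both conditional probabilities in the definition of the process are constant on it; they are
applied in turn, to the action and then to the increment.\<close>
lemma prob_next_step:
  "prob {\<omega>\<in>space M. steps n \<omega> = s \<and> S n \<omega> = e}
    = prob {\<omega>\<in>space M. steps n \<omega> = s} * pmf (step_law \<phi> \<mu> (run \<psi> (x0, b0) s)) e"
proof -
  obtain a \<xi> where e: "e = (a, \<xi>)" by (cases e)
  obtain x b where st: "run \<psi> (x0, b0) s = (x, b)" by (cases "run \<psi> (x0, b0) s")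
  define C where "C = {\<omega>\<in>space M. steps n \<omega> = s}"
  have meas: "C \<in> sets (past M X A \<beta> n m)" if "n \<le> m" for m
  proof -
    have "steps n \<in> measurable (past M X A \<beta> n m) (count_space UNIV)"
      using that by (intro measurable_map_upt S_measurable_of past_measurable) auto
    from measurable_sets[OF this, of "{s}"] show ?thesis
      by (simp add: space_past C_def vimage_def Int_def conj_commute)
  qed
  have CM: "C \<in> sets M" using meas[of n] subalgebra_past by (auto simp: subalgebra_def)
  have AM [measurable]: "{\<omega>\<in>space M. A n \<omega> = a} \<in> sets M"
    using measurable_sets[OF A_measurable, of "{a}" n] by (simp add: vimage_def Int_def conj_commute)
  have XM [measurable]: "{\<omega>\<in>space M. X (Suc n) \<omega> = x + \<xi>} \<in> sets M"
    using measurable_sets[OF X_measurable, of "{x + \<xi>}" "Suc n"] by (simp add: vimage_def Int_def conj_commute)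
  have state: "AE \<omega> in M. \<omega> \<in> C \<longrightarrow> X n \<omega> = x \<and> \<beta> n \<omega> = b"
    using AE_state_eq_run by eventually_elim (use st in \<open>auto simp: C_def\<close>)
  define C1 where "C1 = C \<inter> {\<omega>\<in>space M. A n \<omega> = a}"
  have prob_C1: "prob C1 = prob C * pmf (\<phi> (b x)) a"
    unfolding C1_def
  proof (rule prob_Int_of_cond_exp_const[OF subalgebra_past meas AM])
    show "AE \<omega> in M. \<omega> \<in> C \<longrightarrow> real_cond_exp M (past M X A \<beta> n n) (indicator {\<omega>\<in>space M. A n \<omega> = a}) \<omega> = pmf (\<phi> (b x)) a"
      using decision[of n a] state by eventually_elim auto
  qed simp
  have C1_past: "C1 \<in> sets (past M X A \<beta> n (Suc n))"
  proof -
    have "{\<omega>\<in>space M. A n \<omega> = a} \<in> sets (past M X A \<beta> n (Suc n))"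
      using measurable_sets[OF past_measurable(2)[of n "Suc n" n], of "{a}"]
      by (simp add: space_past vimage_def Int_def conj_commute)
    then show ?thesis unfolding C1_def using meas[of "Suc n"] by auto
  qed
  have "prob (C1 \<inter> {\<omega>\<in>space M. X (Suc n) \<omega> = x + \<xi>}) = prob C1 * pmf (\<mu> a) \<xi>"
  proof (rule prob_Int_of_cond_exp_const[OF subalgebra_past C1_past XM])
    show "AE \<omega> in M. \<omega> \<in> C1 \<longrightarrow> real_cond_exp M (past M X A \<beta> n (Suc n)) (indicator {\<omega>\<in>space M. X (Suc n) \<omega> = x + \<xi>}) \<omega> = pmf (\<mu> a) \<xi>"
      using transition[of n "x + \<xi>"] state
      by eventually_elim (auto simp: C1_def pmf_model2_transition)
  qed
  moreover have "prob {\<omega>\<in>space M. steps n \<omega> = s \<and> S n \<omega> = e} = prob (C1 \<inter> {\<omega>\<in>space M. X (Suc n) \<omega> = x + \<xi>})"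
  proof (rule finite_measure_eq_AE)
    show "AE \<omega> in M. \<omega> \<in> {\<omega>\<in>space M. steps n \<omega> = s \<and> S n \<omega> = e} \<longleftrightarrow> \<omega> \<in> C1 \<inter> {\<omega>\<in>space M. X (Suc n) \<omega> = x + \<xi>}"
      using state by eventually_elim (auto simp: C1_def C_def S_def e algebra_simps)
    have "{\<omega>\<in>space M. steps n \<omega> = s \<and> S n \<omega> = e} = C \<inter> (S n -` {e} \<inter> space M)" by (auto simp: C_def)
    then show "{\<omega>\<in>space M. steps n \<omega> = s \<and> S n \<omega> = e} \<in> sets M"
      using CM measurable_sets[OF S_measurable, of "{e}" n] by auto
  qed (use CM in \<open>auto simp: C1_def\<close>)
  ultimately show ?thesis
    unfolding e st step_law_def by (simp add: prob_C1 pmf_choice_step C_def mult.assoc)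
qed

lemma prob_steps: "prob {\<omega>\<in>space M. steps (length s) \<omega> = s} = path_prob \<phi> \<psi> \<mu> (x0, b0) s"
proof (induction s rule: rev_induct)
  case (snoc e s)
  have "prob {\<omega>\<in>space M. steps (length (s @ [e])) \<omega> = s @ [e]} = prob {\<omega>\<in>space M. steps (length s) \<omega> = s \<and> S (length s) \<omega> = e}"
    by simp
  then show ?case using snoc by (simp add: prob_next_step path_prob_append)
qed (simp add: prob_space)

end

lemma abs_sum_pmf_le:
  fixes p :: "'a::finite pmf" and m :: "'a \<Rightarrow> real"
  shows "\<bar>\<Sum>a\<in>UNIV. pmf p a * m a\<bar> \<le> (\<Sum>a\<in>UNIV. \<bar>m a\<bar>)"
proof -
  have "\<bar>\<Sum>a\<in>UNIV. pmf p a * m a\<bar> \<le> (\<Sum>a\<in>UNIV. \<bar>pmf p a * m a\<bar>)" by (rule sum_abs)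
  also have "\<dots> \<le> (\<Sum>a\<in>UNIV. \<bar>m a\<bar>)"
    by (intro sum_mono) (simp add: abs_mult mult_left_le_one_le pmf_le_1)
  finally show ?thesis .
qed

lemma sum_pmf_ge:
  fixes p :: "'a::finite pmf" and m :: "'a \<Rightarrow> real"
  assumes "\<And>a. \<rho> \<le> m a"
  shows "\<rho> \<le> (\<Sum>a\<in>UNIV. pmf p a * m a)"
proof -
  have "\<rho> = (\<Sum>a\<in>UNIV. pmf p a * \<rho>)"
    by (simp add: sum_distrib_right[symmetric] sum_pmf_eq_1)
  also have "\<dots> \<le> (\<Sum>a\<in>UNIV. pmf p a * m a)" by (intro sum_mono mult_left_mono assms) simp
  finally show ?thesis .
qed

lemma real_point_add: "real_point (x + y) = real_point x + real_point y"
  by (simp add: real_point_def)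

lemma real_point_diff: "real_point (x - y) = real_point x - real_point y"
  by (simp add: real_point_def)

lemma integrable_real_point:
  fixes \<nu> :: "(int \<times> int) pmf"
  assumes "integrable \<nu> (\<lambda>\<xi>. exp (c * norm (real_point \<xi>)))" "c > 0"
  shows "integrable \<nu> real_point"
proof (rule Bochner_Integration.integrable_bound)
  show "integrable \<nu> (\<lambda>\<xi>. norm (real_point \<xi>) ^ 1)"
    by (rule integrable_power_of_exp_moment[OF assms, where d=0]) simp
qed auto

context model2_process begin

abbreviation "K s \<equiv> step_law \<phi> \<mu> (run \<psi> (x0, b0) s)"

lemma K_eq: "K s = choice_step (\<phi> (snd (run \<psi> (x0, b0) s) (fst (run \<psi> (x0, b0) s)))) \<mu>"
  by (simp add: step_law_def case_prod_beta)

text \<open>Given the past, the increment minus the drift of the chosen action has mean 0 for either action,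
hence also for the random choice between them.\<close>
lemma AE_drift_corrected_position:
  assumes c: "c > 0" "\<And>a. integrable (\<mu> a) (\<lambda>\<xi>. exp (c * norm (real_point \<xi>)))"
  shows "AE \<omega> in M. (\<lambda>n. (\<Sum>i<n. (real_point (snd (S i \<omega>)) - drift (\<mu> (fst (S i \<omega>)))) \<bullet> v) / real n) \<longlonglongrightarrow> 0"
proof -
  define f :: "action \<times> (int \<times> int) \<Rightarrow> real" where "f e = (real_point (snd e) - drift (\<mu> (fst e))) \<bullet> v" for e
  note rp_int = integrable_real_point[OF c(2,1)]
  define d where "d a = norm (drift (\<mu> a))" for a
  \<comment> \<open>Dividing by \<open>t\<close> brings \<open>f\<close> into the form required for the moment bound.\<close>
  define t where "t = norm v + 1"
  have t: "t > 0" by (simp add: t_def add_nonneg_pos)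
  have f_bound: "\<bar>f (a, \<xi>) / t\<bar> \<le> norm (real_point \<xi>) + d a" for a \<xi>
  proof -
    have "\<bar>f (a, \<xi>)\<bar> \<le> norm (real_point \<xi> - drift (\<mu> a)) * norm v"
      unfolding f_def using Cauchy_Schwarz_ineq2 by simp
    also have "\<dots> \<le> (norm (real_point \<xi>) + d a) * t"
      unfolding d_def t_def by (intro mult_mono norm_triangle_ineq4) auto
    finally show ?thesis using t by (simp add: field_simps)
  qed
  have f_int: "integrable (\<mu> a) (\<lambda>\<xi>. f (a, \<xi>) ^ k)" for a k
  proof -
    have "integrable (\<mu> a) (\<lambda>\<xi>. t ^ k * (f (a, \<xi>) / t) ^ k)"
      by (intro integrable_mult_right integrable_power_of_exp_moment[OF c(2,1) f_bound])
    then show ?thesis using t by (simp add: power_divide)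
  qed
  have val: "integrable (K s) (\<lambda>e. f e ^ k)" 
    "(\<integral>e. f e ^ k \<partial>K s) = (\<Sum>a\<in>UNIV. pmf (\<phi> (snd (run \<psi> (x0, b0) s) (fst (run \<psi> (x0, b0) s)))) a * (\<integral>\<xi>. f (a, \<xi>) ^ k \<partial>\<mu> a))" for s k
    using has_integral_choice_step[where f="\<lambda>e. f e ^ k" and \<nu>=\<mu>, OF f_int]
    unfolding K_eq by (auto simp: has_bochner_integral_iff)
  define C where "C = (\<Sum>k\<le>4. \<Sum>a\<in>UNIV. \<bar>\<integral>\<xi>. f (a, \<xi>) ^ k \<partial>\<mu> a\<bar>)"
  have C: "\<bar>\<integral>e. f e ^ k \<partial>K s\<bar> \<le> C" if "k \<le> 4" for s k
  proof -
    have "\<bar>\<integral>e. f e ^ k \<partial>K s\<bar> \<le> (\<Sum>a\<in>UNIV. \<bar>\<integral>\<xi>. f (a, \<xi>) ^ k \<partial>\<mu> a\<bar>)"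
      unfolding val by (rule abs_sum_pmf_le)
    also have "\<dots> \<le> C" unfolding C_def using that by (intro member_le_sum) (auto intro: sum_nonneg)
    finally show ?thesis .
  qed
  have mean0: "(\<integral>\<xi>. f (a, \<xi>) \<partial>\<mu> a) = 0" for a
  proof -
    have "(\<integral>\<xi>. f (a, \<xi>) \<partial>\<mu> a) = (\<integral>\<xi>. real_point \<xi> - drift (\<mu> a) \<partial>\<mu> a) \<bullet> v"
      unfolding f_def using rp_int[of a] by simp
    also have "(\<integral>\<xi>. real_point \<xi> - drift (\<mu> a) \<partial>\<mu> a) = 0"
      using rp_int[of a] by (simp add: drift_def)
    finally show ?thesis by simp
  qed
  interpret step_process M S "\<lambda>_. 0" by unfold_locales (rule S_measurable)
  interpret kernel_process M S "\<lambda>_. 0" K by unfold_locales (simp add: hist_def prob_next_step)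
  show ?thesis unfolding f_def[symmetric]
  proof (rule martingale_strong_law[where C=C])
    fix s
    show "integrable (K s) f" using val(1)[of s 1] by simp
    show "(\<integral>e. f e \<partial>K s) = 0" using val(2)[of s 1] mean0 by simp
    show "(\<integral>e. f e ^ 2 \<partial>K s) \<le> C" "(\<integral>e. f e ^ 4 \<partial>K s) \<le> C"
      using C[of 2 s] C[of 4 s] by (simp_all add: abs_le_iff)
    show "\<bar>\<integral>e. f e ^ 3 \<partial>K s\<bar> \<le> C" using C[of 3 s] by simp
  qed (rule val(1))+
qed

text \<open>The level is the coordinate along \<open>u\<close>. Bounds that hold for each action hold for
every mixture of the two, hence for the one-step law after any past.\<close>
lemma action_frequencies_converge:
  assumes c: "c > 0" "\<And>a. integrable (\<mu> a) (\<lambda>\<xi>. exp (c * norm (real_point \<xi>)))"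
    and u: "norm u = 1" "\<And>a. 0 < drift (\<mu> a) \<bullet> u"
  shows "\<exists>\<alpha>. AE \<omega> in M. (\<lambda>n. (\<Sum>i<n. of_bool (fst (S i \<omega>) = Red)) / real n) \<longlonglongrightarrow> \<alpha>"
proof -
  define L where "L x = real_point x \<bullet> u" for x
  define l :: "action \<times> (int \<times> int) \<Rightarrow> real" where "l e = L (snd e)" for e
  have L_add: "L (x + y) = L x + L y" for x y by (simp add: L_def real_point_add inner_add_left)
  have L_le: "\<bar>L x\<bar> \<le> norm (real_point x)" for x
    using Cauchy_Schwarz_ineq2[of "real_point x" u] u by (simp add: L_def)
  have L_int: "integrable (\<mu> a) (\<lambda>\<xi>. L \<xi> ^ k)" for a k
    by (rule integrable_power_of_exp_moment[OF c(2,1), where d=0]) (use L_le in simp)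
  note rp_int = integrable_real_point[OF c(2,1)]
  have L_mean: "(\<integral>\<xi>. L \<xi> \<partial>\<mu> a) = drift (\<mu> a) \<bullet> u" for a
    unfolding L_def drift_def using rp_int[of a] by simp
  define \<rho> where "\<rho> = Min (range (\<lambda>a. drift (\<mu> a) \<bullet> u))"
  have \<rho>: "\<rho> > 0" "\<rho> \<le> drift (\<mu> a) \<bullet> u" for a
    using u by (auto simp: \<rho>_def)
  define D where "D = 8 / c\<^sup>2 * (\<Sum>a\<in>UNIV. \<integral>\<xi>. exp (c * norm (real_point \<xi>)) \<partial>\<mu> a) + 1"
  have D: "8 / c\<^sup>2 * (\<integral>\<xi>. exp (c * norm (real_point \<xi>)) \<partial>\<mu> a) \<le> D" for a
  proof -
    have "(\<integral>\<xi>. exp (c * norm (real_point \<xi>)) \<partial>\<mu> a) \<le> (\<Sum>a\<in>UNIV. \<integral>\<xi>. exp (c * norm (real_point \<xi>)) \<partial>\<mu> a)"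
      by (intro member_le_sum) auto
    then have "8 / c\<^sup>2 * (\<integral>\<xi>. exp (c * norm (real_point \<xi>)) \<partial>\<mu> a) \<le> 8 / c\<^sup>2 * (\<Sum>a\<in>UNIV. \<integral>\<xi>. exp (c * norm (real_point \<xi>)) \<partial>\<mu> a)"
      by (intro mult_left_mono) auto
    then show ?thesis by (simp add: D_def)
  qed
  have D0: "D > 0" unfolding D_def by (intro add_nonneg_pos mult_nonneg_nonneg sum_nonneg) auto
  \<comment> \<open>With this choice the quadratic term \<open>\<theta>\<^sup>2 * D\<close> is at most half of the gain \<open>\<theta> * \<rho>\<close>.\<close>
  define \<theta> where "\<theta> = min (c / 2) (\<rho> / (2 * D))"
  have \<theta>: "0 < \<theta>" "\<theta> \<le> c / 2" using c \<rho> D0 by (auto simp: \<theta>_def)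
  define \<gamma> where "\<gamma> = max 0 (1 - \<theta> * \<rho> / 2)"
  have \<gamma>: "0 \<le> \<gamma>" "\<gamma> < 1" using \<theta> \<rho> by (auto simp: \<gamma>_def)
  have exp_a: "(\<integral>\<^sup>+\<xi>. ennreal (exp (- \<theta> * L \<xi>)) \<partial>\<mu> a) \<le> ennreal \<gamma>" for a
  proof -
    have "(\<integral>\<^sup>+\<xi>. ennreal (exp (- \<theta> * L \<xi>)) \<partial>\<mu> a) \<le> ennreal (1 - \<theta> * \<rho> + \<theta>\<^sup>2 * D)"
      by (rule exp_drift_bound[OF c(2,1) L_le _ \<theta> D]) (simp add: L_mean \<rho>)
    also have "\<dots> \<le> ennreal \<gamma>"
    proof (rule ennreal_leI)
      have "\<theta> * D \<le> \<rho> / 2" using D0 by (simp add: \<theta>_def min_def field_simps)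
      then have "\<theta> * (\<theta> * D) \<le> \<theta> * (\<rho> / 2)" using \<theta> by (intro mult_left_mono) auto
      then show "1 - \<theta> * \<rho> + \<theta>\<^sup>2 * D \<le> \<gamma>" by (simp add: \<gamma>_def power2_eq_square algebra_simps)
    qed
    finally show ?thesis .
  qed
  have exp_K: "(\<integral>\<^sup>+e. ennreal (exp (- \<theta> * l e)) \<partial>K s) \<le> ennreal \<gamma>" for s
    unfolding K_eq by (rule nn_integral_choice_step_le) (use exp_a in \<open>simp add: l_def\<close>)
  have "\<exists>x. 0 < L x \<and> 0 < pmf (\<mu> a) x" for a
    using pmf_positive_value[of "\<mu> a" L] u(2)[of a] L_mean[of a] by metis
  then obtain z where z: "\<And>a. 0 < L (z a)" "\<And>a. 0 < pmf (\<mu> a) (z a)" by metis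
  define \<eta> where "\<eta> = Min (range (\<lambda>a. L (z a)))"
  define p where "p = Min (range (\<lambda>a. pmf (\<mu> a) (z a)))"
  have \<eta>: "\<eta> > 0" "\<eta> \<le> L (z a)" and p: "p > 0" "p \<le> pmf (\<mu> a) (z a)" for a
    using z by (auto simp: \<eta>_def p_def)
  have up: "p \<le> measure (K s) {e. \<eta> \<le> l e}" for s
  proof -
    obtain q where q: "K s = choice_step q \<mu>" using K_eq by blast
    have "ennreal p = (\<integral>\<^sup>+a. ennreal p \<partial>q)" by (simp add: measure_pmf.emeasure_space_1[simplified])
    also have "\<dots> \<le> (\<integral>\<^sup>+a. (\<integral>\<^sup>+\<xi>. indicator {e. \<eta> \<le> l e} (a, \<xi>) \<partial>\<mu> a) \<partial>q)"
    proof (intro nn_integral_mono)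
      fix a
      have "ennreal p \<le> emeasure (\<mu> a) {z a}" using p by (simp add: emeasure_pmf_single ennreal_leI)
      also have "\<dots> = (\<integral>\<^sup>+\<xi>. indicator {z a} \<xi> \<partial>\<mu> a)" by simp
      also have "\<dots> \<le> (\<integral>\<^sup>+\<xi>. indicator {e. \<eta> \<le> l e} (a, \<xi>) \<partial>\<mu> a)"
        using \<eta> by (intro nn_integral_mono) (auto simp: indicator_def l_def)
      finally show "ennreal p \<le> (\<integral>\<^sup>+\<xi>. indicator {e. \<eta> \<le> l e} (a, \<xi>) \<partial>\<mu> a)" .
    qed
    also have "\<dots> = emeasure (K s) {e. \<eta> \<le> l e}" unfolding q nn_integral_choice_step[symmetric] by simp
    finally show ?thesis by (simp add: measure_pmf.emeasure_eq_measure)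
  qed
  have l_val: "integrable (K s) (\<lambda>e. l e ^ k)"
    "(\<integral>e. l e ^ k \<partial>K s) = (\<Sum>a\<in>UNIV. pmf (\<phi> (snd (run \<psi> (x0, b0) s) (fst (run \<psi> (x0, b0) s)))) a * (\<integral>\<xi>. L \<xi> ^ k \<partial>\<mu> a))" for s k
    using has_integral_choice_step[where f="\<lambda>e. l e ^ k" and \<nu>=\<mu>] L_int
    unfolding K_eq by (auto simp: has_bochner_integral_iff l_def)
  define C where "C = (\<Sum>a\<in>UNIV. \<bar>\<integral>\<xi>. L \<xi> ^ 2 \<partial>\<mu> a\<bar>) + 1"
  have C: "C > 0" "(\<integral>e. l e ^ 2 \<partial>K s) \<le> C" for s
  proof -
    show "C > 0" unfolding C_def by (intro add_nonneg_pos sum_nonneg) auto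
    show "(\<integral>e. l e ^ 2 \<partial>K s) \<le> C" unfolding C_def
      using abs_sum_pmf_le[of "\<phi> (snd (run \<psi> (x0, b0) s) (fst (run \<psi> (x0, b0) s)))" "\<lambda>a. \<integral>\<xi>. L \<xi> ^ 2 \<partial>\<mu> a"]
      by (simp add: l_val(2)[of s 2])
  qed
  interpret step_process M S l by unfold_locales (rule S_measurable)
  interpret kernel_process M S l K by unfold_locales (simp add: hist_def prob_next_step)
  have weight_eq: "weight s = path_prob \<phi> \<psi> \<mu> (x0, b0) s" for s
    using prob_steps[of s] by (simp add: weight_def cyl_def hist_def)
  interpret regenerative_walk M S l
  proof
    fix g h assume "strict_record l g" "nonneg_path l h"
    then show "weight (g @ h) = weight g * weight h"
      unfolding weight_eq using path_prob_fresh_start[of L b0 g h \<phi> \<psi> \<mu> x0] L_add env_init_homogeneous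
      by (simp add: l_def[abs_def])
  next
    show "prob {\<omega>\<in>space M. \<forall>k. 0 \<le> level k \<omega>} > 0"
      by (rule never_back_positive[OF \<gamma> exp_K \<theta>(1) \<eta>(1) p(1) up])
    show "AE \<omega> in M. filterlim (\<lambda>n. level n \<omega>) at_top sequentially"
      by (rule AE_level_at_top[OF \<gamma> exp_K \<theta>(1)])
    have "\<rho>\<^sup>2 / C * real n \<le> (\<Sum>k\<le>n. prob {\<omega>\<in>space M. strict_record l (hist k \<omega>)})" for n
    proof (rule records_grow_linearly[OF _ l_val(1) \<rho>(1) _ C])
      fix s
      show "integrable (K s) l" using l_val(1)[of s 1] by simp
      show "\<rho> \<le> (\<integral>e. l e \<partial>K s)"
        using l_val(2)[of s 1] sum_pmf_ge[of \<rho> "\<lambda>a. \<integral>\<xi>. L \<xi> \<partial>\<mu> a"] \<rho>(2) by (simp add: L_mean)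
    qed
    then show "\<exists>c>0. \<forall>n. c * real n \<le> (\<Sum>k\<le>n. prob {\<omega>\<in>space M. strict_record l (hist k \<omega>)})"
      using \<rho>(1) C(1) by (intro exI[of _ "\<rho>\<^sup>2 / C"]) auto
  qed
  show ?thesis by (rule step_averages_converge[of "\<lambda>e. of_bool (fst e = Red)"]) auto
qed

end

theorem theorem3p1:
  fixes M :: "'w measure"
    and \<mu> :: "action \<Rightarrow> (int \<times> int) pmf"
    and x0 :: "int \<times> int"
    and b0 :: "int \<times> int \<Rightarrow> action \<Rightarrow> real"
    and \<phi> :: "(action \<Rightarrow> real) \<Rightarrow> action pmf"
    and \<psi> :: "(action \<Rightarrow> real) \<Rightarrow> (action \<Rightarrow> real) \<Rightarrow> int \<times> int \<Rightarrow> action \<Rightarrow> real"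
    and X :: "nat \<Rightarrow> 'w \<Rightarrow> int \<times> int"
    and A :: "nat \<Rightarrow> 'w \<Rightarrow> action"
    and \<beta> :: "nat \<Rightarrow> 'w \<Rightarrow> int \<times> int \<Rightarrow> action \<Rightarrow> real"
  assumes "model2 \<mu>"
    and "local_learning_process M (model2_transition \<mu>) x0 b0 \<phi> \<psi> X A \<beta>"
  shows "\<exists>\<alpha>::real.
    (AE \<omega> in M. (\<lambda>n. 1 / real n * (\<Sum>i=1..n. of_bool (A i \<omega> = Red))) \<longlonglongrightarrow> \<alpha>) \<and>
    (AE \<omega> in M. (\<lambda>n. real_point (X n \<omega>) /\<^sub>R real n)
       \<longlonglongrightarrow> \<alpha> *\<^sub>R drift (\<mu> Red) + (1 - \<alpha>) *\<^sub>R drift (\<mu> Green))"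
proof -
  interpret model2_process M \<mu> x0 b0 \<phi> \<psi> X A \<beta>
    using assms(2) by (simp add: model2_process_def)
  obtain c where c: "c > 0" "\<And>a. integrable (\<mu> a) (\<lambda>\<xi>. exp (c * norm (real_point \<xi>)))"
    using assms(1) by (auto simp: model2_def)
  obtain u where u: "norm u = 1" "0 < drift (\<mu> Red) \<bullet> u" "0 < drift (\<mu> Green) \<bullet> u"
    using assms(1) by (auto simp: model2_def)
  have "0 < drift (\<mu> a) \<bullet> u" for a using u by (cases a) auto
  from action_frequencies_converge[OF c u(1) this] obtain \<alpha> where
    \<alpha>: "AE \<omega> in M. (\<lambda>n. (\<Sum>i<n. of_bool (fst (S i \<omega>) = Red)) / real n) \<longlonglongrightarrow> \<alpha>" by blast
  define N where "N n \<omega> = (\<Sum>i<n. of_bool (A i \<omega> = Red) :: real)" for n \<omega>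
  have freq: "AE \<omega> in M. (\<lambda>n. N n \<omega> / real n) \<longlonglongrightarrow> \<alpha>"
    using \<alpha> by (simp add: N_def S_def)
  have "AE \<omega> in M. (\<lambda>n. 1 / real n * (\<Sum>i=1..n. of_bool (A i \<omega> = Red))) \<longlonglongrightarrow> \<alpha>"
    using freq
  proof eventually_elim
    case (elim \<omega>)
    have "(\<lambda>n. N (Suc n) \<omega> / real (Suc n) * (real (Suc n) / real n) - of_bool (A 0 \<omega> = Red) / real n) \<longlonglongrightarrow> \<alpha> * 1 - 0"
      by (intro tendsto_intros LIMSEQ_Suc[OF elim] LIMSEQ_Suc_n_over_n lim_const_over_n)
    moreover have "eventually (\<lambda>n. N (Suc n) \<omega> / real (Suc n) * (real (Suc n) / real n) - of_bool (A 0 \<omega> = Red) / real n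
        = 1 / real n * (\<Sum>i=1..n. of_bool (A i \<omega> = Red))) sequentially"
    proof (rule always_eventually, rule allI)
      fix n
      define s where "s = (\<Sum>i=1..n. of_bool (A i \<omega> = Red) :: real)"
      have "N (Suc n) \<omega> = of_bool (A 0 \<omega> = Red) + s"
        unfolding N_def s_def lessThan_Suc_atMost atMost_atLeast0 by (subst sum.atLeast_Suc_atMost) auto
      moreover have "N (Suc n) \<omega> / real (Suc n) * (real (Suc n) / real n) = N (Suc n) \<omega> / real n"
        by (simp del: of_nat_Suc)
      ultimately show "N (Suc n) \<omega> / real (Suc n) * (real (Suc n) / real n) - of_bool (A 0 \<omega> = Red) / real n
        = 1 / real n * (\<Sum>i=1..n. of_bool (A i \<omega> = Red))"
        unfolding s_def[symmetric] by (simp add: add_divide_distrib del: of_nat_Suc)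
    qed
    ultimately show ?case using tendsto_cong by force
  qed
  moreover have "AE \<omega> in M. (\<lambda>n. real_point (X n \<omega>) /\<^sub>R real n)
       \<longlonglongrightarrow> \<alpha> *\<^sub>R drift (\<mu> Red) + (1 - \<alpha>) *\<^sub>R drift (\<mu> Green)"
    using freq AE_drift_corrected_position[OF c, of "(1, 0)"] AE_drift_corrected_position[OF c, of "(0, 1)"]
  proof eventually_elim
    case (elim \<omega>)
    define E where "E n = (\<Sum>i<n. real_point (snd (S i \<omega>)) - drift (\<mu> (fst (S i \<omega>))))" for n
    have "(\<lambda>n. (E n \<bullet> (1, 0)) / real n) \<longlonglongrightarrow> 0" "(\<lambda>n. (E n \<bullet> (0, 1)) / real n) \<longlonglongrightarrow> 0"
      using elim(2,3) by (simp_all add: E_def inner_sum_left)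
    then have "(\<lambda>n. (fst (E n) / real n, snd (E n) / real n)) \<longlonglongrightarrow> (0, 0)"
      by (intro tendsto_Pair) (simp_all add: inner_prod_def)
    moreover have "(fst (E n) / real n, snd (E n) / real n) = E n /\<^sub>R real n" for n
      by (simp add: prod_eq_iff divide_inverse mult.commute)
    ultimately have E: "(\<lambda>n. E n /\<^sub>R real n) \<longlonglongrightarrow> 0" by (simp add: zero_prod_def)
    have pos: "real_point (X n \<omega>) = real_point (X 0 \<omega>) + E n + N n \<omega> *\<^sub>R drift (\<mu> Red) + (real n - N n \<omega>) *\<^sub>R drift (\<mu> Green)" for n
    proof (induction n)
      case (Suc n)
      have "real_point (X (Suc n) \<omega>) = real_point (X n \<omega>) + real_point (X (Suc n) \<omega> - X n \<omega>)"
        by (simp add: real_point_diff)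
      with Suc show ?case
        by (cases "A n \<omega>") (simp_all add: E_def N_def S_def algebra_simps)
    qed (simp add: E_def N_def)
    have "(\<lambda>n. real_point (X 0 \<omega>) /\<^sub>R real n + E n /\<^sub>R real n + (N n \<omega> / real n) *\<^sub>R drift (\<mu> Red) + (1 - N n \<omega> / real n) *\<^sub>R drift (\<mu> Green))
        \<longlonglongrightarrow> 0 + 0 + \<alpha> *\<^sub>R drift (\<mu> Red) + (1 - \<alpha>) *\<^sub>R drift (\<mu> Green)"
    proof (intro tendsto_intros E elim(1))
      have "(\<lambda>n. inverse (real n) *\<^sub>R real_point (X 0 \<omega>)) \<longlonglongrightarrow> 0 *\<^sub>R real_point (X 0 \<omega>)"
        by (intro tendsto_intros lim_inverse_n)
      then show "(\<lambda>n. real_point (X 0 \<omega>) /\<^sub>R real n) \<longlonglongrightarrow> 0" by simp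
    qed
    moreover have "eventually (\<lambda>n. real_point (X 0 \<omega>) /\<^sub>R real n + E n /\<^sub>R real n + (N n \<omega> / real n) *\<^sub>R drift (\<mu> Red) + (1 - N n \<omega> / real n) *\<^sub>R drift (\<mu> Green)
        = real_point (X n \<omega>) /\<^sub>R real n) sequentially"
      using eventually_gt_at_top[of 0]
    proof eventually_elim
      case (elim n)
      then have "1 - N n \<omega> / real n = inverse (real n) * (real n - N n \<omega>)" by (simp add: field_simps)
      then show ?case unfolding pos[of n] by (simp add: scaleR_add_right divide_inverse mult.commute)
    qed
    ultimately show ?case by (simp add: tendsto_cong)
  qed
  ultimately show ?thesis by blast
qed

end
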